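(* For each basic set $U=\gamma+\alpha\mathrm{M}_2(\mathbb{Z})$ ($\gamma\in\mathrm{M}_2(\mathbb{Q})$, $\alpha\in\mathbb{Q}^\times$) let $\mu(U)\in\widetilde{\mathcal S}_2$ be the class of $H\big(E_{U_1}(\tau,X)\,E_{U_2}(\tau,Y)\big)$. Then: (1) $\mu$ satisfies the distribution relations: whenever a basic set $U$ is a finite disjoint union of basic sets $U^{(1)},\dots,U^{(r)}$, $\mu(U)=\sum_k\mu(U^{(k)})$; hence $\mu$ extends uniquely to an element of $\mathcal{D}_{naive}(\mathrm{M}_2(\mathbb{Q}),\widetilde{\mathcal S}_2)$. (2) $\rho\mu=\mu$ for every diagonal matrix $\rho=\begin{pmatrix}a&0\\0&d\end{pmatrix}\in\mathrm{GL}_2(\mathbb{Q})$.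
   Context: For a compact open $V\subseteq\mathbb{Q}^2$ (finite union of cosets $v+\alpha\mathbb{Z}^2$) put $V_\tau=\{a_1\tau+a_2:\binom{a_1}{a_2}\in V\}$, $\phi_{n,V}(z,\tau)$ the value at $s=0$ of the analytic continuation of $\sum_{\omega\in V_\tau}{}'(z+\omega)^{-n}|z+\omega|^{-s}$ (term $\omega=-z$ omitted if present), and $E_V(\tau,X)=\sum_{n\ge0}(-1)^n\phi_{n+1,V}(0,\tau)X^n$. For $U\subseteq\mathrm{M}_2(\mathbb{Q})$, $U_1=\{u\binom10:u\in U\}$, $U_2=\{u\binom01:u\in U\}$. Compact open subsets of $\mathrm{M}_2(\mathbb{Q})$ are finite unions of basic sets, and $\mathcal{D}_{naive}(\mathrm{M}_2(\mathbb{Q}),M)$ is the set of finitely additive $M$-valued functions on them. Nearly holomorphic modular forms of weight $k$ for a congruence subgroup $\Gamma$: $C^\infty$ functions on $\mathcal H$, slowly increasing at the cusps, killed by a power of $(\tau-\bar\tau)^2\partial_{\bar\tau}$, invariant under the weight-$k$ slash action of $\Gamma$; space $\mathcal N_k(\Gamma)$. With $\delta_k=\partial_\tau+k/(\tau-\bar\tau)$, the holomorphic projection $H:\mathcal N_k(\Gamma)\to M_k(\Gamma)$ is the linear map with $H(f)=f$ for holomorphic $f$ and, for $k\ge3$, $H(\delta_{k-2}g)=0$ for $g\in\mathcal N_{k-2}(\Gamma)$; it acts coefficientwise on power series. $\widetilde M_2$ (resp. $\widetilde{\mathcal E}_2$) is the set of $\sum_{i,j\ge0}h_{ij}X^iY^j$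 with all $h_{ij}\in M_{i+j+2}(\Gamma)$ (resp. in the holomorphic Eisenstein subspace $\mathcal E_{i+j+2}(\Gamma)$) for some congruence subgroup $\Gamma$; $\widetilde{\mathcal S}_2=\widetilde M_2/\widetilde{\mathcal E}_2$. $\mathrm{GL}_2(\mathbb{Q})$ acts on $\mathcal{D}_{naive}(\mathrm{M}_2(\mathbb{Q}),\widetilde{\mathcal S}_2)$ by $(\rho\mu)(U)(X,Y)=\det(\rho)\,\mu(U\rho)\big((X\ Y)\rho\big)$, with $(X\ Y)\rho=(aX+cY,\,bX+dY)$ for $\rho=\begin{pmatrix}a&b\\c&d\end{pmatrix}$. *)

theory Defs
  imports
    "HOL-Complex_Analysis.Complex_Analysis"
    "HOL-Number_Theory.Cong"
    "HOL-Algebra.Coset"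
    "HOL-Algebra.FiniteProduct"
begin

section \<open>Compact open sets and finitely additive functions\<close>

definition Z2 :: "(rat^2) set" where
  "Z2 = {v. \<forall>i. v $ i \<in> \<int>}"

definition M2Z :: "(rat^2^2) set" where
  "M2Z = {m. \<forall>i j. m $ i $ j \<in> \<int>}"

definition basic_vec :: "(rat^2) set \<Rightarrow> bool" where
  "basic_vec V \<longleftrightarrow> (\<exists>v \<alpha>. \<alpha> \<noteq> 0 \<and> V = (\<lambda>z. v + \<alpha> *s z) ` Z2)"

definition compact_open_vec :: "(rat^2) set \<Rightarrow> bool" where
  "compact_open_vec V \<longleftrightarrow> (\<exists>\<V>. finite \<V> \<and> (\<forall>B\<in>\<V>. basic_vec B) \<and> V = \<Union>\<V>)"

text \<open>Here \<^term>\<open>mat \<alpha> ** m\<close> is the scalar multiple of the matrix \<^term>\<open>m\<close> by \<^term>\<open>\<alpha>\<close>.\<close>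

definition basic_mat :: "(rat^2^2) set \<Rightarrow> bool" where
  "basic_mat U \<longleftrightarrow> (\<exists>\<gamma> \<alpha>. \<alpha> \<noteq> 0 \<and> U = (\<lambda>m. \<gamma> + mat \<alpha> ** m) ` M2Z)"

definition compact_open_mat :: "(rat^2^2) set \<Rightarrow> bool" where
  "compact_open_mat U \<longleftrightarrow> (\<exists>\<U>. finite \<U> \<and> (\<forall>B\<in>\<U>. basic_mat B) \<and> U = \<Union>\<U>)"

definition fst_col :: "(rat^2^2) set \<Rightarrow> (rat^2) set" where
  "fst_col U = (\<lambda>u. u *v vector [1, 0]) ` U"

definition snd_col :: "(rat^2^2) set \<Rightarrow> (rat^2) set" where
  "snd_col U = (\<lambda>u. u *v vector [0, 1]) ` U"

text \<open>The coefficient group is written multiplicatively, as everywhere in HOL-Algebra.  The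
  functions are extensional, so that equality in the set below is equality on compact open sets.\<close>

definition D_naive :: "('m, 'b) monoid_scheme \<Rightarrow> ((rat^2^2) set \<Rightarrow> 'm) set" where
  "D_naive G = {\<nu> \<in> Collect compact_open_mat \<rightarrow>\<^sub>E carrier G.
     \<forall>A B. compact_open_mat A \<longrightarrow> compact_open_mat B \<longrightarrow> A \<inter> B = {} \<longrightarrow>
       \<nu> (A \<union> B) = \<nu> A \<otimes>\<^bsub>G\<^esub> \<nu> B}"


section \<open>Eisenstein--Kronecker series\<close>

definition uhp :: "complex set" where
  "uhp = {\<tau>. Im \<tau> > 0}"

text \<open>Functions on the upper half-plane are represented by functions on \<^typ>\<open>complex\<close> that
  vanish outside of it.\<close>

definition on_uhp :: "(complex \<Rightarrow> complex) \<Rightarrow> complex \<Rightarrow> complex" where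
  "on_uhp f = (\<lambda>\<tau>. if \<tau> \<in> uhp then f \<tau> else 0)"

definition lat :: "(rat^2) set \<Rightarrow> complex \<Rightarrow> complex set" where
  "lat V \<tau> = (\<lambda>a. of_rat (a $ 1) * \<tau> + of_rat (a $ 2)) ` V"

definition eis_sum :: "nat \<Rightarrow> (rat^2) set \<Rightarrow> complex \<Rightarrow> complex \<Rightarrow> complex \<Rightarrow> complex" where
  "eis_sum n V z \<tau> s =
     (\<Sum>\<^sub>\<infinity>\<omega>\<in>lat V \<tau> - {- z}. inverse ((z + \<omega>) ^ n) * of_real (cmod (z + \<omega>)) powr (- s))"

text \<open>The series converges absolutely for \<^prop>\<open>Re s > 2 - real n\<close>.  For \<^prop>\<open>n \<ge> 1\<close> (the only
  case used) its continuation has no poles; the value at \<open>0\<close> is determined by the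
  continuation to any half-plane containing \<open>0\<close>, by the identity theorem.\<close>

definition phi :: "nat \<Rightarrow> (rat^2) set \<Rightarrow> complex \<Rightarrow> complex \<Rightarrow> complex" where
  "phi n V z \<tau> = (THE c. \<exists>F. \<exists>\<epsilon>>0. F holomorphic_on {s. Re s > - \<epsilon>} \<and>
     (\<forall>s. Re s > 2 - real n \<longrightarrow> F s = eis_sum n V z \<tau> s) \<and> F 0 = c)"

definition E_ser :: "(rat^2) set \<Rightarrow> complex \<Rightarrow> complex fps" where
  "E_ser V \<tau> = Abs_fps (\<lambda>n. (-1) ^ n * phi (n + 1) V 0 \<tau>)"


section \<open>Modular forms\<close>

definition SL2Z :: "(int^2^2) monoid" where
  "SL2Z = \<lparr>carrier = {A. det A = 1}, mult = (**), one = mat 1\<rparr>"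

definition Gamma_principal :: "nat \<Rightarrow> (int^2^2) set" where
  "Gamma_principal N = {A. det A = 1 \<and> (\<forall>i j. [A $ i $ j = mat 1 $ i $ j] (mod int N))}"

definition congruence_subgroup :: "(int^2^2) set \<Rightarrow> bool" where
  "congruence_subgroup \<Gamma> \<longleftrightarrow> subgroup \<Gamma> SL2Z \<and> (\<exists>N>0. Gamma_principal N \<subseteq> \<Gamma>)"

text \<open>Only used for matrices of determinant one, so there is no determinant factor.\<close>

definition slash :: "nat \<Rightarrow> (complex \<Rightarrow> complex) \<Rightarrow> int^2^2 \<Rightarrow> complex \<Rightarrow> complex" where
  "slash k f \<gamma> \<tau> =
     f ((of_int (\<gamma> $ 1 $ 1) * \<tau> + of_int (\<gamma> $ 1 $ 2)) / (of_int (\<gamma> $ 2 $ 1) * \<tau> + of_int (\<gamma> $ 2 $ 2)))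
       / (of_int (\<gamma> $ 2 $ 1) * \<tau> + of_int (\<gamma> $ 2 $ 2)) ^ k"

definition slash_invariant :: "nat \<Rightarrow> (int^2^2) set \<Rightarrow> (complex \<Rightarrow> complex) \<Rightarrow> bool" where
  "slash_invariant k \<Gamma> f \<longleftrightarrow> (\<forall>\<gamma>\<in>\<Gamma>. \<forall>\<tau>\<in>uhp. slash k f \<gamma> \<tau> = f \<tau>)"

definition slowly_increasing :: "nat \<Rightarrow> (complex \<Rightarrow> complex) \<Rightarrow> bool" where
  "slowly_increasing k f \<longleftrightarrow> (\<forall>\<sigma>\<in>carrier SL2Z. \<exists>A B C :: real. B > 0 \<and>
     (\<forall>\<tau>. Im \<tau> > B \<longrightarrow> cmod (slash k f \<sigma> \<tau>) \<le> A * Im \<tau> powr C))"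

definition bounded_at_cusps :: "nat \<Rightarrow> (complex \<Rightarrow> complex) \<Rightarrow> bool" where
  "bounded_at_cusps k f \<longleftrightarrow> (\<forall>\<sigma>\<in>carrier SL2Z. \<exists>A B :: real. B > 0 \<and>
     (\<forall>\<tau>. Im \<tau> > B \<longrightarrow> cmod (slash k f \<sigma> \<tau>) \<le> A))"

text \<open>Differentiability is over the reals here, and likewise in the Wirtinger derivatives.\<close>

fun C_diff_on :: "nat \<Rightarrow> complex set \<Rightarrow> (complex \<Rightarrow> complex) \<Rightarrow> bool" where
  "C_diff_on 0 S f \<longleftrightarrow> continuous_on S f"
| "C_diff_on (Suc n) S f \<longleftrightarrow> (\<forall>x\<in>S. f differentiable (at x)) \<and>
     (\<forall>v. C_diff_on n S (\<lambda>x. frechet_derivative f (at x) v))"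

definition smooth_uhp :: "(complex \<Rightarrow> complex) \<Rightarrow> bool" where
  "smooth_uhp f \<longleftrightarrow> (\<forall>n. C_diff_on n uhp f)"

definition d_tau :: "(complex \<Rightarrow> complex) \<Rightarrow> complex \<Rightarrow> complex" where
  "d_tau f \<tau> = (frechet_derivative f (at \<tau>) 1 - \<i> * frechet_derivative f (at \<tau>) \<i>) / 2"

definition d_taubar :: "(complex \<Rightarrow> complex) \<Rightarrow> complex \<Rightarrow> complex" where
  "d_taubar f \<tau> = (frechet_derivative f (at \<tau>) 1 + \<i> * frechet_derivative f (at \<tau>) \<i>) / 2"

definition lowering :: "(complex \<Rightarrow> complex) \<Rightarrow> complex \<Rightarrow> complex" where
  "lowering f \<tau> = (\<tau> - cnj \<tau>)\<^sup>2 * d_taubar f \<tau>"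

definition delta :: "nat \<Rightarrow> (complex \<Rightarrow> complex) \<Rightarrow> complex \<Rightarrow> complex" where
  "delta k f = on_uhp (\<lambda>\<tau>. d_tau f \<tau> + of_nat k / (\<tau> - cnj \<tau>) * f \<tau>)"

definition nearly_hol_forms :: "nat \<Rightarrow> (int^2^2) set \<Rightarrow> (complex \<Rightarrow> complex) set" where
  "nearly_hol_forms k \<Gamma> = {f. (\<forall>\<tau>. \<tau> \<notin> uhp \<longrightarrow> f \<tau> = 0) \<and> smooth_uhp f \<and>
     slowly_increasing k f \<and> (\<exists>r. \<forall>\<tau>\<in>uhp. (lowering ^^ r) f \<tau> = 0) \<and> slash_invariant k \<Gamma> f}"

definition modular_forms :: "nat \<Rightarrow> (int^2^2) set \<Rightarrow> (complex \<Rightarrow> complex) set" where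
  "modular_forms k \<Gamma> = {f. (\<forall>\<tau>. \<tau> \<notin> uhp \<longrightarrow> f \<tau> = 0) \<and> f holomorphic_on uhp \<and>
     bounded_at_cusps k f \<and> slash_invariant k \<Gamma> f}"

text \<open>The modular forms for \<open>\<Gamma>\<close> that are linear combinations of Eisenstein series of weight \<open>k\<close>
  (of any level).  In weight \<open>2\<close> the individual series need not be holomorphic.\<close>

definition eisenstein_forms :: "nat \<Rightarrow> (int^2^2) set \<Rightarrow> (complex \<Rightarrow> complex) set" where
  "eisenstein_forms k \<Gamma> = {f \<in> modular_forms k \<Gamma>.
     \<exists>\<V> c. finite \<V> \<and> (\<forall>V\<in>\<V>. compact_open_vec V) \<and>
       (\<forall>\<tau>\<in>uhp. f \<tau> = (\<Sum>V\<in>\<V>. c V * phi k V 0 \<tau>))}"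

text \<open>A holomorphic projection is given by one map in each weight, independent of the group.
  Conversely the conditions determine it on nearly holomorphic forms: for \<^prop>\<open>k \<ge> 3\<close> because such
  a form is a holomorphic one plus an element of the image of \<^const>\<open>delta\<close>, and for \<^prop>\<open>k = 2\<close>
  because the nonholomorphic level one series \<open>E\<^sub>2\<close> has to go to \<open>0\<close>.\<close>

definition holomorphic_projection ::
    "(nat \<Rightarrow> (complex \<Rightarrow> complex) \<Rightarrow> complex \<Rightarrow> complex) \<Rightarrow> bool" where
  "holomorphic_projection H \<longleftrightarrow> (\<forall>\<Gamma> k. congruence_subgroup \<Gamma> \<longrightarrow>
     (\<forall>f\<in>nearly_hol_forms k \<Gamma>. H k f \<in> modular_forms k \<Gamma>) \<and>
     (\<forall>f\<in>nearly_hol_forms k \<Gamma>. \<forall>g\<in>nearly_hol_forms k \<Gamma>.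
        H k (\<lambda>\<tau>. f \<tau> + g \<tau>) = (\<lambda>\<tau>. H k f \<tau> + H k g \<tau>)) \<and>
     (\<forall>f\<in>nearly_hol_forms k \<Gamma>. \<forall>c. H k (\<lambda>\<tau>. c * f \<tau>) = (\<lambda>\<tau>. c * H k f \<tau>)) \<and>
     (\<forall>f\<in>nearly_hol_forms k \<Gamma>. f holomorphic_on uhp \<longrightarrow> H k f = f) \<and>
     (k \<ge> 3 \<longrightarrow> (\<forall>g\<in>nearly_hol_forms (k - 2) \<Gamma>. H k (delta (k - 2) g) = (\<lambda>\<tau>. 0))))"


section \<open>Power series of modular forms\<close>

text \<open>The entry of \<open>h\<close> at \<open>i\<close>, \<open>j\<close> is the coefficient of \<open>X\<^sup>i Y\<^sup>j\<close>.\<close>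

type_synonym mf_series = "nat \<Rightarrow> nat \<Rightarrow> complex \<Rightarrow> complex"

definition M2_tilde :: "mf_series monoid" where
  "M2_tilde = \<lparr>
     carrier = {h. \<exists>\<Gamma>. congruence_subgroup \<Gamma> \<and> (\<forall>i j. h i j \<in> modular_forms (i + j + 2) \<Gamma>)},
     mult = (\<lambda>g h i j \<tau>. g i j \<tau> + h i j \<tau>),
     one = (\<lambda>i j \<tau>. 0)\<rparr>"

definition E2_tilde :: "mf_series set" where
  "E2_tilde = {h. \<exists>\<Gamma>. congruence_subgroup \<Gamma> \<and> (\<forall>i j. h i j \<in> eisenstein_forms (i + j + 2) \<Gamma>)}"

definition S2_tilde :: "mf_series set monoid" where
  "S2_tilde = M2_tilde Mod E2_tilde"

definition mu :: "(nat \<Rightarrow> (complex \<Rightarrow> complex) \<Rightarrow> complex \<Rightarrow> complex) \<Rightarrow>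
    (rat^2^2) set \<Rightarrow> mf_series set" where
  "mu H U = E2_tilde #>\<^bsub>M2_tilde\<^esub> (\<lambda>i j. H (i + j + 2)
     (on_uhp (\<lambda>\<tau>. fps_nth (E_ser (fst_col U) \<tau>) i * fps_nth (E_ser (snd_col U) \<tau>) j)))"

text \<open>The series \<open>det(\<rho>) h((X Y)\<rho>)\<close>.  In \<^typ>\<open>complex poly poly\<close> the inner variable is \<open>X\<close> and the
  outer one is \<open>Y\<close>; the substitution preserves total degrees.\<close>

definition gl_series :: "rat^2^2 \<Rightarrow> mf_series \<Rightarrow> mf_series" where
  "gl_series \<rho> h = (\<lambda>i j \<tau>. of_rat (det \<rho>) *
     (\<Sum>p\<le>i + j. coeff (coeff
          ([:[:0, of_rat (\<rho> $ 1 $ 1):], [:of_rat (\<rho> $ 2 $ 1):]:] ^ p *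
           [:[:0, of_rat (\<rho> $ 1 $ 2):], [:of_rat (\<rho> $ 2 $ 2):]:] ^ (i + j - p)) j) i
        * h p (i + j - p) \<tau>))"

text \<open>For invertible \<open>\<rho>\<close> the map \<^term>\<open>gl_series \<rho>\<close> is a bijection preserving \<^const>\<open>E2_tilde\<close>, so
  the image of a coset is again a coset.\<close>

definition gl_act :: "rat^2^2 \<Rightarrow> ((rat^2^2) set \<Rightarrow> mf_series set) \<Rightarrow>
    (rat^2^2) set \<Rightarrow> mf_series set" where
  "gl_act \<rho> \<nu> = restrict (\<lambda>U. gl_series \<rho> ` \<nu> ((\<lambda>u. u ** \<rho>) ` U)) (Collect compact_open_mat)"

end

theory Submission
  imports Defs
begin

text \<open>
  The product \<open>E\<^bsub>V\<^esub>(\<tau>, X) E\<^bsub>W\<^esub>(\<tau>, Y)\<close> is additive in \<open>V\<close> and in \<open>W\<close>, and \<open>E\<^bsub>aV\<^esub>(\<tau>, X) = a\<^bsup>-1\<^esup> E\<^bsub>V\<^esub>(\<tau>, X/a)\<close>.  So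
  the products define a finitely additive function on compact open sets of matrices, compatible with
  the action of diagonal matrices already before passing to the quotient, and \<open>H\<close> preserves this because
  it is linear.  The content is that the products are nearly holomorphic modular forms, which is what
  makes \<open>H\<close> linear on them.

  By homogeneity it suffices to treat \<open>V = v + \<int>\<^sup>2\<close>; let \<open>N v \<in> \<int>\<^sup>2\<close>.  For weights at least three the series
  converges at \<open>s = 0\<close>.  In general write \<open>f(w) = w\<^bsup>-n\<^esup> |w|\<^bsup>-s\<^esup>\<close>; the series over \<open>v + \<int>\<^sup>2\<close> minus the one over \<open>\<int>\<^sup>2\<close>
  equals the sum over \<open>l\<close> of \<open>f(l + v) - (1 - 1/N) f(l) - f(l + N v)/N\<close>, where the Taylor terms up to first
  order cancel, so it converges for \<open>Re s > -n\<close> and is holomorphic in \<open>\<tau>\<close> at \<open>s = 0\<close>.  The series over \<open>\<int>\<^sup>2\<close>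
  vanishes in weight one.  In weight two, comparing derivatives and differences of \<open>w\<^bsup>-1\<^esup> |w|\<^bsup>-s\<^esup>\<close> along rows
  reduces it to \<open>s \<Sum> |w|\<^bsup>-2-s\<^esup>\<close>, whose value at \<open>s = 0\<close> is \<open>2\<pi> / Im \<tau>\<close>.
\<close>

section \<open>Estimates for the summands\<close>

text \<open>\<open>phi\<close> is defined by a unique choice, so nothing can be said about its
  values until a continuation has been exhibited. The relation \<open>has_phi\<close> therefore
  carries convergence, holomorphy and a continuation together, and additivity, homogeneity and
  modularity are proved for that relation. A continuation slightly to the left of 0 suffices,
  because every half-plane containing 0 determines the value. A product of two series is a
  polynomial of degree at most two in \<open>1 / (\<tau> - cnj \<tau>)\<close> over the functions
  holomorphic in \<tau>; on such polynomials \<open>lowering\<close> acts as the derivative with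
  respect to that variable, hence is nilpotent. Slow increase asks for bounds uniform in Re \<tau>.
  The estimates give bounds uniform on vertical strips, with constants independent of \<tau> up to a
  polynomial factor, and periodicity covers the other \<tau>. Linearity of \<open>H\<close> is
  available only among forms for one group. Hence a single level N has to serve all coefficients i,
  j. It exists because N only has to make the principal congruence subgroup preserve the two cosets,
  whatever the weight.\<close>

definition eis_term :: "nat \<Rightarrow> complex \<Rightarrow> complex \<Rightarrow> complex" where
  "eis_term n s w = inverse (w ^ n) * of_real (cmod w) powr (- s)"

text \<open>\<open>0 powr a = 0\<close> makes the summand vanish at 0 even for \<open>n = 0\<close>,
  so the term omitted from the primed sum never has to be excluded from an index set.\<close>

lemma eis_term_0 [simp]: "eis_term n s 0 = 0"
  by (simp add: eis_term_def)

lemma eis_term_at_0: "w \<noteq> 0 \<Longrightarrow> eis_term n 0 w = inverse (w ^ n)"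
  by (simp add: eis_term_def)

lemma eis_term_eq_exp: "w \<noteq> 0 \<Longrightarrow> eis_term n s w = inverse (w ^ n) * exp (- (s * of_real (ln (cmod w))))"
  by (simp add: eis_term_def powr_def Ln_of_real)

lemma norm_eis_term: "w \<noteq> 0 \<Longrightarrow> norm (eis_term n s w) = cmod w powr - (real n + Re s)"
  by (simp add: eis_term_def norm_mult norm_inverse norm_power norm_powr_real_powr
      powr_diff powr_realpow powr_minus[of _ "real n"] divide_inverse powr_minus mult.commute)

text \<open>Only the nonnegative real number |w| is raised to a complex power, so no branch of the
  logarithm interferes. Scaling of lattices and the automorphy factor both come from this
  multiplicativity.\<close>

lemma eis_term_mult: "eis_term n s (a * w) = eis_term n s a * eis_term n s w"
  by (simp add: eis_term_def norm_mult powr_times_real power_mult_distrib)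

lemma eis_term_minus: "eis_term n s (- w) = (- 1) ^ n * eis_term n s w"
  by (cases "even n") (simp_all add: eis_term_def)

lemma eis_term_holomorphic_in_s: "(\<lambda>s. eis_term n s w) holomorphic_on A"
  by (cases "w = 0") (auto simp: eis_term_eq_exp intro!: holomorphic_intros)

text \<open>The error of the real-linear Taylor polynomial at \<open>l\<close>; for \<open>l = 0\<close> that polynomial is \<open>0\<close>, since
  \<open>eis_term n s 0 = 0\<close>.\<close>

definition eis_rem :: "nat \<Rightarrow> complex \<Rightarrow> complex \<Rightarrow> complex \<Rightarrow> complex" where
  "eis_rem n s l v =
     eis_term n s (l + v) - eis_term n s l * (1 - of_nat n * (v / l) - s * of_real (Re (v / l)))"

lemma eis_rem_holomorphic_in_s: "(\<lambda>s. eis_rem n s l v) holomorphic_on A"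
  unfolding eis_rem_def by (intro holomorphic_intros eis_term_holomorphic_in_s)

text \<open>With L = Ln (1 + z) the summand is exp E for E = - n L - s Re L. The error splits into
  exp E - 1 - E and the contribution of L - z to E. Both are quadratic in z, and the two summands of
  \<open>K\<close> are, in reverse order, their constants.\<close>

lemma eis_term_taylor:
  fixes R :: real and n :: nat
  assumes "norm s \<le> R" "norm z < 1/2"
  defines "K \<equiv> (real n + R) * 2 + (2 * (real n + R))\<^sup>2 * exp (real n + R)"
  shows "norm (eis_term n s (1 + z) - (1 - of_nat n * z - s * of_real (Re z))) \<le> K * norm z ^ 2"
proof -
  define L where "L = Ln (1 + z)"
  have R: "R \<ge> 0" using assms(1) norm_ge_zero order_trans by blast
  have nz: "1 + z \<noteq> 0"
  proof
    assume "1 + z = 0"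
    then have "z = - 1" by (simp add: eq_neg_iff_add_eq_0 add.commute)
    then show False using assms(2) by simp
  qed
  have L1: "norm L \<le> 2 * norm z" unfolding L_def by (rule norm_Ln_le[OF assms(2)])
  have "norm (L - z) \<le> norm z^2 / (1 - norm z)"
    unfolding L_def using assms(2) by (intro Ln_approx_linear) auto
  also have "\<dots> \<le> norm z ^ 2 * 2"
    using divide_left_mono[of "1/2" "1 - norm z" "norm z ^ 2"] assms(2) by simp
  finally have L2: "norm (L - z) \<le> 2 * norm z ^ 2" by simp
  define E where "E = - (of_nat n * L) - s * of_real (Re L)"
  have E: "norm E \<le> (real n + R) * (2 * norm z)"
  proof -
    have "norm E \<le> norm (of_nat n * L) + norm (s * of_real (Re L))"
      unfolding E_def by (metis norm_minus_cancel norm_triangle_ineq4)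
    also have "\<dots> \<le> real n * norm L + R * norm L"
      by (simp add: norm_mult) (use R assms(1) abs_Re_le_cmod[of L] in \<open>auto intro!: mult_mono\<close>)
    also have "\<dots> = (real n + R) * norm L" by (simp add: algebra_simps)
    also have "\<dots> \<le> (real n + R) * (2 * norm z)" using L1 R by (intro mult_left_mono) auto
    finally show ?thesis .
  qed
  have ex: "eis_term n s (1 + z) = exp E"
  proof -
    have "exp (- (of_nat n * L)) = inverse ((1+z)^n)"
      by (simp add: exp_minus exp_of_nat_mult L_def nz)
    moreover have "Re L = ln (cmod (1 + z))" unfolding L_def using nz by simp
    ultimately show ?thesis
      using nz by (simp add: eis_term_eq_exp E_def exp_diff exp_minus divide_inverse)
  qed
  have "norm (exp E - (1 + E)) \<le> exp \<bar>Re E\<bar> * norm E ^ 2"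
    using Taylor_exp[of E 1] by (simp add: numeral_2_eq_2)
  also have "\<dots> \<le> exp (real n + R) * ((real n + R) * (2 * norm z))\<^sup>2"
  \<comment> \<open>Since |z| < 1/2, the bound on |E| is at most n + R, which turns the exponential
    factor into a constant.\<close>
  proof (intro mult_mono power_mono E)
    have "\<bar>Re E\<bar> \<le> norm E" by (rule abs_Re_le_cmod)
    also note E
    also have "(real n + R) * (2 * norm z) \<le> (real n + R) * 1"
      using assms(2) R by (intro mult_left_mono) auto
    finally show "exp \<bar>Re E\<bar> \<le> exp (real n + R)" by simp
  qed auto
  finally have 1: "norm (exp E - (1 + E)) \<le> exp (real n + R) * (2 * (real n + R))\<^sup>2 * norm z ^ 2"
    by (simp only: power_mult_distrib mult_ac)
  have "norm ((1 + E) - (1 - of_nat n * z - s * of_real (Re z))) =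
        norm (of_nat n * (L - z) + s * of_real (Re (L - z)))"
    by (subst norm_minus_cancel[symmetric]) (simp add: E_def algebra_simps)
  also have "\<dots> \<le> norm (of_nat n * (L - z)) + norm (s * of_real (Re (L - z)))"
    by (rule norm_triangle_ineq)
  also have "\<dots> \<le> real n * norm (L - z) + R * norm (L - z)"
    by (simp only: norm_mult norm_of_nat norm_of_real)
      (use R assms(1) abs_Re_le_cmod[of "L - z"] in \<open>auto intro!: mult_mono\<close>)
  also have "\<dots> = (real n + R) * norm (L - z)" by (simp add: algebra_simps)
  also have "\<dots> \<le> (real n + R) * (2 * norm z ^ 2)" using L2 R by (intro mult_left_mono) auto
  finally have 2: "norm ((1 + E) - (1 - of_nat n * z - s * of_real (Re z))) \<le> (real n + R) * 2 * norm z ^ 2"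
    by (simp only: mult.assoc)
  have "norm (eis_term n s (1 + z) - (1 - of_nat n * z - s * of_real (Re z))) \<le>
     norm (exp E - (1 + E)) + norm ((1 + E) - (1 - of_nat n * z - s * of_real (Re z)))"
    unfolding ex using norm_triangle_ineq[of "exp E - (1 + E)" "(1 + E) - (1 - of_nat n * z - s * of_real (Re z))"]
    by (simp only: diff_add_cancel add_diff_eq)
  also have "\<dots> \<le> K * norm z ^ 2"
    using 1 2 unfolding K_def by (simp add: algebra_simps)
  finally show ?thesis .
qed

text \<open>A number x \<ge> c is comparable with 1 + x, namely (1 + x) c / 2 \<le> x. The third
  exponent \<open>Q\<close> makes the constant independent of \<open>P\<close>, that is, uniform for
  s in a disc.\<close>

lemma powr_neg_le_separated:
  fixes c :: real
  assumes "0 < c" "c \<le> 1" "c \<le> x" "0 \<le> p" "p \<le> P" "P \<le> Q"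
  shows "x powr - P \<le> (2 / c) powr Q * (1 + x) powr - p"
proof -
  have x: "x > 0" using assms by linarith
  have "(1 + x) * c / 2 \<le> x"
  proof -
    have "c * x \<le> x" using assms by (simp add: mult_left_le_one_le)
    moreover have "(1 + x) * c = c + c * x" by (simp add: algebra_simps)
    ultimately show ?thesis using assms by linarith
  qed
  then have "x powr - P \<le> ((1 + x) * c / 2) powr - P"
    using assms x by (intro powr_mono2') auto
  also have "\<dots> = (2 / c) powr P * (1 + x) powr - P"
  proof -
    have "(1 + x) * c / 2 = inverse (2 / c) * (1 + x)" using assms by simp
    moreover have "inverse (2 / c) powr - P = (2 / c) powr P"
      using assms by (subst inverse_powr) (auto simp: powr_minus)
    ultimately show ?thesis using assms x by (simp only: powr_mult)
  qed
  also have "\<dots> \<le> (2 / c) powr Q * (1 + x) powr - p"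
    using assms x by (intro mult_mono powr_mono) auto
  finally show ?thesis .
qed

lemma eis_term_bound:
  fixes c R :: real
  assumes "0 < c" "c \<le> 1" "norm s \<le> R" "0 \<le> p" "p \<le> real n + Re s" "w = 0 \<or> c \<le> norm w"
  shows "norm (eis_term n s w) \<le> (2 / c) powr (real n + R) * (1 + norm w) powr - p"
proof (cases "w = 0")
  case False
  then show ?thesis
    unfolding norm_eis_term[OF False] using assms
    by (intro powr_neg_le_separated) (use complex_Re_le_cmod[of s] in auto)
qed auto

text \<open>For |l| > 2 |v| the factor l is pulled out and the Taylor estimate at z = v / l gains
  two powers of |l|. Otherwise |l| is bounded in terms of |v|; the pieces are estimated one by one
  and the missing decay is paid for by a power of 1 + |v|. The exponent \<open>p\<close> is left
  free so that one constant serves all admissible s of modulus at most R.\<close>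

lemma eis_rem_bound:
  fixes c R :: real
  assumes "0 < c" "c \<le> 1"
  obtains C m where "C \<ge> 0" and "\<And>s l v p. norm s \<le> R \<Longrightarrow> 0 \<le> real n + Re s \<Longrightarrow> 0 \<le> p \<Longrightarrow>
      p \<le> real n + Re s + 2 \<Longrightarrow> l = 0 \<or> c \<le> norm l \<Longrightarrow> l + v = 0 \<or> c \<le> norm (l + v) \<Longrightarrow>
      norm (eis_rem n s l v) \<le> C * (1 + norm v) ^ m * (1 + norm l) powr - p"
proof (cases "R \<ge> 0")
  case False
  then show thesis using that[of 0] by (meson norm_ge_zero order_trans order_refl)
next
  case R: True
  \<comment> \<open>The rounded exponent n + R + 2 arises in the case |l| \<le> 2 |v|, where a
    further factor 1 + |v| accounts for \<open>Suc\<close>; the added 2 ensures that m also covers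
    the square of |v| in the Taylor case.\<close>
  define m where "m = Suc (nat \<lceil>real n + R + 2\<rceil>) + 2"
  define K where "K = (real n + R) * 2 + (2 * (real n + R))\<^sup>2 * exp (real n + R)"
  define C1 where "C1 = K * (2 / c) powr (real n + R + 2)"
  define C2 where "C2 = (2 / c) powr (real n + R) * (2 + (real n + R) / c) * 2 powr (real n + R + 2)"
  have pos: "K \<ge> 0" "C1 \<ge> 0" "C2 \<ge> 0" using R assms by (auto simp: K_def C1_def C2_def)
  have "norm (eis_rem n s l v) \<le> (C1 + C2) * (1 + norm v) ^ m * (1 + norm l) powr - p"
    if s: "norm s \<le> R" "0 \<le> real n + Re s" and p: "0 \<le> p" "p \<le> real n + Re s + 2"
      and l: "l = 0 \<or> c \<le> norm l" and lv: "l + v = 0 \<or> c \<le> norm (l + v)" for s l v p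
  proof (cases "norm l > 2 * norm v")
    case True
    then have l0: "l \<noteq> 0" using norm_ge_zero[of v] by auto
    define z where "z = v / l"
    have z: "norm z < 1/2" using True l0 by (simp add: z_def norm_divide divide_simps)
    have "l + v = l * (1 + z)" using l0 by (simp add: z_def field_simps)
    then have "eis_rem n s l v = eis_term n s l * (eis_term n s (1 + z) - (1 - of_nat n * z - s * of_real (Re z)))"
      unfolding eis_rem_def z_def[symmetric] by (simp only: eis_term_mult right_diff_distrib)
    then have "norm (eis_rem n s l v) \<le> cmod l powr - (real n + Re s) * (K * norm z ^ 2)"
      using eis_term_taylor[OF s(1) z, of n, folded K_def]
      by (simp add: norm_mult norm_eis_term[OF l0] mult_left_mono)
    also have "\<dots> = K * norm v ^ 2 * cmod l powr - (real n + Re s + 2)"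
      using l0 by (simp add: z_def norm_divide power_divide powr_diff powr_add powr_minus powr_realpow field_simps)
    also have "\<dots> \<le> K * norm v ^ 2 * ((2 / c) powr (real n + R + 2) * (1 + norm l) powr - p)"
      using assms p s l l0 pos complex_Re_le_cmod[of s]
      by (intro mult_left_mono powr_neg_le_separated) auto
    also have "\<dots> = C1 * norm v ^ 2 * (1 + norm l) powr - p" by (simp add: C1_def)
    also have "\<dots> \<le> (C1 + C2) * (1 + norm v) ^ m * (1 + norm l) powr - p"
    proof (intro mult_mono)
      have "norm v ^ 2 \<le> (1 + norm v) ^ 2" by (intro power_mono) auto
      also have "\<dots> \<le> (1 + norm v) ^ m" by (intro power_increasing) (auto simp: m_def)
      finally show "norm v ^ 2 \<le> (1 + norm v) ^ m" .
    qed (use pos in auto)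
    finally show ?thesis .
  next
    case False
    have Re: "Re s \<le> R" using s(1) complex_Re_le_cmod[of s] by linarith
    have t1: "norm (eis_term n s (l + v)) \<le> (2 / c) powr (real n + R)"
      using eis_term_bound[OF assms s(1) order_refl s(2) lv] by (simp split: if_splits)
    have t2: "norm (eis_term n s l) \<le> (2 / c) powr (real n + R)"
      using eis_term_bound[OF assms s(1) order_refl s(2) l] by (simp split: if_splits)
    have t3: "norm (eis_term n s l * (1 - of_nat n * (v / l) - s * of_real (Re (v / l)))) \<le>
         (2 / c) powr (real n + R) * (1 + (real n + R) / c * norm v)"
    proof (cases "l = 0")
      case False
      have vl: "norm (v / l) \<le> norm v / c"
        using l False assms by (simp add: norm_divide divide_left_mono mult_pos_pos)
      have "norm (1 - of_nat n * (v / l) - s * of_real (Re (v / l))) \<le>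
            norm (1::complex) + norm (of_nat n * (v / l)) + norm (s * of_real (Re (v / l)))"
        by (meson add_mono_thms_linordered_semiring(3) norm_triangle_ineq4 order_trans)
      also have "\<dots> \<le> 1 + real n * norm (v / l) + R * norm (v / l)"
        unfolding norm_mult using s(1) R abs_Re_le_cmod[of "v/l"]
        by (auto intro!: add_mono mult_mono)
      also have "\<dots> = 1 + (real n + R) * norm (v / l)" by (simp add: algebra_simps)
      also have "\<dots> \<le> 1 + (real n + R) * (norm v / c)"
        using vl R by (intro add_left_mono mult_left_mono) auto
      finally show ?thesis unfolding norm_mult
        by (intro mult_mono t2) (auto simp: assms)
    qed (use R assms in auto)
    have "norm (eis_rem n s l v) \<le> (2 / c) powr (real n + R) + (2 / c) powr (real n + R) * (1 + (real n + R) / c * norm v)"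
      unfolding eis_rem_def using t1 t3 norm_triangle_ineq4 by (meson add_mono order_trans)
    also have "\<dots> = (2 / c) powr (real n + R) * (2 + (real n + R) / c * norm v)"
      by (simp add: algebra_simps)
    also have "\<dots> \<le> (2 / c) powr (real n + R) * ((2 + (real n + R) / c) * (1 + norm v))"
    proof (intro mult_left_mono)
      define a where "a = (real n + R) / c"
      have "a \<ge> 0" using R assms by (simp add: a_def)
      then show "2 + (real n + R) / c * norm v \<le> (2 + (real n + R) / c) * (1 + norm v)"
        unfolding a_def[symmetric] by (simp add: algebra_simps)
    qed auto
    \<comment> \<open>Here |l| \<le> 2 |v|, so a factor (1 + |l|)^(-p) can be inserted at the cost
      of (2 (1 + |v|))^p.\<close>
    also have "\<dots> \<le> (2 / c) powr (real n + R) * ((2 + (real n + R) / c) * (1 + norm v)) *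
       (2 powr (real n + R + 2) * (1 + norm v) powr (real n + R + 2) * (1 + norm l) powr - p)"
    proof -
      have "1 = (1 + norm l) powr p * (1 + norm l) powr - p"
        using norm_ge_zero[of l] by (simp add: powr_minus field_simps add_nonneg_eq_0_iff)
      also have "(1 + norm l) powr p \<le> (2 * (1 + norm v)) powr p"
        using False p by (intro powr_mono2) auto
      also have "\<dots> \<le> (2 * (1 + norm v)) powr (real n + R + 2)"
        using p Re norm_ge_zero[of v] by (intro powr_mono) (auto simp del: norm_ge_zero)
      also have "\<dots> = 2 powr (real n + R + 2) * (1 + norm v) powr (real n + R + 2)"
        by (simp only: powr_mult)
      finally have "1 \<le> 2 powr (real n + R + 2) * (1 + norm v) powr (real n + R + 2) * (1 + norm l) powr - p"
        by (simp add: mult_right_mono)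
      from mult_left_mono[OF this, of "(2 / c) powr (real n + R) * ((2 + (real n + R) / c) * (1 + norm v))"]
      show ?thesis using R assms by (simp only: mult_1_right) simp
    qed
    also have "\<dots> = C2 * ((1 + norm v) * (1 + norm v) powr (real n + R + 2)) * (1 + norm l) powr - p"
      by (simp add: C2_def algebra_simps)
    also have "\<dots> \<le> (C1 + C2) * (1 + norm v) ^ m * (1 + norm l) powr - p"
    proof (intro mult_mono)
      have v1: "1 + norm v > 0" using norm_ge_zero[of v] by linarith
      have "(1 + norm v) powr (real n + R + 2) \<le> (1 + norm v) powr real (nat \<lceil>real n + R + 2\<rceil>)"
        by (intro powr_mono real_nat_ceiling_ge) auto
      also have "\<dots> = (1 + norm v) ^ nat \<lceil>real n + R + 2\<rceil>" using v1 by (simp add: powr_realpow)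
      finally have "(1 + norm v) * (1 + norm v) powr (real n + R + 2) \<le> (1 + norm v) ^ Suc (nat \<lceil>real n + R + 2\<rceil>)"
        using v1 by simp
      also have "\<dots> \<le> (1 + norm v) ^ m" by (intro power_increasing) (auto simp: m_def)
      finally show "(1 + norm v) * (1 + norm v) powr (real n + R + 2) \<le> (1 + norm v) ^ m" .
    qed (use pos in auto)
    finally show ?thesis .
  qed
  then show thesis using that[of "C1 + C2" m] pos by auto
qed

section \<open>Locally dominated sums of holomorphic functions\<close>

lemma infsum_holomorphic:
  fixes f :: "'i \<Rightarrow> complex \<Rightarrow> complex"
  assumes S: "open S" and hol: "\<And>i. i \<in> I \<Longrightarrow> f i holomorphic_on S"
    and bd: "\<And>x. x \<in> S \<Longrightarrow> \<exists>r>0. \<exists>M. M summable_on I \<and> (\<forall>y\<in>ball x r \<inter> S. \<forall>i\<in>I. norm (f i y) \<le> M i)"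
  shows "(\<lambda>x. \<Sum>\<^sub>\<infinity>i\<in>I. f i x) holomorphic_on S"
proof -
  have "(\<lambda>x. \<Sum>\<^sub>\<infinity>i\<in>I. f i x) field_differentiable (at x)" if x: "x \<in> S" for x
  proof -
    obtain r M where r: "r > 0" and M: "M summable_on I"
      and le: "\<And>y i. y \<in> ball x r \<Longrightarrow> y \<in> S \<Longrightarrow> i \<in> I \<Longrightarrow> norm (f i y) \<le> M i" using bd[OF x] by blast
    obtain e where e: "e > 0" "ball x e \<subseteq> S" using S x open_contains_ball by blast
    \<comment> \<open>Halving makes the closed disc of radius \<open>d\<close> fit into both open
      balls, as the limit theorem asks for continuity on the closed disc.\<close>
    define d where "d = min r e / 2"
    have d: "d > 0" "cball x d \<subseteq> S" "cball x d \<subseteq> ball x r"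
    proof -
      show "d > 0" using r e by (simp add: d_def)
      then have "d < r" "d < e" using r e by (auto simp: d_def min_def)
      then have "cball x d \<subseteq> ball x r" "cball x d \<subseteq> ball x e" by auto
      then show "cball x d \<subseteq> S" "cball x d \<subseteq> ball x r" using e by auto
    qed
    have ul: "uniform_limit (cball x d) (\<lambda>X y. \<Sum>i\<in>X. f i y) (\<lambda>y. \<Sum>\<^sub>\<infinity>i\<in>I. f i y) (finite_subsets_at_top I)"
      using le d(2,3) by (intro Weierstrass_m_test_general[OF _ M]) blast+
    have ev: "\<forall>\<^sub>F X in finite_subsets_at_top I. continuous_on (cball x d) (\<lambda>y. \<Sum>i\<in>X. f i y) \<and>
       (\<lambda>y. \<Sum>i\<in>X. f i y) holomorphic_on ball x d"
    proof (rule eventually_finite_subsets_at_top_weakI)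
      fix X assume "finite X" "X \<subseteq> I"
      then have "(\<lambda>y. \<Sum>i\<in>X. f i y) holomorphic_on cball x d"
        using hol d by (intro holomorphic_on_sum) (meson holomorphic_on_subset subsetD)
      then show "continuous_on (cball x d) (\<lambda>y. \<Sum>i\<in>X. f i y) \<and> (\<lambda>y. \<Sum>i\<in>X. f i y) holomorphic_on ball x d"
        by (meson ball_subset_cball holomorphic_on_imp_continuous_on holomorphic_on_subset)
    qed
    have "(\<lambda>y. \<Sum>\<^sub>\<infinity>i\<in>I. f i y) holomorphic_on ball x d"
      using holomorphic_uniform_limit[OF ev ul] by auto
    then show ?thesis using d by (metis centre_in_ball holomorphic_on_imp_differentiable_at open_ball)
  qed
  then show ?thesis using holomorphic_on_def field_differentiable_at_within by blast
qed


section \<open>Lattice sums\<close>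

definition vpt :: "complex \<Rightarrow> rat^2 \<Rightarrow> complex" where
  "vpt \<tau> v = of_rat (v $ 1) * \<tau> + of_rat (v $ 2)"

definition ivec :: "int \<times> int \<Rightarrow> rat^2" where
  "ivec ab = vector [of_int (fst ab), of_int (snd ab)]"

text \<open>Unbounded upwards, so that one estimate serves both local uniformity in \<tau> and
  growth towards the cusp.\<close>

definition strip :: "real \<Rightarrow> real \<Rightarrow> complex set" where
  "strip A B = {\<tau>. \<bar>Re \<tau>\<bar> \<le> A \<and> B \<le> Im \<tau>}"

text \<open>A majorant of (1 + |a| + |b|)^(-p), because (1 + |a|) (1 + |b|) \<le> (1 + |a| + |b|)^2.
  The product form reduces summability for p > 2 to a sum over one integer with exponent p /
  2.\<close>

definition lat_major :: "real \<Rightarrow> int \<times> int \<Rightarrow> real" where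
  "lat_major p ab = ((1 + \<bar>of_int (fst ab)\<bar>) * (1 + \<bar>of_int (snd ab)\<bar>)) powr (- p / 2)"

lemma vpt_add: "vpt \<tau> (v + w) = vpt \<tau> v + vpt \<tau> w"
  by (simp add: vpt_def of_rat_add algebra_simps)

lemma vpt_smult: "vpt \<tau> (c *s v) = of_rat c * vpt \<tau> v"
  by (simp add: vpt_def of_rat_mult algebra_simps)

lemma vpt_0 [simp]: "vpt \<tau> 0 = 0"
  by (simp add: vpt_def)

lemma vpt_uminus: "vpt \<tau> (- v) = - vpt \<tau> v"
  by (simp add: vpt_def of_rat_minus)

lemma ivec_nth [simp]: "ivec ab $ 1 = of_int (fst ab)" "ivec ab $ 2 = of_int (snd ab)"
  by (simp_all add: ivec_def)

lemma vec2_eq_iff: "(v :: 'a^2) = w \<longleftrightarrow> v $ 1 = w $ 1 \<and> v $ 2 = w $ 2"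
  by (simp add: vec_eq_iff forall_2)

lemma ivec_add: "ivec (x + y) = ivec x + ivec y"
  by (simp add: vec2_eq_iff)

lemma ivec_minus: "ivec (- x) = - ivec x"
  by (simp add: vec2_eq_iff)

lemma ivec_0 [simp]: "ivec 0 = 0"
  by (simp add: vec2_eq_iff)

lemma inj_ivec: "inj ivec"
  by (rule injI) (auto simp: vec2_eq_iff prod_eq_iff)

lemma Z2_eq: "Z2 = range ivec"
proof (intro equalityI subsetI)
  fix v :: "rat^2" assume "v \<in> Z2"
  then obtain a b where "v $ 1 = of_int a" "v $ 2 = of_int b" by (auto simp: Z2_def forall_2 elim!: Ints_cases)
  then have "v = ivec (a, b)" by (simp add: vec2_eq_iff)
  then show "v \<in> range ivec" by auto
qed (auto simp: Z2_def forall_2)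

lemma ivec_in_Z2 [simp]: "ivec ab \<in> Z2" by (simp add: Z2_eq)

lemma Z2_add: "v \<in> Z2 \<Longrightarrow> w \<in> Z2 \<Longrightarrow> v + w \<in> Z2"
  by (auto simp: Z2_def)

lemma Z2_smult_nat: "v \<in> Z2 \<Longrightarrow> of_nat D *s v \<in> Z2"
  by (auto simp: Z2_def)

lemma uhp_in_strip: "\<tau> \<in> uhp \<Longrightarrow> \<tau> \<in> strip \<bar>Re \<tau>\<bar> (Im \<tau>)"
  by (simp add: strip_def)

text \<open>The imaginary part of w = x \<tau> + y bounds |x| by |w| / B; then the real part bounds
  |y| by |w| (1 + A / B). The sum of these constants is \<open>K\<close>.\<close>

lemma strip_norm_ge:
  assumes "0 \<le> A" "0 < B"
  obtains c where "0 < c" "c \<le> 1"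
    "\<And>\<tau> x y. \<tau> \<in> strip A B \<Longrightarrow> c * (\<bar>x\<bar> + \<bar>y\<bar>) \<le> cmod (of_real x * \<tau> + of_real y)"
proof -
  define K where "K = 1 / B + 1 + A / B"
  have K: "K \<ge> 1" using assms by (simp add: K_def)
  have "1 / K * (\<bar>x\<bar> + \<bar>y\<bar>) \<le> cmod (of_real x * \<tau> + of_real y)" if t: "\<tau> \<in> strip A B" for \<tau> and x y :: real
  proof -
    define w where "w = of_real x * \<tau> + of_real y"
    have "\<bar>x\<bar> * B \<le> \<bar>x\<bar> * Im \<tau>" using t by (intro mult_left_mono) (auto simp: strip_def)
    also have "\<dots> = \<bar>Im w\<bar>" using t assms by (simp add: w_def abs_mult strip_def)
    also have "\<dots> \<le> norm w" by (rule abs_Im_le_cmod)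
    finally have x: "\<bar>x\<bar> \<le> norm w / B" using assms by (simp add: field_simps)
    have "\<bar>y\<bar> = \<bar>Re w - x * Re \<tau>\<bar>" by (simp add: w_def)
    also have "\<dots> \<le> \<bar>Re w\<bar> + \<bar>x\<bar> * \<bar>Re \<tau>\<bar>" by (metis abs_mult abs_triangle_ineq4)
    also have "\<dots> \<le> norm w + norm w / B * A"
      using x t assms by (intro add_mono abs_Re_le_cmod mult_mono) (auto simp: strip_def)
    finally have "\<bar>x\<bar> + \<bar>y\<bar> \<le> K * norm w" using x by (simp add: K_def algebra_simps)
    then show ?thesis using K unfolding w_def[symmetric] by (simp add: field_simps)
  qed
  then show thesis using K by (intro that[of "1 / K"]) auto
qed

lemma complex_of_rat_eq: "complex_of_rat r = of_real (of_rat r)"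
  by (cases r) (simp add: of_rat_rat)

lemma vpt_of_real: "vpt \<tau> v = of_real (of_rat (v $ 1)) * \<tau> + of_real (of_rat (v $ 2))"
  by (simp add: vpt_def complex_of_rat_eq)

text \<open>A nonzero vector of (1/D) Z^2 has |x| + |y| \<ge> 1/D, which keeps its lattice point
  away from 0 uniformly in \<tau>. The second bound transfers decay in the lattice point to decay in
  the index pair.\<close>

lemma strip_bounds:
  fixes D :: nat
  assumes "0 \<le> A" "0 < B" "0 < D"
  obtains c where "0 < c" "c \<le> 1"
    "\<And>\<tau> v. \<tau> \<in> strip A B \<Longrightarrow> of_nat D *s v \<in> Z2 \<Longrightarrow> vpt \<tau> v = 0 \<or> c \<le> norm (vpt \<tau> v)"
    "\<And>\<tau> ab. \<tau> \<in> strip A B \<Longrightarrow> c * (1 + \<bar>of_int (fst ab)\<bar> + \<bar>of_int (snd ab)\<bar>) \<le> 1 + norm (vpt \<tau> (ivec ab))"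
proof -
  obtain c where c: "0 < c" "c \<le> 1" and
    le: "\<And>\<tau> x y. \<tau> \<in> strip A B \<Longrightarrow> c * (\<bar>x\<bar> + \<bar>y\<bar>) \<le> cmod (of_real x * \<tau> + of_real y)"
    using strip_norm_ge[OF assms(1,2)] by blast
  have 1: "vpt \<tau> v = 0 \<or> c / D \<le> norm (vpt \<tau> v)" if t: "\<tau> \<in> strip A B" and v: "of_nat D *s v \<in> Z2" for \<tau> v
  proof (cases "v = 0")
    case False
    obtain a b where a: "of_nat D * v $ 1 = of_int a" and b: "of_nat D * v $ 2 = of_int b"
      using v by (auto simp: Z2_def forall_2 elim!: Ints_cases)
    have "a \<noteq> 0 \<or> b \<noteq> 0" using False a b assms by (auto simp: vec2_eq_iff)
    then have "1 \<le> \<bar>a\<bar> + \<bar>b\<bar>" by linarith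
    then have "(1 :: real) \<le> of_int (\<bar>a\<bar> + \<bar>b\<bar>)" by linarith
    then have "1 \<le> \<bar>real_of_int a\<bar> + \<bar>real_of_int b\<bar>" by simp
    moreover have ra: "real_of_rat (v $ 1) = of_int a / D"
    proof -
      have "v $ 1 = of_int a / of_nat D" using a assms(3) by (simp add: field_simps)
      then show ?thesis by (simp add: of_rat_divide)
    qed
    moreover have rb: "real_of_rat (v $ 2) = of_int b / D"
    proof -
      have "v $ 2 = of_int b / of_nat D" using b assms(3) by (simp add: field_simps)
      then show ?thesis by (simp add: of_rat_divide)
    qed
    ultimately have "1 / D \<le> \<bar>real_of_rat (v $ 1)\<bar> + \<bar>real_of_rat (v $ 2)\<bar>"
      unfolding ra rb using assms(3) by (simp add: divide_right_mono flip: add_divide_distrib)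
    then have "c * (1 / D) \<le> c * (\<bar>real_of_rat (v $ 1)\<bar> + \<bar>real_of_rat (v $ 2)\<bar>)"
      using c by (intro mult_left_mono) auto
    also have "\<dots> \<le> norm (vpt \<tau> v)" unfolding vpt_of_real by (rule le[OF t])
    finally show ?thesis by simp
  qed auto
  have cD: "c / D \<le> c" "c / D > 0" using c assms(3) by (auto simp: field_simps)
  have 2: "c / D * (1 + \<bar>of_int (fst ab)\<bar> + \<bar>of_int (snd ab)\<bar>) \<le> 1 + norm (vpt \<tau> (ivec ab))" if t: "\<tau> \<in> strip A B" for \<tau> ab
  proof -
    have "c / D * (1 + \<bar>of_int (fst ab)\<bar> + \<bar>of_int (snd ab)\<bar>) \<le> c * (1 + \<bar>of_int (fst ab)\<bar> + \<bar>of_int (snd ab)\<bar>)"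
      using cD by (intro mult_right_mono) auto
    also have "\<dots> = c + c * (\<bar>of_int (fst ab)\<bar> + \<bar>of_int (snd ab)\<bar>)" by (simp add: algebra_simps)
    also have "\<dots> \<le> 1 + norm (vpt \<tau> (ivec ab))"
      using le[OF t, of "of_int (fst ab)" "of_int (snd ab)"] c
      unfolding vpt_of_real by (intro add_mono) simp_all
    finally show ?thesis .
  qed
  show thesis by (rule that[of "c / D", OF _ _ 1 2]) (use c cD in auto)
qed

section \<open>Summable majorants on Z^2\<close>

lemma powr_le_lat_major:
  assumes "0 < c" "c \<le> 1" "0 \<le> p" "p \<le> P"
    "c * (1 + \<bar>of_int (fst ab)\<bar> + \<bar>of_int (snd ab)\<bar>) \<le> (x :: real)"
  shows "x powr - p \<le> c powr - P * lat_major p ab"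
proof -
  define a b where "a = \<bar>real_of_int (fst ab)\<bar>" and "b = \<bar>real_of_int (snd ab)\<bar>"
  have ab: "a \<ge> 0" "b \<ge> 0" by (auto simp: a_def b_def)
  have "(1 + a) * (1 + b) \<le> (1 + a + b) ^ 2" using ab by (auto simp: power2_eq_square algebra_simps)
  then have "((1 + a) * (1 + b)) powr (1/2) \<le> 1 + a + b"
    using ab by (simp add: powr_half_sqrt real_le_lsqrt)
  then have "c * ((1 + a) * (1 + b)) powr (1/2) \<le> x"
    using assms(1,5) unfolding a_def[symmetric] b_def[symmetric] by (meson mult_left_mono order_trans less_imp_le)
  then have "x powr - p \<le> (c * ((1 + a) * (1 + b)) powr (1/2)) powr - p"
    using assms ab by (intro powr_mono2') (auto intro!: mult_pos_pos)
  also have "\<dots> = c powr - p * lat_major p ab"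
    using assms(1) ab by (simp add: powr_mult powr_powr lat_major_def a_def b_def)
  also have "\<dots> \<le> c powr - P * lat_major p ab"
    using assms by (intro mult_right_mono powr_mono') (auto simp: lat_major_def)
  finally show ?thesis .
qed

lemma lat_major_nonneg [simp]: "0 \<le> lat_major p ab" by (simp add: lat_major_def)

lemma summable_on_int_powr:
  assumes "q > 1"
  shows "(\<lambda>a::int. (1 + \<bar>of_int a\<bar>) powr - q :: real) summable_on UNIV"
proof -
  have "summable (\<lambda>n. real (Suc n) powr - q)"
    by (subst summable_Suc_iff) (use assms in \<open>simp add: summable_real_powr_iff\<close>)
  then have *: "(\<lambda>n. (1 + real n) powr - q) summable_on UNIV"
    by (subst summable_on_UNIV_nonneg_real_iff) (auto simp: add.commute)
  have 1: "(\<lambda>a::int. (1 + \<bar>of_int a\<bar>) powr - q :: real) summable_on range int"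
    using * by (subst summable_on_reindex) (auto simp: o_def inj_on_def)
  have 2: "(\<lambda>a::int. (1 + \<bar>of_int a\<bar>) powr - q :: real) summable_on range (\<lambda>n. - int n)"
    using * by (subst summable_on_reindex) (auto simp: o_def inj_on_def)
  have "x \<in> range int \<union> range (\<lambda>n. - int n)" for x
    by (cases x rule: int_cases2) auto
  then have "(UNIV :: int set) = range int \<union> range (\<lambda>n. - int n)" by blast
  then show ?thesis using summable_on_union[OF 1 2] by simp
qed

lemma summable_on_lat_major:
  assumes "p > 2"
  shows "lat_major p summable_on UNIV"
proof -
  let ?f = "\<lambda>a::int. (1 + \<bar>of_int a\<bar>) powr - (p / 2) :: real"
  have s: "?f summable_on UNIV" using assms by (intro summable_on_int_powr) auto
  have "lat_major p summable_on (SIGMA a:UNIV. UNIV)"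
  proof (rule summable_on_SigmaI)
    show "((\<lambda>b. lat_major p (a, b)) has_sum (?f a * infsum ?f UNIV)) UNIV" for a
      using has_sum_cmult_right[OF has_sum_infsum[OF s], of "?f a"]
      by (simp add: lat_major_def powr_mult)
    show "(\<lambda>a. ?f a * infsum ?f UNIV) summable_on UNIV"
      using s by (rule summable_on_cmult_left)
  qed auto
  then show ?thesis by (simp add: UNIV_Times_UNIV)
qed

text \<open>The majorant depends on the index pair and not on the shift v: since 1 + |l| \<le> (1 +
  |l + w|) (1 + |w|), shifting by w costs only a power of 1 + |w|.\<close>

lemma eis_term_lattice_bound:
  fixes D :: nat
  assumes "0 \<le> A" "0 < B" "0 < D" "0 \<le> R"
  obtains C m where "0 \<le> C" "\<And>\<tau> s p v ab. \<tau> \<in> strip A B \<Longrightarrow> norm s \<le> R \<Longrightarrow> 0 \<le> p \<Longrightarrow> p \<le> real n + Re s \<Longrightarrow>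
     of_nat D *s v \<in> Z2 \<Longrightarrow>
     norm (eis_term n s (vpt \<tau> (ivec ab + v))) \<le> C * (1 + norm (vpt \<tau> v)) ^ m * lat_major p ab"
proof -
  obtain c where c: "0 < c" "c \<le> 1"
    and sep: "\<And>\<tau> v. \<tau> \<in> strip A B \<Longrightarrow> of_nat D *s v \<in> Z2 \<Longrightarrow> vpt \<tau> v = 0 \<or> c \<le> norm (vpt \<tau> v)"
    and low: "\<And>\<tau> ab. \<tau> \<in> strip A B \<Longrightarrow> c * (1 + \<bar>of_int (fst ab)\<bar> + \<bar>of_int (snd ab)\<bar>) \<le> 1 + norm (vpt \<tau> (ivec ab))"
    using strip_bounds[OF assms(1-3)] by blast
  define m where "m = nat \<lceil>real n + R\<rceil>"
  define C where "C = (2 / c) powr (real n + R) * c powr - (real n + R)"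
  have "norm (eis_term n s (vpt \<tau> (ivec ab + v))) \<le> C * (1 + norm (vpt \<tau> v)) ^ m * lat_major p ab"
    if t: "\<tau> \<in> strip A B" and s: "norm s \<le> R" and p: "0 \<le> p" "p \<le> real n + Re s"
      and v: "of_nat D *s v \<in> Z2" for \<tau> s p v ab
  proof -
    have pR: "p \<le> real n + R" using p s complex_Re_le_cmod[of s] by linarith
    define l w where "l = vpt \<tau> (ivec ab)" and "w = vpt \<tau> v"
    have lw: "vpt \<tau> (ivec ab + v) = l + w" by (simp add: l_def w_def vpt_add)
    have "of_nat D *s (ivec ab + v) \<in> Z2" using v by (simp add: vector_add_ldistrib Z2_add Z2_smult_nat)
    then have e1: "norm (eis_term n s (l + w)) \<le> (2 / c) powr (real n + R) * (1 + norm (l + w)) powr - p"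
      using eis_term_bound[OF c s p] sep[OF t] lw by metis
    have "(1 + norm (l + w)) powr - p \<le> ((1 + norm l) / (1 + norm w)) powr - p"
    proof (rule powr_mono2')
      have "norm l \<le> norm (l + w) + norm w" using norm_triangle_ineq4[of "l + w" w] by simp
      then have "1 + norm l \<le> (1 + norm (l + w)) * (1 + norm w)"
      proof -
        have "(1 + norm (l + w)) * (1 + norm w) = 1 + norm w + norm (l + w) + norm (l + w) * norm w"
          by (simp add: algebra_simps)
        moreover have "0 \<le> norm (l + w) * norm w" by (intro mult_nonneg_nonneg) auto
        ultimately show ?thesis using \<open>norm l \<le> _\<close> by linarith
      qed
      then show "(1 + norm l) / (1 + norm w) \<le> 1 + norm (l + w)"
        by (simp add: divide_le_eq add_pos_nonneg)
    qed (use p in \<open>auto intro!: divide_pos_pos add_pos_nonneg\<close>)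
    also have "\<dots> = (1 + norm w) powr p * (1 + norm l) powr - p"
      by (simp add: powr_divide powr_minus field_simps)
    also have "\<dots> \<le> (1 + norm w) ^ m * (c powr - (real n + R) * lat_major p ab)"
    proof (intro mult_mono)
      have "(1 + norm w) powr p \<le> (1 + norm w) powr real m"
        using pR real_nat_ceiling_ge[of "real n + R"] by (intro powr_mono) (auto simp: m_def)
      also have "\<dots> = (1 + norm w) ^ m"
        by (rule powr_realpow) (metis add_pos_nonneg norm_ge_zero zero_less_one)
      finally show "(1 + norm w) powr p \<le> (1 + norm w) ^ m" .
      show "(1 + norm l) powr - p \<le> c powr - (real n + R) * lat_major p ab"
        by (rule powr_le_lat_major) (use c p pR low[OF t] in \<open>auto simp: l_def\<close>)
    qed auto
    finally have "(2 / c) powr (real n + R) * (1 + norm (l + w)) powr - p \<le>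
        (2 / c) powr (real n + R) * ((1 + norm w) ^ m * (c powr - (real n + R) * lat_major p ab))"
      by (intro mult_left_mono) auto
    with e1 show ?thesis unfolding lw C_def w_def by (simp add: mult_ac)
  qed
  then show thesis by (intro that[of C m]) (auto simp: C_def)
qed

lemma eis_rem_lattice_bound:
  fixes D :: nat
  assumes "0 \<le> A" "0 < B" "0 < D" "0 \<le> R"
  obtains C m where "0 \<le> C" "\<And>\<tau> s p v ab. \<tau> \<in> strip A B \<Longrightarrow> norm s \<le> R \<Longrightarrow> 0 \<le> real n + Re s \<Longrightarrow>
     0 \<le> p \<Longrightarrow> p \<le> real n + Re s + 2 \<Longrightarrow> of_nat D *s v \<in> Z2 \<Longrightarrow>
     norm (eis_rem n s (vpt \<tau> (ivec ab)) (vpt \<tau> v)) \<le> C * (1 + norm (vpt \<tau> v)) ^ m * lat_major p ab"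
proof -
  obtain c where c: "0 < c" "c \<le> 1"
    and sep: "\<And>\<tau> v. \<tau> \<in> strip A B \<Longrightarrow> of_nat D *s v \<in> Z2 \<Longrightarrow> vpt \<tau> v = 0 \<or> c \<le> norm (vpt \<tau> v)"
    and low: "\<And>\<tau> ab. \<tau> \<in> strip A B \<Longrightarrow> c * (1 + \<bar>of_int (fst ab)\<bar> + \<bar>of_int (snd ab)\<bar>) \<le> 1 + norm (vpt \<tau> (ivec ab))"
    using strip_bounds[OF assms(1-3)] by blast
  obtain C m where C: "C \<ge> 0" and bd: "\<And>s l v p. norm s \<le> R \<Longrightarrow> 0 \<le> real n + Re s \<Longrightarrow> 0 \<le> p \<Longrightarrow>
      p \<le> real n + Re s + 2 \<Longrightarrow> l = 0 \<or> c \<le> norm l \<Longrightarrow> l + v = 0 \<or> c \<le> norm (l + v) \<Longrightarrow>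
      norm (eis_rem n s l v) \<le> C * (1 + norm v) ^ m * (1 + norm l) powr - p"
    using eis_rem_bound[OF c, of R n] by blast
  define C' where "C' = C * c powr - (real n + R + 2)"
  have "norm (eis_rem n s (vpt \<tau> (ivec ab)) (vpt \<tau> v)) \<le> C' * (1 + norm (vpt \<tau> v)) ^ m * lat_major p ab"
    if t: "\<tau> \<in> strip A B" and s: "norm s \<le> R" "0 \<le> real n + Re s" and p: "0 \<le> p" "p \<le> real n + Re s + 2"
      and v: "of_nat D *s v \<in> Z2" for \<tau> s p v ab
  proof -
    have pR: "p \<le> real n + R + 2" using p s complex_Re_le_cmod[of s] by linarith
    have "of_nat D *s (ivec ab + v) \<in> Z2" using v by (simp add: vector_add_ldistrib Z2_add Z2_smult_nat)
    note s1 = sep[OF t this, unfolded vpt_add] and s2 = sep[OF t Z2_smult_nat[OF ivec_in_Z2], of ab]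
    have "norm (eis_rem n s (vpt \<tau> (ivec ab)) (vpt \<tau> v)) \<le> C * (1 + norm (vpt \<tau> v)) ^ m * (1 + norm (vpt \<tau> (ivec ab))) powr - p"
      by (rule bd[OF s p s2 s1])
    also have "\<dots> \<le> C * (1 + norm (vpt \<tau> v)) ^ m * (c powr - (real n + R + 2) * lat_major p ab)"
      using C by (intro mult_left_mono powr_le_lat_major c p pR low[OF t]) auto
    finally show ?thesis by (simp add: C'_def mult_ac)
  qed
  then show thesis using C by (intro that[of C' m]) (auto simp: C'_def)
qed

lemma summable_on_norm_le:
  fixes f :: "'a \<Rightarrow> complex"
  assumes "g summable_on A" "\<And>x. x \<in> A \<Longrightarrow> norm (f x) \<le> g x"
  shows "f summable_on A"
  using Infinite_Sum.abs_summable_on_comparison_test'[OF assms] abs_summable_summable by blast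

section \<open>Holomorphy in s of the lattice sums\<close>

definition eis_lat_sum :: "nat \<Rightarrow> rat^2 \<Rightarrow> complex \<Rightarrow> complex \<Rightarrow> complex" where
  "eis_lat_sum n v \<tau> s = (\<Sum>\<^sub>\<infinity>ab. eis_term n s (vpt \<tau> (ivec ab + v)))"

lemma ex_denominator: "\<exists>D>0. of_nat D *s (v :: rat^2) \<in> Z2"
proof -
  obtain a b where a: "quotient_of (v $ 1) = (fst a, snd a)" and b: "quotient_of (v $ 2) = (fst b, snd b)"
    by (metis prod.collapse)
  have pos: "snd a > 0" "snd b > 0" using a b quotient_of_denom_pos by blast+
  have e: "v $ 1 = of_int (fst a) / of_int (snd a)" "v $ 2 = of_int (fst b) / of_int (snd b)"
    using a b quotient_of_div by blast+
  have "rat_of_nat (nat (snd a * snd b)) = of_int (snd a * snd b)"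
    using pos by (simp add: of_nat_nat)
  then have "of_nat (nat (snd a * snd b)) *s v = ivec (snd b * fst a, snd a * fst b)"
    using pos by (simp add: vec2_eq_iff e)
  then show ?thesis using pos by (intro exI[of _ "nat (snd a * snd b)"]) simp
qed

lemma open_Re_gt: "open {s. Re s > a}"
  by (rule open_halfspace_Re_gt)

lemma
  assumes t: "\<tau> \<in> uhp"
  shows summable_eis_term: "Re s > 2 - real n \<Longrightarrow> (\<lambda>ab. eis_term n s (vpt \<tau> (ivec ab + v))) summable_on UNIV"
    and eis_lat_sum_holomorphic: "eis_lat_sum n v \<tau> holomorphic_on {s. Re s > 2 - real n}"
proof -
  have B: "0 < Im \<tau>" using t by (simp add: uhp_def)
  obtain D where D: "D > 0" "of_nat D *s v \<in> Z2" using ex_denominator by blast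
  have main: "\<exists>r>0. \<exists>M. M summable_on (UNIV :: (int \<times> int) set) \<and> (\<forall>y\<in>ball s r. \<forall>ab. norm (eis_term n y (vpt \<tau> (ivec ab + v))) \<le> M ab)"
    if s: "Re s > 2 - real n" for s
  proof -
    \<comment> \<open>Half the distance to the abscissa of convergence: on the disc of radius
      \<open>r\<close> around s the exponent 2 + r > 2 is still admissible.\<close>
    define r where "r = (Re s - (2 - real n)) / 2"
    have r: "r > 0" using s by (simp add: r_def)
    obtain C m where bd: "\<And>\<tau>' s' p v ab. \<tau>' \<in> strip \<bar>Re \<tau>\<bar> (Im \<tau>) \<Longrightarrow> norm s' \<le> norm s + r \<Longrightarrow> 0 \<le> p \<Longrightarrow>
       p \<le> real n + Re s' \<Longrightarrow> of_nat D *s v \<in> Z2 \<Longrightarrow>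
     norm (eis_term n s' (vpt \<tau>' (ivec ab + v))) \<le> C * (1 + norm (vpt \<tau>' v)) ^ m * lat_major p ab"
      using eis_term_lattice_bound[of "\<bar>Re \<tau>\<bar>" "Im \<tau>" D "norm s + r" n] B D(1) r
      by (metis abs_ge_zero add_nonneg_nonneg less_imp_le norm_ge_zero)
    have "norm (eis_term n y (vpt \<tau> (ivec ab + v))) \<le> C * (1 + norm (vpt \<tau> v)) ^ m * lat_major (2 + r) ab"
      if y: "y \<in> ball s r" for y ab
    proof (rule bd[OF uhp_in_strip[OF t]])
      have ys: "norm (s - y) < r" using y by (simp add: dist_norm)
      show "norm y \<le> norm s + r" using ys norm_triangle_sub[of y s] by (simp add: norm_minus_commute)
      have "Re s - Re y < r" using ys complex_Re_le_cmod[of "s - y"] by simp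
      then show "2 + r \<le> real n + Re y" unfolding r_def by (simp add: field_simps)
    qed (use r D in auto)
    moreover have "(\<lambda>ab. C * (1 + norm (vpt \<tau> v)) ^ m * lat_major (2 + r) ab) summable_on UNIV"
      using r by (intro summable_on_cmult_right summable_on_lat_major) auto
    ultimately show ?thesis using r by blast
  qed
  show "(\<lambda>ab. eis_term n s (vpt \<tau> (ivec ab + v))) summable_on UNIV" if "Re s > 2 - real n"
  proof -
    from main[OF that] obtain r M where r: "r > 0" and M: "M summable_on (UNIV :: (int \<times> int) set)"
      and "\<forall>y\<in>ball s r. \<forall>ab. norm (eis_term n y (vpt \<tau> (ivec ab + v))) \<le> M ab" by blast
    then show ?thesis by (intro summable_on_norm_le[OF M]) auto
  qed
  show "eis_lat_sum n v \<tau> holomorphic_on {s. Re s > 2 - real n}"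
    unfolding eis_lat_sum_def[abs_def]
    by (rule infsum_holomorphic[OF open_Re_gt eis_term_holomorphic_in_s]) (use main in \<open>simp, meson IntE\<close>)
qed

text \<open>The remainder decays with exponent n + Re s + 2, which exceeds 5/2 for n \<ge> 1 and Re
  s > -1/2. So the sum converges across s = 0 with room to spare over the critical exponent
  2.\<close>

lemma
  assumes t: "\<tau> \<in> uhp" and n: "n \<ge> 1"
  shows summable_eis_rem: "Re s > - 1/2 \<Longrightarrow> (\<lambda>ab. eis_rem n s (vpt \<tau> (ivec ab)) (vpt \<tau> v)) summable_on UNIV"
    and infsum_eis_rem_holomorphic:
      "(\<lambda>s. \<Sum>\<^sub>\<infinity>ab. eis_rem n s (vpt \<tau> (ivec ab)) (vpt \<tau> v)) holomorphic_on {s. Re s > - 1/2}"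
proof -
  have B: "0 < Im \<tau>" using t by (simp add: uhp_def)
  obtain D where D: "D > 0" "of_nat D *s v \<in> Z2" using ex_denominator by blast
  have main: "\<exists>r>0. \<exists>M. M summable_on (UNIV :: (int \<times> int) set) \<and> (\<forall>y\<in>ball s r \<inter> {s. Re s > - 1/2}. \<forall>ab. norm (eis_rem n y (vpt \<tau> (ivec ab)) (vpt \<tau> v)) \<le> M ab)"
    for s
  proof -
    obtain C m where bd: "\<And>\<tau>' s' p v ab. \<tau>' \<in> strip \<bar>Re \<tau>\<bar> (Im \<tau>) \<Longrightarrow> norm s' \<le> norm s + 1 \<Longrightarrow> 0 \<le> real n + Re s' \<Longrightarrow> 0 \<le> p \<Longrightarrow>
       p \<le> real n + Re s' + 2 \<Longrightarrow> of_nat D *s v \<in> Z2 \<Longrightarrow>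
     norm (eis_rem n s' (vpt \<tau>' (ivec ab)) (vpt \<tau>' v)) \<le> C * (1 + norm (vpt \<tau>' v)) ^ m * lat_major p ab"
      using eis_rem_lattice_bound[of "\<bar>Re \<tau>\<bar>" "Im \<tau>" D "norm s + 1" n] B D(1)
      by (metis abs_ge_zero add_nonneg_nonneg zero_le_one norm_ge_zero)
    have "norm (eis_rem n y (vpt \<tau> (ivec ab)) (vpt \<tau> v)) \<le> C * (1 + norm (vpt \<tau> v)) ^ m * lat_major (5/2) ab"
      if y: "y \<in> ball s 1" "Re y > - 1/2" for y ab
    proof (rule bd[OF uhp_in_strip[OF t]])
      have ys: "norm (s - y) < 1" using y by (simp add: dist_norm)
      show "norm y \<le> norm s + 1" using ys norm_triangle_sub[of y s] by (simp add: norm_minus_commute)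
      show "5/2 \<le> real n + Re y + 2" "0 \<le> real n + Re y" using y n by auto
    qed (use D in auto)
    moreover have "(\<lambda>ab. C * (1 + norm (vpt \<tau> v)) ^ m * lat_major (5/2) ab) summable_on UNIV"
      by (intro summable_on_cmult_right summable_on_lat_major) auto
    ultimately show ?thesis by (intro exI[of _ 1] exI[of _ "\<lambda>ab. C * (1 + norm (vpt \<tau> v)) ^ m * lat_major (5/2) ab"]) auto
  qed
  show "(\<lambda>ab. eis_rem n s (vpt \<tau> (ivec ab)) (vpt \<tau> v)) summable_on UNIV" if "Re s > - 1/2"
  proof -
    from main[of s] obtain r M where r: "r > 0" and M: "M summable_on (UNIV :: (int \<times> int) set)"
      and "\<forall>y\<in>ball s r \<inter> {s. Re s > - 1/2}. \<forall>ab. norm (eis_rem n y (vpt \<tau> (ivec ab)) (vpt \<tau> v)) \<le> M ab" by blast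
    then show ?thesis using that by (intro summable_on_norm_le[OF M]) auto
  qed
  show "(\<lambda>s. \<Sum>\<^sub>\<infinity>ab. eis_rem n s (vpt \<tau> (ivec ab)) (vpt \<tau> v)) holomorphic_on {s. Re s > - 1/2}"
    by (rule infsum_holomorphic[OF open_Re_gt eis_rem_holomorphic_in_s]) (use main in simp)
qed

lemma bij_shift: "bij (\<lambda>x::int \<times> int. x + c)"
  by (rule bij_betw_byWitness[of _ "\<lambda>x. x - c"]) auto

lemma bij_minus: "bij (\<lambda>x::int \<times> int. - x)"
  by (rule bij_betw_byWitness[of _ "\<lambda>x. - x"]) auto

lemma eis_lat_sum_periodic: "eis_lat_sum n (ivec c + v) \<tau> s = eis_lat_sum n v \<tau> s"
proof -
  have "eis_lat_sum n v \<tau> s = (\<Sum>\<^sub>\<infinity>ab. eis_term n s (vpt \<tau> (ivec (ab + c) + v)))"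
    unfolding eis_lat_sum_def
    by (rule infsum_reindex_bij_betw[OF bij_shift, symmetric])
  then show ?thesis by (simp add: eis_lat_sum_def ivec_add add.assoc)
qed

lemma eis_lat_sum_odd: "odd n \<Longrightarrow> eis_lat_sum n 0 \<tau> s = 0"
proof -
  assume n: "odd n"
  have "eis_lat_sum n 0 \<tau> s = (\<Sum>\<^sub>\<infinity>ab. eis_term n s (vpt \<tau> (ivec (- ab))))"
    unfolding eis_lat_sum_def add_0_right
    by (rule infsum_reindex_bij_betw[OF bij_minus, symmetric])
  also have "\<dots> = - eis_lat_sum n 0 \<tau> s"
    using n by (simp add: ivec_minus vpt_uminus eis_term_minus eis_lat_sum_def infsum_uminus)
  finally show ?thesis by simp
qed

text \<open>For \<open>N v \<in> \<int>\<^sup>2\<close> the linear Taylor terms of the summands at \<open>v\<close> and \<open>N v\<close> cancel, while the sums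
  over \<open>N v + \<int>\<^sup>2\<close> and \<open>\<int>\<^sup>2\<close> agree.\<close>

definition eis_diff :: "nat \<Rightarrow> nat \<Rightarrow> rat^2 \<Rightarrow> complex \<Rightarrow> complex \<Rightarrow> int \<times> int \<Rightarrow> complex" where
  "eis_diff n N v \<tau> s ab = eis_rem n s (vpt \<tau> (ivec ab)) (vpt \<tau> v)
     - eis_rem n s (vpt \<tau> (ivec ab)) (vpt \<tau> (of_nat N *s v)) / of_nat N"

lemma infsum_eis_diff:
  assumes t: "\<tau> \<in> uhp" and n: "n \<ge> 1" and N: "N > 0" "of_nat N *s v \<in> Z2" and s: "Re s > 2"
  shows "(\<Sum>\<^sub>\<infinity>ab. eis_diff n N v \<tau> s ab) = eis_lat_sum n v \<tau> s - eis_lat_sum n 0 \<tau> s"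
proof -
  have sm: "(\<lambda>ab. eis_term n s (vpt \<tau> (ivec ab + v))) summable_on UNIV" for v
    using s n by (intro summable_eis_term[OF t]) auto
  note hs = has_sum_infsum[OF sm, folded eis_lat_sum_def]
  obtain c where c: "of_nat N *s v = ivec c" using N by (auto simp: Z2_eq)
  have eq: "eis_diff n N v \<tau> s ab = eis_term n s (vpt \<tau> (ivec ab + v))
     + (- (1 - 1 / of_nat N)) * eis_term n s (vpt \<tau> (ivec ab + 0))
     + (- (1 / of_nat N)) * eis_term n s (vpt \<tau> (ivec ab + of_nat N *s v))" for ab
  proof -
    define l w where "l = vpt \<tau> (ivec ab)" and "w = vpt \<tau> v"
    have "eis_rem n s l w - eis_rem n s l (of_nat N * w) / of_nat N =
       eis_term n s (l + w) + (- (1 - 1 / of_nat N)) * eis_term n s l + (- (1 / of_nat N)) * eis_term n s (l + of_nat N * w)"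
    proof -
      define u where "u = w / l"
      have u: "of_nat N * w / l = of_nat N * u" by (simp add: u_def)
      show ?thesis using N(1) unfolding eis_rem_def u u_def[symmetric] by (simp add: field_simps)
    qed
    then show ?thesis by (simp add: eis_diff_def l_def w_def vpt_add vpt_smult)
  qed
  have "((\<lambda>ab. eis_diff n N v \<tau> s ab) has_sum (eis_lat_sum n v \<tau> s + (- (1 - 1 / of_nat N)) * eis_lat_sum n 0 \<tau> s
     + (- (1 / of_nat N)) * eis_lat_sum n (of_nat N *s v) \<tau> s)) UNIV"
    unfolding eq by (intro has_sum_add has_sum_cmult_right hs)
  \<comment> \<open>The vector \<open>of_nat N *s v\<close> is integral, so the third sum is again
    the one over Z^2, and its coefficient adds up with that of the second to -1.\<close>
  moreover have "eis_lat_sum n (of_nat N *s v) \<tau> s = eis_lat_sum n 0 \<tau> s"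
    using eis_lat_sum_periodic[of n c 0] c by simp
  ultimately have "(\<Sum>\<^sub>\<infinity>ab. eis_diff n N v \<tau> s ab) = eis_lat_sum n v \<tau> s + (- (1 - 1 / of_nat N)) * eis_lat_sum n 0 \<tau> s
     + (- (1 / of_nat N)) * eis_lat_sum n 0 \<tau> s" using infsumI by metis
  then show ?thesis by (simp add: algebra_simps)
qed

lemma infsum_eis_diff_holomorphic:
  assumes "\<tau> \<in> uhp" "n \<ge> 1"
  shows "(\<lambda>s. \<Sum>\<^sub>\<infinity>ab. eis_diff n N v \<tau> s ab) holomorphic_on {s. Re s > - 1/2}"
proof -
  let ?R = "\<lambda>w s ab. eis_rem n s (vpt \<tau> (ivec ab)) (vpt \<tau> w)"
  have "(\<Sum>\<^sub>\<infinity>ab. eis_diff n N v \<tau> s ab) = infsum (?R v s) UNIV + infsum (?R (of_nat N *s v) s) UNIV * (- 1 / of_nat N)"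
    if "Re s > - 1/2" for s
  proof (rule infsumI)
    note h = has_sum_infsum[OF summable_eis_rem[OF assms that]]
    have "((\<lambda>ab. ?R v s ab + ?R (of_nat N *s v) s ab * (- 1 / of_nat N)) has_sum
        (infsum (?R v s) UNIV + infsum (?R (of_nat N *s v) s) UNIV * (- 1 / of_nat N))) UNIV"
      by (intro has_sum_add has_sum_cmult_left h)
    then show "(eis_diff n N v \<tau> s has_sum (infsum (?R v s) UNIV + infsum (?R (of_nat N *s v) s) UNIV * (- 1 / of_nat N))) UNIV"
      by (simp add: eis_diff_def[abs_def])
  qed
  moreover have "(\<lambda>s. infsum (?R v s) UNIV + infsum (?R (of_nat N *s v) s) UNIV * (- 1 / of_nat N)) holomorphic_on {s. Re s > - 1/2}"
    by (intro holomorphic_intros infsum_eis_rem_holomorphic assms)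
  ultimately show ?thesis by (smt (verit, best) holomorphic_cong mem_Collect_eq)
qed


section \<open>The lattice sum of weight two\<close>

lemma has_sum_diff:
  fixes f g :: "'a \<Rightarrow> 'b :: real_normed_field"
  assumes "(f has_sum a) A" "(g has_sum b) A"
  shows "((\<lambda>x. f x - g x) has_sum (a - b)) A"
  using has_sum_add[OF assms(1) has_sum_uminusI[OF assms(2)]] by simp

text \<open>Unconditional summability permits evaluation along the intervals from -n to n - 1. The
  limits at the two ends may differ, and this difference is where the value in weight two comes
  from.\<close>

lemma infsum_telescope_int:
  fixes F :: "int \<Rightarrow> 'a :: real_normed_vector"
  assumes "(\<lambda>q. F (q + 1) - F q) summable_on UNIV"
    and "(\<lambda>n. F (int n)) \<longlonglongrightarrow> A" and "(\<lambda>n. F (- int n)) \<longlonglongrightarrow> B"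
  shows "(\<Sum>\<^sub>\<infinity>q. F (q + 1) - F q) = A - B"
proof -
  have "((\<lambda>q. F (q + 1) - F q) has_sum (\<Sum>\<^sub>\<infinity>q. F (q + 1) - F q)) UNIV"
    using assms(1) by (rule has_sum_infsum)
  then have lim: "(sum (\<lambda>q. F (q + 1) - F q) \<longlongrightarrow> (\<Sum>\<^sub>\<infinity>q. F (q + 1) - F q)) (finite_subsets_at_top UNIV)"
    by (simp add: has_sum_def)
  have fl: "filterlim (\<lambda>n. {- int n..<int n}) (finite_subsets_at_top UNIV) sequentially"
    unfolding filterlim_finite_subsets_at_top
  proof (intro allI impI)
    fix X :: "int set" assume X: "finite X \<and> X \<subseteq> UNIV"
    define N where "N = Suc (nat (Max (insert 0 (abs ` X))))"
    have N: "\<bar>x\<bar> < int N" if "x \<in> X" for x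
    proof -
      have "\<bar>x\<bar> \<le> Max (insert 0 (abs ` X))" using X that by (intro Max_ge) auto
      then show ?thesis unfolding N_def by linarith
    qed
    show "\<forall>\<^sub>F n in sequentially. finite {- int n..<int n} \<and> X \<subseteq> {- int n..<int n} \<and> {- int n..<int n} \<subseteq> UNIV"
      using eventually_ge_at_top[of N]
    proof eventually_elim
      case (elim n)
      show ?case using N elim by (force simp: abs_less_iff)
    qed
  qed
  have "sum (\<lambda>q. F (q + 1) - F q) {- int n..<int n} = F (int n) - F (- int n)" for n
  proof (induction n)
    case (Suc n)
    have "{- int (Suc n)..<int (Suc n)} = insert (- int (Suc n)) (insert (int n) {- int n..<int n})"
      by auto
    then show ?case using Suc by (simp add: algebra_simps)
  qed auto
  then have "(\<lambda>n. F (int n) - F (- int n)) \<longlonglongrightarrow> (\<Sum>\<^sub>\<infinity>q. F (q + 1) - F q)"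
    using filterlim_compose[OF lim fl] by simp
  then show ?thesis using tendsto_diff[OF assms(2,3)] LIMSEQ_unique by blast
qed

lemma arctan_affine_tendsto:
  fixes c d :: real
  assumes "d > 0"
  shows "(\<lambda>n. arctan ((real n + c) / d)) \<longlonglongrightarrow> pi / 2"
    and "(\<lambda>n. arctan ((- real n + c) / d)) \<longlonglongrightarrow> - (pi / 2)"
proof -
  have f: "filterlim (\<lambda>n. (real n + c') / d) at_top sequentially" for c' :: real
  proof -
    have "filterlim (\<lambda>n. (1 / d) * real n) at_top sequentially"
      using assms by (intro filterlim_tendsto_pos_mult_at_top[OF tendsto_const _ filterlim_real_sequentially]) auto
    then have "filterlim (\<lambda>n. c' / d + (1 / d) * real n) at_top sequentially"
      by (intro filterlim_tendsto_add_at_top[OF tendsto_const])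
    then show ?thesis by (simp add: add_divide_distrib add.commute)
  qed
  show "(\<lambda>n. arctan ((real n + c) / d)) \<longlonglongrightarrow> pi / 2"
    using filterlim_compose[OF tendsto_arctan_at_top f] .
  have "(\<lambda>n. - arctan ((real n + (- c)) / d)) \<longlonglongrightarrow> - (pi / 2)"
    using filterlim_compose[OF tendsto_arctan_at_top f] by (rule tendsto_minus)
  moreover have "arctan ((- real n + c) / d) = - arctan ((real n + (- c)) / d)" for n
  proof -
    have "(- real n + c) / d = - ((real n + (- c)) / d)" by (simp add: minus_divide_left)
    then show ?thesis by (simp only: arctan_minus)
  qed
  ultimately show "(\<lambda>n. arctan ((- real n + c) / d)) \<longlonglongrightarrow> - (pi / 2)" by simp
qed

text \<open>Geometrically, |d + i \<xi>| \<le> |d + i u| + 1 \<le> (1 + 1/d) |d + i u|, because |d +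
  i u| \<ge> d. The factor tends to 1 as d grows, so a sum of such kernels over a unit grid
  approaches its integral.\<close>

lemma lorentz_ratio:
  fixes d u \<xi> :: real
  assumes "d > 0" "\<bar>u - \<xi>\<bar> \<le> 1"
  shows "d / (d\<^sup>2 + u\<^sup>2) \<le> (1 + 1/d)\<^sup>2 * (d / (d\<^sup>2 + \<xi>\<^sup>2))"
proof -
  define t where "t = \<xi> - u"
  have t: "\<bar>t\<bar> \<le> 1" using assms(2) by (simp add: t_def abs_minus_commute)
  have \<xi>: "\<xi> = u + t" by (simp add: t_def)
  have pos: "d\<^sup>2 + u\<^sup>2 > 0" "d\<^sup>2 + \<xi>\<^sup>2 > 0" using assms(1) by (auto intro: add_pos_nonneg)
  have "u * t \<le> \<bar>u\<bar>" using t 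
  proof -
    have "u * t \<le> \<bar>u\<bar> * \<bar>t\<bar>" by (metis abs_ge_self abs_mult)
    also have "\<dots> \<le> \<bar>u\<bar> * 1" using t by (intro mult_left_mono) auto
    finally show ?thesis by simp
  qed
  moreover have "2 * \<bar>u\<bar> \<le> (d\<^sup>2 + u\<^sup>2) / d"
    using assms(1) sum_squares_bound[of "\<bar>u\<bar>" d] by (simp add: field_simps power2_eq_square)
  moreover have "t\<^sup>2 \<le> 1" using t by (simp add: abs_square_le_1)
  moreover have "1 \<le> (d\<^sup>2 + u\<^sup>2) / d\<^sup>2" using assms(1) by (simp add: field_simps)
  moreover have "0 \<le> (d\<^sup>2 + u\<^sup>2) / d" using assms(1) by simp
  ultimately have "d\<^sup>2 + u\<^sup>2 + 2 * (u * t) + t\<^sup>2 \<le> (d\<^sup>2 + u\<^sup>2) + 2 * ((d\<^sup>2 + u\<^sup>2) / d) + (d\<^sup>2 + u\<^sup>2) / d\<^sup>2"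
    by linarith
  also have "\<dots> = (1 + 1/d)\<^sup>2 * (d\<^sup>2 + u\<^sup>2)"
    using assms(1) by (simp add: power2_eq_square field_simps)
  finally have "d\<^sup>2 + \<xi>\<^sup>2 \<le> (1 + 1/d)\<^sup>2 * (d\<^sup>2 + u\<^sup>2)"
    by (simp add: \<xi> power2_sum algebra_simps)
  then have "d * (d\<^sup>2 + \<xi>\<^sup>2) \<le> d * ((1 + 1/d)\<^sup>2 * (d\<^sup>2 + u\<^sup>2))" using assms(1) by (intro mult_left_mono) auto
  then show ?thesis using pos by (simp add: divide_le_eq pos_le_divide_eq mult_ac)
qed

text \<open>By the mean value theorem each unit increment of arctan (u / d) is the kernel at an
  intermediate point, and the total increment is pi. Comparing each sample with its intermediate
  point gives both bounds, with a constant tending to 1 as d grows.\<close>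

lemma infsum_lorentz_bounds:
  fixes c d :: real
  assumes d: "d > 0" and sm: "(\<lambda>q::int. d / (d\<^sup>2 + (of_int q + c)\<^sup>2)) summable_on UNIV"
  defines "K \<equiv> (1 + 1/d)\<^sup>2"
  shows "(\<Sum>\<^sub>\<infinity>q::int. d / (d\<^sup>2 + (of_int q + c)\<^sup>2)) \<le> K * pi"
    and "pi \<le> K * (\<Sum>\<^sub>\<infinity>q::int. d / (d\<^sup>2 + (of_int q + c)\<^sup>2))"
proof -
  let ?g = "\<lambda>u. d / (d\<^sup>2 + u\<^sup>2)"
  let ?th = "\<lambda>q::int. arctan ((of_int q + c) / d)"
  have ex: "\<exists>\<xi>. \<bar>of_int q + c - \<xi>\<bar> \<le> 1 \<and> ?th (q + 1) - ?th q = ?g \<xi>" for q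
  proof -
    have der: "((\<lambda>u. arctan (u / d)) has_real_derivative ?g u) (at u)" for u
      using d by (auto intro!: derivative_eq_intros simp: power2_eq_square field_simps add_pos_nonneg)
    obtain z where "z > of_int q + c" "z < of_int q + c + 1"
      "arctan ((of_int q + c + 1) / d) - arctan ((of_int q + c) / d) = (of_int q + c + 1 - (of_int q + c)) * ?g z"
      using MVT2[of "of_int q + c" "of_int q + c + 1" "\<lambda>u. arctan (u / d)" ?g] der by auto
    then show ?thesis by (intro exI[of _ z]) (auto simp: add_ac)
  qed
  have up: "?th (q + 1) - ?th q \<le> K * ?g (of_int q + c)" for q
  proof -
    obtain \<xi> where x: "\<bar>of_int q + c - \<xi>\<bar> \<le> 1" "?th (q + 1) - ?th q = ?g \<xi>" using ex by blast
    have "\<bar>\<xi> - (of_int q + c)\<bar> \<le> 1" using x(1) by linarith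
    from lorentz_ratio[OF d this] show ?thesis unfolding K_def x(2) .
  qed
  have lo: "?g (of_int q + c) \<le> K * (?th (q + 1) - ?th q)" for q
  proof -
    obtain \<xi> where x: "\<bar>of_int q + c - \<xi>\<bar> \<le> 1" "?th (q + 1) - ?th q = ?g \<xi>" using ex by blast
    from lorentz_ratio[OF d x(1)] show ?thesis unfolding K_def x(2) .
  qed
  have nn: "0 \<le> ?th (q + 1) - ?th q" for q
    using d by (simp add: arctan_monotone' divide_right_mono)
  have smt: "(\<lambda>q. ?th (q + 1) - ?th q) summable_on UNIV"
    by (rule summable_on_comparison_test[OF summable_on_cmult_right[OF sm, of K]]) (use up nn in auto)
  have tot: "(\<Sum>\<^sub>\<infinity>q. ?th (q + 1) - ?th q) = pi"
    using infsum_telescope_int[OF smt] arctan_affine_tendsto[OF d, of c] by simp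
  have "(\<Sum>\<^sub>\<infinity>q::int. ?g (of_int q + c)) \<le> (\<Sum>\<^sub>\<infinity>q. K * (?th (q + 1) - ?th q))"
    using lo by (intro infsum_mono sm summable_on_cmult_right smt) auto
  also have "\<dots> = K * (\<Sum>\<^sub>\<infinity>q. ?th (q + 1) - ?th q)" using smt by (intro infsum_cmult_right) auto
  finally show "(\<Sum>\<^sub>\<infinity>q::int. ?g (of_int q + c)) \<le> K * pi" unfolding tot .
  have "(\<Sum>\<^sub>\<infinity>q. ?th (q + 1) - ?th q) \<le> (\<Sum>\<^sub>\<infinity>q::int. K * ?g (of_int q + c))"
    using up by (intro infsum_mono sm summable_on_cmult_right smt) auto
  also have "\<dots> = K * (\<Sum>\<^sub>\<infinity>q::int. ?g (of_int q + c))" using sm by (intro infsum_cmult_right) auto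
  finally show "pi \<le> K * (\<Sum>\<^sub>\<infinity>q::int. ?g (of_int q + c))" unfolding tot .
qed

section \<open>The divergence form of the Epstein zeta function\<close>

text \<open>Since \<open>|w|\<^bsup>-2-s\<^esup>\<close> is homogeneous of degree \<open>-2-s\<close>, Euler's identity writes
  \<open>s |p\<tau> + q|\<^bsup>-2-s\<^esup>\<close> as minus the divergence of \<open>(p, q) |p\<tau> + q|\<^bsup>-2-s\<^esup>\<close>.  Comparing derivatives with
  differences yields terms that are summable beyond \<open>s = 0\<close>.\<close>

definition epst_rem :: "complex \<Rightarrow> complex \<Rightarrow> int \<times> int \<Rightarrow> complex" where
  "epst_rem \<tau> s ab = (let l = vpt \<tau> (ivec ab) in
     (of_int (fst ab) + 1) * eis_rem 0 (2 + s) l \<tau> + (of_int (snd ab) + 1) * eis_rem 0 (2 + s) l 1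
     - (2 + s) * eis_term 0 (2 + s) l * of_real (Re (\<tau> / l) + Re (1 / l)))"

lemma vpt_ivec: "vpt \<tau> (ivec ab) = of_int (fst ab) * \<tau> + of_int (snd ab)"
  by (simp add: vpt_def)

text \<open>The linear Taylor terms carry the factors p + 1 and q + 1. By Re ((p \<tau> + q) / l) =
  1, their parts with p and q add up to (2 + s) |l|^(-2-s). Two copies of |l|^(-2-s) cancel against
  the constant Taylor terms, which leaves the factor s. The parts stemming from the two added ones
  are removed by the last term of \<open>epst_rem\<close>.\<close>

lemma epst_rem_eq:
  fixes \<tau> s ab
  defines "l \<equiv> vpt \<tau> (ivec ab)"
  shows "epst_rem \<tau> s ab =
     ((of_int (fst ab) + 1) * eis_term 0 (2 + s) (l + \<tau>) - of_int (fst ab) * eis_term 0 (2 + s) l)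
     + ((of_int (snd ab) + 1) * eis_term 0 (2 + s) (l + 1) - of_int (snd ab) * eis_term 0 (2 + s) l)
     + s * eis_term 0 (2 + s) l"
proof (cases "l = 0")
  case True
  then show ?thesis unfolding epst_rem_def Let_def l_def[symmetric] eis_rem_def by simp
next
  case False
  define p q where "p = fst ab" and "q = snd ab"
  define x y where "x = Re (\<tau> / l)" and "y = Re (1 / l)"
  have "of_int p * (\<tau> / l) + of_int q * (1 / l) = 1"
  proof -
    have "of_int p * (\<tau> / l) + of_int q * (1 / l) = (of_int p * \<tau> + of_int q) / l"
      by (simp add: add_divide_distrib)
    also have "of_int p * \<tau> + of_int q = l" by (simp add: p_def q_def l_def vpt_ivec)
    finally show ?thesis using False by simp
  qed
  from arg_cong[OF this, of Re] have "of_int p * x + of_int q * y = 1"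
    unfolding x_def y_def by (simp del: times_divide_eq_right)
  from arg_cong[OF this, of complex_of_real]
  have xy: "of_int p * of_real x + of_int q * of_real y = (1 :: complex)" by simp
  show ?thesis
    unfolding epst_rem_def Let_def l_def[symmetric] eis_rem_def p_def[symmetric] q_def[symmetric]
      x_def[symmetric] y_def[symmetric]
  proof -
    define k where "k = eis_term 0 (2 + s) l"
    have "k * (2 + s) * (of_int p * of_real x + of_int q * of_real y) = k * (2 + s)" by (simp add: xy)
    then show "(of_int p + 1) * (eis_term 0 (2 + s) (l + \<tau>) - eis_term 0 (2 + s) l * (1 - of_nat 0 * (\<tau> / l) - (2 + s) * of_real x)) +
      (of_int q + 1) * (eis_term 0 (2 + s) (l + 1) - eis_term 0 (2 + s) l * (1 - of_nat 0 * (1 / l) - (2 + s) * of_real y)) -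
      (2 + s) * eis_term 0 (2 + s) l * of_real (x + y) =
      (of_int p + 1) * eis_term 0 (2 + s) (l + \<tau>) - of_int p * eis_term 0 (2 + s) l +
      ((of_int q + 1) * eis_term 0 (2 + s) (l + 1) - of_int q * eis_term 0 (2 + s) l) + s * eis_term 0 (2 + s) l"
      unfolding k_def[symmetric] by (simp add: algebra_simps)
  qed
qed

lemma norm_vpt_ivec_ge:
  assumes "\<tau> \<in> uhp"
  obtains c where "0 < c" "c \<le> 1" "\<And>ab. vpt \<tau> (ivec ab) = 0 \<or> c \<le> norm (vpt \<tau> (ivec ab))"
    "\<And>ab. c * (1 + \<bar>of_int (fst ab)\<bar> + \<bar>of_int (snd ab)\<bar>) \<le> 1 + norm (vpt \<tau> (ivec ab))"
proof -
  have B: "Im \<tau> > 0" using assms by (simp add: uhp_def)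
  obtain c where c: "0 < c" "c \<le> 1"
    and s: "\<And>\<tau>' v. \<tau>' \<in> strip \<bar>Re \<tau>\<bar> (Im \<tau>) \<Longrightarrow> of_nat 1 *s v \<in> Z2 \<Longrightarrow> vpt \<tau>' v = 0 \<or> c \<le> norm (vpt \<tau>' v)"
    and l: "\<And>\<tau>' ab. \<tau>' \<in> strip \<bar>Re \<tau>\<bar> (Im \<tau>) \<Longrightarrow> c * (1 + \<bar>of_int (fst ab)\<bar> + \<bar>of_int (snd ab)\<bar>) \<le> 1 + norm (vpt \<tau>' (ivec ab))"
    using strip_bounds[OF abs_ge_zero B zero_less_one] by blast
  show thesis
    by (rule that[OF c]) (use s[OF uhp_in_strip[OF assms] Z2_smult_nat[OF ivec_in_Z2]] l[OF uhp_in_strip[OF assms]] in auto)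
qed

text \<open>For Re s > -1/2 the Taylor remainders decay with exponent 7/2. The coefficients p + 1
  and q + 1 grow at most like 1 + |l| and reduce it to 5/2; the correction term reaches 5/2 through
  its division by l.\<close>

lemma epst_rem_dominated:
  assumes t: "\<tau> \<in> uhp"
  shows "\<exists>M. M summable_on (UNIV :: (int \<times> int) set) \<and>
     (\<forall>s. Re s > - 1/2 \<longrightarrow> norm s \<le> R \<longrightarrow> (\<forall>ab. norm (epst_rem \<tau> s ab) \<le> M ab))"
proof -
  obtain c where c: "0 < c" "c \<le> 1" and sep: "\<And>ab. vpt \<tau> (ivec ab) = 0 \<or> c \<le> norm (vpt \<tau> (ivec ab))"
    and low: "\<And>ab. c * (1 + \<bar>of_int (fst ab)\<bar> + \<bar>of_int (snd ab)\<bar>) \<le> 1 + norm (vpt \<tau> (ivec ab))"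
    using norm_vpt_ivec_ge[OF t] by blast
  obtain C m where C: "C \<ge> 0" and bd: "\<And>s l v p. norm s \<le> R + 2 \<Longrightarrow> 0 \<le> real 0 + Re s \<Longrightarrow> 0 \<le> p \<Longrightarrow>
      p \<le> real 0 + Re s + 2 \<Longrightarrow> l = 0 \<or> c \<le> norm l \<Longrightarrow> l + v = 0 \<or> c \<le> norm (l + v) \<Longrightarrow>
      norm (eis_rem 0 s l v) \<le> C * (1 + norm v) ^ m * (1 + norm l) powr - p"
    using eis_rem_bound[OF c, of "R + 2" 0] by blast
  define C1 where "C1 = (1/c) * (C * (1 + norm \<tau>) ^ m)"
  define C2 where "C2 = (1/c) * (C * 2 ^ m)"
  define C3 where "C3 = (R + 2) * ((2 / c) powr (real 1 + (R + 2)) * (norm \<tau> + 1))"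
  define M where "M = (\<lambda>ab. (C1 + C2 + C3) * (c powr - (5/2) * lat_major (5/2) ab))"
  have sM: "M summable_on UNIV"
    unfolding M_def by (intro summable_on_cmult_right summable_on_lat_major) auto
  have "norm (epst_rem \<tau> s ab) \<le> M ab" if s: "Re s > - 1/2" "norm s \<le> R" for s ab
  proof -
    have R: "R \<ge> 0" using s(2) norm_ge_zero order_trans by blast
    define l where "l = vpt \<tau> (ivec ab)"
    define a b where "a = fst ab" and "b = snd ab"
    have s2: "norm (2 + s) \<le> R + 2" using norm_triangle_ineq[of 2 s] s(2) by simp
    have lt: "l + \<tau> = vpt \<tau> (ivec (ab + (1, 0)))" by (simp add: l_def vpt_ivec algebra_simps)
    have l1: "l + 1 = vpt \<tau> (ivec (ab + (0, 1)))" by (simp add: l_def vpt_ivec algebra_simps)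
    have sl: "l = 0 \<or> c \<le> norm l" "l + \<tau> = 0 \<or> c \<le> norm (l + \<tau>)" "l + 1 = 0 \<or> c \<le> norm (l + 1)"
      using sep[of ab] sep[of "ab + (1, 0)"] sep[of "ab + (0, 1)"] unfolding lt l1 by (simp_all only: l_def)
    have L: "1 + norm l > 0" using norm_ge_zero[of l] by linarith
    have h: "(1 + norm l) * (1 + norm l) powr - (7/2) = (1 + norm l) powr - (5/2)"
      using L powr_add[of "1 + norm l" 1 "- (7/2)"] by simp
    have lowa: "\<bar>of_int a\<bar> + 1 \<le> (1/c) * (1 + norm l)" "\<bar>of_int b\<bar> + 1 \<le> (1/c) * (1 + norm l)"
    proof -
      have "c * (\<bar>of_int a\<bar> + 1) \<le> c * (1 + \<bar>of_int a\<bar> + \<bar>of_int b\<bar>)"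
        "c * (\<bar>of_int b\<bar> + 1) \<le> c * (1 + \<bar>of_int a\<bar> + \<bar>of_int b\<bar>)"
        using c by (auto intro!: mult_left_mono)
      then have "c * (\<bar>of_int a\<bar> + 1) \<le> 1 + norm l" "c * (\<bar>of_int b\<bar> + 1) \<le> 1 + norm l"
        using low[of ab] unfolding a_def b_def l_def by linarith+
      then show "\<bar>of_int a\<bar> + 1 \<le> (1/c) * (1 + norm l)" "\<bar>of_int b\<bar> + 1 \<le> (1/c) * (1 + norm l)"
        using c by (auto simp: field_simps)
    qed
    have n1: "norm (of_int z + 1 :: complex) \<le> \<bar>of_int z\<bar> + 1" for z
      by (metis norm_of_int norm_one norm_triangle_ineq)
    have r1: "norm (eis_rem 0 (2 + s) l \<tau>) \<le> C * (1 + norm \<tau>) ^ m * (1 + norm l) powr - (7/2)"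
      by (rule bd[OF s2 _ _ _ sl(1,2)]) (use s in simp_all)
    have r2: "norm (eis_rem 0 (2 + s) l 1) \<le> C * (1 + norm (1::complex)) ^ m * (1 + norm l) powr - (7/2)"
      by (rule bd[OF s2 _ _ _ sl(1,3)]) (use s in simp_all)
    have t1: "norm ((of_int a + 1) * eis_rem 0 (2 + s) l \<tau>) \<le> C1 * (1 + norm l) powr - (5/2)"
    proof -
      have "norm ((of_int a + 1) * eis_rem 0 (2 + s) l \<tau>) \<le>
        ((1/c) * (1 + norm l)) * (C * (1 + norm \<tau>) ^ m * (1 + norm l) powr - (7/2))"
        unfolding norm_mult using n1[of a] lowa(1) c L by (intro mult_mono r1) auto
      also have "\<dots> = C1 * ((1 + norm l) * (1 + norm l) powr - (7/2))" by (simp add: C1_def)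
      finally show ?thesis unfolding h .
    qed
    have t2: "norm ((of_int b + 1) * eis_rem 0 (2 + s) l 1) \<le> C2 * (1 + norm l) powr - (5/2)"
    proof -
      have "norm ((of_int b + 1) * eis_rem 0 (2 + s) l 1) \<le>
        ((1/c) * (1 + norm l)) * (C * (1 + norm (1::complex)) ^ m * (1 + norm l) powr - (7/2))"
        unfolding norm_mult using n1[of b] lowa(2) c L by (intro mult_mono r2) auto
      also have "\<dots> = C2 * ((1 + norm l) * (1 + norm l) powr - (7/2))" by (simp add: C2_def)
      finally show ?thesis unfolding h .
    qed
    have t3: "norm ((2 + s) * eis_term 0 (2 + s) l * of_real (Re (\<tau> / l) + Re (1 / l))) \<le> C3 * (1 + norm l) powr - (5/2)"
    proof -
      \<comment> \<open>Absorbs the division by l into the weight, so that the correction term is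
        bounded like a summand of weight one.\<close>
      have e: "norm (eis_term 0 (2 + s) l) / norm l = norm (eis_term 1 (2 + s) l)"
        by (simp add: eis_term_def norm_mult norm_inverse divide_inverse mult.commute)
      have "\<bar>Re (\<tau> / l) + Re (1 / l)\<bar> \<le> norm (\<tau> / l) + norm (1 / l)"
        by (rule order_trans[OF abs_triangle_ineq]) (intro add_mono abs_Re_le_cmod)
      then have "\<bar>Re (\<tau> / l) + Re (1 / l)\<bar> \<le> (norm \<tau> + 1) / norm l" by (simp add: norm_divide add_divide_distrib)
      then have "norm ((2 + s) * eis_term 0 (2 + s) l * of_real (Re (\<tau> / l) + Re (1 / l))) \<le>
         (R + 2) * norm (eis_term 0 (2 + s) l) * ((norm \<tau> + 1) / norm l)"
        unfolding norm_mult norm_of_real using s2 R by (intro mult_mono) auto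
      also have "\<dots> = (R + 2) * (norm (eis_term 1 (2 + s) l) * (norm \<tau> + 1))"
        unfolding e[symmetric] by simp
      also have "\<dots> \<le> (R + 2) * (((2 / c) powr (real 1 + (R + 2)) * (1 + norm l) powr - (5/2)) * (norm \<tau> + 1))"
        using R s by (intro mult_left_mono mult_right_mono eis_term_bound[OF c s2 _ _ sl(1)]) simp_all
      finally show ?thesis unfolding C3_def by (simp only: mult_ac)
    qed
    have "norm (epst_rem \<tau> s ab) \<le> norm ((of_int a + 1) * eis_rem 0 (2 + s) l \<tau>) + norm ((of_int b + 1) * eis_rem 0 (2 + s) l 1)
      + norm ((2 + s) * eis_term 0 (2 + s) l * of_real (Re (\<tau> / l) + Re (1 / l)))"
      unfolding epst_rem_def Let_def l_def[symmetric] a_def[symmetric] b_def[symmetric]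
      by (rule order_trans[OF norm_triangle_ineq4]) (rule add_right_mono[OF norm_triangle_ineq])
    also have "\<dots> \<le> (C1 + C2 + C3) * (1 + norm l) powr - (5/2)"
      using t1 t2 t3 unfolding distrib_right by linarith
    also have "\<dots> \<le> M ab"
      unfolding M_def
    proof (intro mult_left_mono)
      show "(1 + norm l) powr - (5/2) \<le> c powr - (5/2) * lat_major (5/2) ab"
        by (rule powr_le_lat_major[OF c]) (use low[of ab] in \<open>auto simp: l_def\<close>)
      show "0 \<le> C1 + C2 + C3" unfolding C1_def C2_def C3_def
        using C c R by (intro add_nonneg_nonneg mult_nonneg_nonneg) auto
    qed
    finally show ?thesis .
  qed
  then show ?thesis using sM by (intro exI[of _ M]) simp
qed

lemma
  assumes t: "\<tau> \<in> uhp"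
  shows summable_epst_rem: "Re s > - 1/2 \<Longrightarrow> epst_rem \<tau> s summable_on UNIV"
    and infsum_epst_rem_holomorphic: "(\<lambda>s. \<Sum>\<^sub>\<infinity>ab. epst_rem \<tau> s ab) holomorphic_on {s. Re s > - 1/2}"
proof -
  show "epst_rem \<tau> s summable_on UNIV" if s: "Re s > - 1/2" for s
  proof -
    obtain M where M: "M summable_on (UNIV :: (int \<times> int) set)" and
      "\<And>y ab. Re y > - 1/2 \<Longrightarrow> norm y \<le> norm s \<Longrightarrow> norm (epst_rem \<tau> y ab) \<le> M ab"
      using epst_rem_dominated[OF t, of "norm s"] by blast
    then show ?thesis using s by (intro summable_on_norm_le[OF M]) auto
  qed
  show "(\<lambda>s. \<Sum>\<^sub>\<infinity>ab. epst_rem \<tau> s ab) holomorphic_on {s. Re s > - 1/2}"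
  proof (rule infsum_holomorphic[OF open_Re_gt])
    have "(\<lambda>s. eis_term n (2 + s) l) holomorphic_on X" "(\<lambda>s. eis_rem n (2 + s) l v) holomorphic_on X" for n l v X
    proof -
      have a: "(\<lambda>s. 2 + s) holomorphic_on X" by (intro holomorphic_intros)
      show "(\<lambda>s. eis_term n (2 + s) l) holomorphic_on X" "(\<lambda>s. eis_rem n (2 + s) l v) holomorphic_on X"
        using holomorphic_on_compose[OF a eis_term_holomorphic_in_s, of n l]
          holomorphic_on_compose[OF a eis_rem_holomorphic_in_s, of n l v] by (simp_all add: o_def)
    qed
    then show "(\<lambda>s. epst_rem \<tau> s ab) holomorphic_on {s. Re s > - 1/2}" for ab
      unfolding epst_rem_def Let_def by (intro holomorphic_intros)
    fix s :: complex
    obtain M where "M summable_on (UNIV :: (int \<times> int) set)" and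
      le: "\<And>y ab. Re y > - 1/2 \<Longrightarrow> norm y \<le> norm s + 1 \<Longrightarrow> norm (epst_rem \<tau> y ab) \<le> M ab"
      using epst_rem_dominated[OF t, of "norm s + 1"] by blast
    moreover have "norm y \<le> norm s + 1" if "y \<in> ball s 1" for y
    proof -
      have "norm (y - s) < 1" using that by (simp add: dist_norm norm_minus_commute)
      then show ?thesis using norm_triangle_sub[of y s] by linarith
    qed
    ultimately show "\<exists>r>0. \<exists>M. M summable_on UNIV \<and> (\<forall>y\<in>ball s r \<inter> {s. - 1 / 2 < Re s}. \<forall>i\<in>UNIV. norm (epst_rem \<tau> y i) \<le> M i)"
      by (intro exI[of _ 1] exI[of _ M]) auto
  qed
qed


text \<open>For Re s > 2 the sums weighted by p and by q converge on their own, so translation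
  invariance makes both difference terms cancel and only the multiple by s remains. At s = 0 this
  separation breaks down.\<close>

lemma infsum_epst_rem:
  assumes t: "\<tau> \<in> uhp" and s: "Re s > 2"
  shows "(\<Sum>\<^sub>\<infinity>ab. epst_rem \<tau> s ab) = s * (\<Sum>\<^sub>\<infinity>ab. eis_term 0 (2 + s) (vpt \<tau> (ivec ab)))"
proof -
  obtain c where c: "0 < c" "c \<le> 1" and sep: "\<And>ab. vpt \<tau> (ivec ab) = 0 \<or> c \<le> norm (vpt \<tau> (ivec ab))"
    and low: "\<And>ab. c * (1 + \<bar>of_int (fst ab)\<bar> + \<bar>of_int (snd ab)\<bar>) \<le> 1 + norm (vpt \<tau> (ivec ab))"
    using norm_vpt_ivec_ge[OF t] by blast
  define k where "k = (\<lambda>ab. eis_term 0 (2 + s) (vpt \<tau> (ivec ab)))"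
  have k: "k summable_on UNIV"
    using summable_eis_term[OF t, of 0 "2 + s" 0] s by (simp add: k_def)
  have coef: "(\<lambda>ab. of_int (f ab) * k ab) summable_on UNIV"
    if f: "\<And>ab. \<bar>f ab\<bar> \<le> \<bar>fst ab\<bar> + \<bar>snd ab\<bar>" for f :: "int \<times> int \<Rightarrow> int"
  proof (rule summable_on_norm_le)
    define C where "C = (1/c) * (2 / c) powr (real 0 + norm (2 + s)) * c powr - 3"
    show "(\<lambda>ab. C * lat_major 3 ab) summable_on UNIV"
      by (intro summable_on_cmult_right summable_on_lat_major) auto
    fix ab :: "int \<times> int"
    define l where "l = vpt \<tau> (ivec ab)"
    have L: "1 + norm l > 0" using norm_ge_zero[of l] by linarith
    have "c * \<bar>of_int (f ab)\<bar> \<le> c * (1 + \<bar>of_int (fst ab)\<bar> + \<bar>of_int (snd ab)\<bar>)"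
      using c f[of ab] by (intro mult_left_mono) linarith+
    also note low
    finally have fa: "\<bar>of_int (f ab)\<bar> \<le> (1/c) * (1 + norm l)"
      using c by (simp add: l_def field_simps)
    have kb: "norm (k ab) \<le> (2 / c) powr (real 0 + norm (2 + s)) * (1 + norm l) powr - 4"
      unfolding k_def l_def[symmetric]
      by (rule eis_term_bound[OF c order_refl]) (use s sep l_def in auto)
    have "norm (of_int (f ab) * k ab) \<le> ((1/c) * (1 + norm l)) * ((2 / c) powr (real 0 + norm (2 + s)) * (1 + norm l) powr - 4)"
      unfolding norm_mult norm_of_int using L c by (intro mult_mono fa kb) auto
    also have "\<dots> = (1/c) * (2 / c) powr (real 0 + norm (2 + s)) * ((1 + norm l) * (1 + norm l) powr - 4)"
      by simp
    also have "(1 + norm l) * (1 + norm l) powr - 4 = (1 + norm l) powr - 3"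
      using L powr_add[of "1 + norm l" 1 "- 4"] by simp
    also have "(1/c) * (2 / c) powr (real 0 + norm (2 + s)) * (1 + norm l) powr - 3 \<le>
        (1/c) * (2 / c) powr (real 0 + norm (2 + s)) * (c powr - 3 * lat_major 3 ab)"
      using c low[of ab] by (intro mult_left_mono powr_le_lat_major) (auto simp: l_def)
    finally show "norm (of_int (f ab) * k ab) \<le> C * lat_major 3 ab" by (simp add: C_def mult_ac)
  qed
  have shift: "((\<lambda>ab. of_int (fst (ab + d)) * k (ab + d)) has_sum (\<Sum>\<^sub>\<infinity>ab. of_int (fst ab) * k ab)) UNIV"
    "((\<lambda>ab. of_int (snd (ab + d)) * k (ab + d)) has_sum (\<Sum>\<^sub>\<infinity>ab. of_int (snd ab) * k ab)) UNIV" for d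
    using has_sum_infsum[OF coef[of fst]] has_sum_infsum[OF coef[of snd]]
    by (subst has_sum_reindex_bij_betw[OF bij_shift]; simp)+
  have d: "k (ab + (1, 0)) = eis_term 0 (2 + s) (vpt \<tau> (ivec ab) + \<tau>)"
    "k (ab + (0, 1)) = eis_term 0 (2 + s) (vpt \<tau> (ivec ab) + 1)" for ab
    by (simp_all add: k_def vpt_ivec algebra_simps)
  have eq: "epst_rem \<tau> s ab = (of_int (fst (ab + (1, 0))) * k (ab + (1, 0)) - of_int (fst ab) * k ab)
      + (of_int (snd (ab + (0, 1))) * k (ab + (0, 1)) - of_int (snd ab) * k ab) + s * k ab" for ab
    unfolding epst_rem_eq d by (simp add: k_def)
  have "((\<lambda>ab. epst_rem \<tau> s ab) has_sum
     (((\<Sum>\<^sub>\<infinity>ab. of_int (fst ab) * k ab) - (\<Sum>\<^sub>\<infinity>ab. of_int (fst ab) * k ab))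
      + ((\<Sum>\<^sub>\<infinity>ab. of_int (snd ab) * k ab) - (\<Sum>\<^sub>\<infinity>ab. of_int (snd ab) * k ab)) + s * infsum k UNIV)) UNIV"
    unfolding eq
    by (intro has_sum_add has_sum_diff has_sum_cmult_right shift has_sum_infsum coef k) auto
  then show ?thesis using infsumI by (fastforce simp: k_def)
qed

text \<open>Because Re (1/l) = (1/l + 1 / cnj l) / 2, the derivative of w^(-1) |w|^(-s) in direction
  1 is - (1 + s/2) w^(-2) |w|^(-s) - (s/2) |w|^(-2-s). Summed over the lattice, the differences in
  that direction cancel, which expresses the weight two sum through the remainders and s times the
  Epstein sum.\<close>

lemma eis_lat_sum_2_eq:
  assumes t: "\<tau> \<in> uhp" and s: "Re s > 2"
  shows "(1 + s / 2) * eis_lat_sum 2 0 \<tau> s =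
     (\<Sum>\<^sub>\<infinity>ab. eis_rem 1 s (vpt \<tau> (ivec ab)) 1) - (\<Sum>\<^sub>\<infinity>ab. epst_rem \<tau> s ab) / 2"
proof -
  define f where "f = (\<lambda>n ab. eis_term n s (vpt \<tau> (ivec ab)))"
  define k where "k = (\<lambda>ab. eis_term 0 (2 + s) (vpt \<tau> (ivec ab)))"
  have f: "f n summable_on UNIV" if "n \<ge> 1" for n
    using summable_eis_term[OF t, of n s 0] s that by (simp add: f_def)
  have k: "k summable_on UNIV"
    using summable_eis_term[OF t, of 0 "2 + s" 0] s by (simp add: k_def)
  have f1: "((\<lambda>ab. f 1 (ab + (0, 1))) has_sum infsum (f 1) UNIV) UNIV"
    by (subst has_sum_reindex_bij_betw[OF bij_shift]) (use f in auto)
  have eq: "eis_rem 1 s (vpt \<tau> (ivec ab)) 1 = f 1 (ab + (0, 1)) - f 1 ab + ((1 + s / 2) * f 2 ab + (s / 2) * k ab)" for ab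
  proof -
    define l where "l = vpt \<tau> (ivec ab)"
    have "eis_term 1 s l * (1 / l + s * of_real (Re (1 / l))) = (1 + s / 2) * eis_term 2 s l + (s / 2) * eis_term 0 (2 + s) l"
    proof (cases "l = 0")
      case False
      have 1: "eis_term 1 s l * (1 / l) = eis_term 2 s l"
        by (simp add: eis_term_def power2_eq_square divide_inverse)
      have "eis_term 0 (2 + s) l = eis_term 1 s l * (1 / cnj l)"
      proof -
        have "of_real (cmod l) powr - (2 + s) = of_real (cmod l) powr - s * of_real (cmod l) powr - 2"
          unfolding powr_add[symmetric] by (simp add: add.commute)
        also have "complex_of_real (cmod l) powr - 2 = inverse (of_real (cmod l) ^ 2)"
          by (simp add: powr_minus)
        also have "of_real (cmod l) ^ 2 = l * cnj l"
          using complex_norm_square[of l] by simp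
        finally show ?thesis by (simp add: eis_term_def divide_inverse mult_ac)
      qed
      moreover have "complex_of_real (Re (1 / l)) = (1 / l + 1 / cnj l) / 2"
        using complex_add_cnj[of "1 / l"] by simp
      ultimately have 2: "eis_term 1 s l * of_real (Re (1 / l)) = (eis_term 2 s l + eis_term 0 (2 + s) l) / 2"
        using 1 by (metis distrib_left times_divide_eq_right)
      have "eis_term 1 s l * (1 / l + s * of_real (Re (1 / l))) =
          eis_term 1 s l * (1 / l) + s * (eis_term 1 s l * of_real (Re (1 / l)))" by (simp only: distrib_left mult_ac)
      then show ?thesis unfolding 1 2 by (simp add: field_simps)
    qed auto
    then have "eis_rem 1 s l 1 = eis_term 1 s (l + 1) - eis_term 1 s l + ((1 + s / 2) * eis_term 2 s l + (s / 2) * eis_term 0 (2 + s) l)"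
      by (simp add: eis_rem_def algebra_simps)
    moreover have "f 1 (ab + (0, 1)) = eis_term 1 s (l + 1)" by (simp add: f_def l_def vpt_ivec algebra_simps)
    ultimately show ?thesis by (simp add: f_def k_def l_def)
  qed
  have "((\<lambda>ab. eis_rem 1 s (vpt \<tau> (ivec ab)) 1) has_sum
     (infsum (f 1) UNIV - infsum (f 1) UNIV + ((1 + s / 2) * infsum (f 2) UNIV + (s / 2) * infsum k UNIV))) UNIV"
    unfolding eq by (intro has_sum_add has_sum_diff has_sum_cmult_right f1 has_sum_infsum f k) auto
  then have "(\<Sum>\<^sub>\<infinity>ab. eis_rem 1 s (vpt \<tau> (ivec ab)) 1) = (1 + s / 2) * infsum (f 2) UNIV + (s / 2) * infsum k UNIV"
    by (simp add: infsumI)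
  moreover have "eis_lat_sum 2 0 \<tau> s = infsum (f 2) UNIV" by (simp add: eis_lat_sum_def f_def)
  ultimately show ?thesis using infsum_epst_rem[OF t s] by (simp add: k_def)
qed


text \<open>The boundary terms that vanish for Re s > 2 survive at s = 0. Let R p be the sum of |p
  \<tau> + q|^(-2) over q. Summing along rows leaves the differences of p R p, which tends to pi /
  Im \<tau> as p tends to infinity and, R being even, to the negative of this at the other
  end.\<close>

lemma infsum_epst_rem_0:
  assumes t: "\<tau> \<in> uhp"
  shows "(\<Sum>\<^sub>\<infinity>ab. epst_rem \<tau> 0 ab) = of_real (2 * pi / Im \<tau>)"
proof -
  define x y where "x = Re \<tau>" and "y = Im \<tau>"
  have y: "y > 0" using t by (simp add: uhp_def y_def)
  define k where "k = (\<lambda>p q :: int. inverse ((cmod (of_int p * \<tau> + of_int q))\<^sup>2))"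
  define T where "T = (\<lambda>p q. (of_int (p + 1) * k (p + 1) q - of_int p * k p q)
     + (of_int (q + 1) * k p (q + 1) - of_int q * k p q))"
  have kt: "eis_term 0 2 w = of_real (inverse ((cmod w)\<^sup>2))" for w
    by (simp add: eis_term_def powr_minus)
  have eT: "epst_rem \<tau> 0 (p, q) = of_real (T p q)" for p q
    by (simp add: epst_rem_eq kt T_def k_def vpt_ivec algebra_simps)
  obtain c where c: "0 < c" "c \<le> 1" and sep: "\<And>ab. vpt \<tau> (ivec ab) = 0 \<or> c \<le> norm (vpt \<tau> (ivec ab))"
    and low: "\<And>ab. c * (1 + \<bar>of_int (fst ab)\<bar> + \<bar>of_int (snd ab)\<bar>) \<le> 1 + norm (vpt \<tau> (ivec ab))"
    using norm_vpt_ivec_ge[OF t] by blast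
  define K where "K = (2 / c) powr 2 * c powr - 2"
  have kK: "k p q \<le> K * (1 + \<bar>of_int q\<bar>) powr - 2" for p q
  proof -
    define l where "l = vpt \<tau> (ivec (p, q))"
    have "k p q = norm (eis_term 0 2 l)" unfolding kt norm_of_real by (simp add: k_def l_def vpt_ivec)
    also have "\<dots> \<le> (2 / c) powr (real 0 + 2) * (1 + norm l) powr - 2"
      by (rule eis_term_bound[OF c]) (use sep l_def in auto)
    also have "\<dots> \<le> (2 / c) powr (real 0 + 2) * (c * (1 + \<bar>of_int q\<bar>)) powr - 2"
    proof (intro mult_left_mono powr_mono2')
      have "c * (1 + \<bar>of_int q\<bar>) \<le> c * (1 + \<bar>of_int p\<bar> + \<bar>of_int q\<bar>)" using c by (intro mult_left_mono) auto
      then show "c * (1 + \<bar>of_int q\<bar>) \<le> 1 + norm l" using low[of "(p, q)"] by (simp add: l_def)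
    qed (use c in \<open>auto intro!: mult_pos_pos\<close>)
    also have "\<dots> = K * (1 + \<bar>of_int q\<bar>) powr - 2" by (simp only: K_def powr_mult mult.assoc of_nat_0 add_0)
    finally show ?thesis .
  qed
  have k0: "k p q \<ge> 0" for p q by (simp add: k_def)
  have ks: "k p summable_on UNIV" for p
    by (rule summable_on_comparison_test[OF summable_on_cmult_right[OF summable_on_int_powr[of 2], of K]])
      (use kK k0 in auto)
  define R where "R = (\<lambda>p. \<Sum>\<^sub>\<infinity>q. k p q)"
  have Re_eq: "Re (epst_rem \<tau> 0 ab) = (case ab of (p, q) \<Rightarrow> T p q)" for ab
    by (cases ab) (simp add: eT)
  have sE: "epst_rem \<tau> 0 summable_on UNIV" by (rule summable_epst_rem[OF t]) auto
  have sT: "(\<lambda>(p, q). T p q) summable_on (UNIV \<times> UNIV)"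
    using summable_on_Re[OF sE] unfolding Re_eq by simp
  have sTp: "T p summable_on UNIV" for p
    using summable_on_SigmaD1[OF sT, of p] by simp
  \<comment> \<open>The sign \<open>e\<close> treats both ends of a row at once; the terms are at
    most K / (n + 1) in absolute value.\<close>
  have zq: "(\<lambda>n. of_int (e * int n) * k p (e * int n)) \<longlonglongrightarrow> 0" if e: "\<bar>e\<bar> = 1" for e p
  proof (rule tendsto_rabs_zero_cancel, rule tendsto_sandwich[OF _ _ tendsto_const])
    show "\<forall>\<^sub>F n in sequentially. 0 \<le> \<bar>of_int (e * int n) * k p (e * int n)\<bar>" by simp
    have "\<bar>of_int (e * int n) * k p (e * int n)\<bar> \<le> K * inverse (real (Suc n))" for n
    proof -
      have ae: "\<bar>real_of_int (e * int n)\<bar> = real n" using e by (simp add: abs_mult flip: of_int_abs)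
      have "\<bar>of_int (e * int n) * k p (e * int n)\<bar> = real n * k p (e * int n)"
        using k0 by (simp only: abs_mult ae) simp
      also have "\<dots> \<le> (1 + real n) * (K * (1 + real n) powr - 2)"
        using kK[of p "e * int n"] k0 unfolding ae by (intro mult_mono) auto
      also have "\<dots> = K * ((1 + real n) powr 1 * (1 + real n) powr - 2)" by simp
      also have "\<dots> = K * inverse (real (Suc n))"
        unfolding powr_add[symmetric] by (simp add: powr_minus add.commute)
      finally show ?thesis .
    qed
    then show "\<forall>\<^sub>F n in sequentially. \<bar>of_int (e * int n) * k p (e * int n)\<bar> \<le> K * inverse (real (Suc n))" by simp
    show "(\<lambda>n. K * inverse (real (Suc n))) \<longlonglongrightarrow> 0"
      using tendsto_mult[OF tendsto_const LIMSEQ_inverse_real_of_nat, of K] by simp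
  qed
  have inner: "infsum (T p) UNIV = of_int (p + 1) * R (p + 1) - of_int p * R p" for p
  proof -
    let ?F = "\<lambda>q. of_int q * k p q"
    have h1: "((\<lambda>q. of_int (p + 1) * k (p + 1) q - of_int p * k p q) has_sum (of_int (p + 1) * R (p + 1) - of_int p * R p)) UNIV"
      unfolding R_def by (intro has_sum_diff has_sum_cmult_right has_sum_infsum ks)
    \<comment> \<open>The differences along the row inherit summability from \<open>T p\<close> by
      subtracting the part \<open>h1\<close>.\<close>
    have h2: "((\<lambda>q. ?F (q + 1) - ?F q) has_sum (infsum (T p) UNIV - (of_int (p + 1) * R (p + 1) - of_int p * R p))) UNIV"
      using has_sum_diff[OF has_sum_infsum[OF sTp[of p]] h1] by (simp add: T_def)
    have "(\<Sum>\<^sub>\<infinity>q. ?F (q + 1) - ?F q) = 0 - 0"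
    proof (rule infsum_telescope_int)
      show "(\<lambda>q. ?F (q + 1) - ?F q) summable_on UNIV" using h2 has_sum_imp_summable by blast
      show "(\<lambda>n. ?F (int n)) \<longlonglongrightarrow> 0" using zq[of 1 p] by simp
      show "(\<lambda>n. ?F (- int n)) \<longlonglongrightarrow> 0" using zq[of "- 1" p] by simp
    qed
    then show ?thesis using infsumI[OF h2] by simp
  qed
  have Rm: "R (- p) = R p" for p
  proof -
    have "R (- p) = (\<Sum>\<^sub>\<infinity>q. k (- p) (- q))"
      unfolding R_def by (rule infsum_reindex_bij_betw[symmetric]) (rule bij_betw_byWitness[of _ uminus]; auto)
    also have "\<dots> = R p"
      unfolding R_def
    proof (rule infsum_cong)
      fix q
      have "of_int (- p) * \<tau> + of_int (- q) = - (of_int p * \<tau> + of_int q)" by simp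
      then show "k (- p) (- q) = k p q" unfolding k_def by (metis norm_minus_cancel)
    qed
    finally show ?thesis .
  qed
  have lim: "(\<lambda>n. of_int (int n) * R (int n)) \<longlonglongrightarrow> pi / y"
  proof -
    have bds: "pi / (1 + 1 / (real n * y))\<^sup>2 \<le> y * (real n * R (int n))"
      "y * (real n * R (int n)) \<le> (1 + 1 / (real n * y))\<^sup>2 * pi" if n: "n > 0" for n
    proof -
      define d where "d = real n * y"
      have d: "d > 0" using n y by (simp add: d_def)
      \<comment> \<open>|n \<tau> + q|^2 = (n y)^2 + (q + n x)^2, so row n is a sum of Lorentz
        kernels of width n y, which grows with n.\<close>
      have kq: "d * k (int n) q = d / (d\<^sup>2 + (of_int q + real n * x)\<^sup>2)" for q
        by (simp add: k_def cmod_power2 d_def x_def y_def divide_inverse add_ac)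
      have sm: "(\<lambda>q::int. d / (d\<^sup>2 + (of_int q + real n * x)\<^sup>2)) summable_on UNIV"
        using summable_on_cmult_right[OF ks, of d "int n"] unfolding kq .
      have "(\<Sum>\<^sub>\<infinity>q. d * k (int n) q) = d * R (int n)"
        unfolding R_def using ks by (intro infsum_cmult_right) auto
      then have "(\<Sum>\<^sub>\<infinity>q::int. d / (d\<^sup>2 + (of_int q + real n * x)\<^sup>2)) = y * (real n * R (int n))"
        unfolding kq by (simp add: d_def)
      note b = infsum_lorentz_bounds[OF d sm, unfolded this]
      show "y * (real n * R (int n)) \<le> (1 + 1 / (real n * y))\<^sup>2 * pi" using b(1) by (simp add: d_def)
      have "(1 + 1 / d)\<^sup>2 > 0" using d by (intro zero_less_power add_pos_pos) auto
      then show "pi / (1 + 1 / (real n * y))\<^sup>2 \<le> y * (real n * R (int n))"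
        using b(2) unfolding d_def[symmetric] by (simp add: pos_divide_le_eq mult.commute)
    qed
    have z: "(\<lambda>n. 1 / (real n * y)) \<longlonglongrightarrow> 0"
      using tendsto_mult[OF lim_inverse_n tendsto_const[of "1 / y"]] by (simp add: divide_inverse)
    have u: "(\<lambda>n. (1 + 1 / (real n * y))\<^sup>2 * pi) \<longlonglongrightarrow> (1 + 0)\<^sup>2 * pi" by (intro tendsto_intros z)
    have l: "(\<lambda>n. pi / (1 + 1 / (real n * y))\<^sup>2) \<longlonglongrightarrow> pi / (1 + 0)\<^sup>2" by (intro tendsto_intros z) auto
    have "(\<lambda>n. y * (real n * R (int n))) \<longlonglongrightarrow> pi"
    proof (rule tendsto_sandwich[OF _ _ _ _])
      show "\<forall>\<^sub>F n in sequentially. pi / (1 + 1 / (real n * y))\<^sup>2 \<le> y * (real n * R (int n))"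
        using eventually_gt_at_top[of 0] by eventually_elim (rule bds(1))
      show "\<forall>\<^sub>F n in sequentially. y * (real n * R (int n)) \<le> (1 + 1 / (real n * y))\<^sup>2 * pi"
        using eventually_gt_at_top[of 0] by eventually_elim (rule bds(2))
    qed (use l u in auto)
    from tendsto_divide[OF this tendsto_const[of y]] show ?thesis using y by simp
  qed
  \<comment> \<open>Summability over Z^2, known from the remainder estimates, justifies the
    evaluation row by row.\<close>
  have "(\<Sum>\<^sub>\<infinity>(p,q)\<in>UNIV \<times> UNIV. T p q) = (\<Sum>\<^sub>\<infinity>p. infsum (T p) UNIV)"
    using infsum_Sigma'_banach[of T UNIV "\<lambda>_. UNIV"] sT by simp
  also have "\<dots> = (\<Sum>\<^sub>\<infinity>p. of_int (p + 1) * R (p + 1) - of_int p * R p)" by (simp add: inner)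
  also have "\<dots> = pi / y - (- (pi / y))"
  proof (rule infsum_telescope_int)
    show "(\<lambda>p. of_int (p + 1) * R (p + 1) - of_int p * R p) summable_on UNIV"
      using summable_on_Sigma_banach[of T UNIV "\<lambda>_. UNIV"] sT by (simp add: inner)
    show "(\<lambda>n. of_int (- int n) * R (- int n)) \<longlonglongrightarrow> - (pi / y)"
      using tendsto_minus[OF lim] by (simp add: Rm)
  qed (rule lim)
  finally have val: "(\<Sum>\<^sub>\<infinity>(p,q)\<in>UNIV \<times> UNIV. T p q) = 2 * pi / y" by simp
  have "((\<lambda>(p, q). T p q) has_sum (2 * pi / y)) UNIV"
    using has_sum_infsum[OF sT] unfolding val by simp
  from has_sum_of_real[OF this, where 'a = complex]
  have "((\<lambda>ab. epst_rem \<tau> 0 ab) has_sum of_real (2 * pi / y)) UNIV"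
    by (rule has_sum_cong[THEN iffD1, rotated]) (auto simp: eT)
  then show ?thesis using infsumI y_def by blast
qed


section \<open>Eisenstein--Kronecker series\<close>

definition eis_vsum :: "nat \<Rightarrow> (rat^2) set \<Rightarrow> complex \<Rightarrow> complex \<Rightarrow> complex" where
  "eis_vsum n V \<tau> s = (\<Sum>\<^sub>\<infinity>x\<in>V. eis_term n s (vpt \<tau> x))"

lemma vpt_eq_0_iff: "\<tau> \<in> uhp \<Longrightarrow> vpt \<tau> x = 0 \<longleftrightarrow> x = 0"
proof -
  assume t: "\<tau> \<in> uhp"
  have "x = 0" if "vpt \<tau> x = 0"
  proof -
    have "Im (vpt \<tau> x) = of_rat (x $ 1) * Im \<tau>" by (simp add: vpt_of_real)
    then have "x $ 1 = 0" using that t by (simp add: uhp_def)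
    then show ?thesis using that by (simp add: vpt_def vec2_eq_iff)
  qed
  then show ?thesis by auto
qed

lemma inj_vpt: "\<tau> \<in> uhp \<Longrightarrow> inj (vpt \<tau>)"
  by (rule injI) (metis vpt_eq_0_iff vpt_add vpt_uminus eq_iff_diff_eq_0 diff_conv_add_uminus)

lemma eis_sum_eq_vsum:
  assumes "\<tau> \<in> uhp"
  shows "eis_sum n V 0 \<tau> s = eis_vsum n V \<tau> s"
proof -
  have l: "lat V \<tau> = vpt \<tau> ` V" by (simp add: lat_def vpt_def[abs_def])
  have "eis_sum n V 0 \<tau> s = (\<Sum>\<^sub>\<infinity>\<omega>\<in>vpt \<tau> ` V. eis_term n s \<omega>)"
    unfolding eis_sum_def l by (rule infsum_cong_neutral) (auto simp: eis_term_def)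
  also have "\<dots> = (\<Sum>\<^sub>\<infinity>x\<in>V. eis_term n s (vpt \<tau> x))"
    by (subst infsum_reindex) (auto simp: o_def intro: inj_on_subset[OF inj_vpt[OF assms]])
  finally show ?thesis by (simp add: eis_vsum_def)
qed

text \<open>Summability is included because splitting V relies on it. The continuation is compared
  with the series only for Re s > 2, where it converges in every weight; agreement on the full
  half-plane of convergence follows from the identity theorem and the holomorphy clause.\<close>

definition has_phi :: "nat \<Rightarrow> (rat^2) set \<Rightarrow> complex \<Rightarrow> complex \<Rightarrow> bool" where
  "has_phi n V \<tau> c \<longleftrightarrow>
     (\<forall>s. Re s > 2 - real n \<longrightarrow> (\<lambda>x. eis_term n s (vpt \<tau> x)) summable_on V) \<and>
     eis_vsum n V \<tau> holomorphic_on {s. Re s > 2 - real n} \<and>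
     (\<exists>F. \<exists>\<epsilon>>0. F holomorphic_on {s. Re s > - \<epsilon>} \<and> (\<forall>s. Re s > 2 \<longrightarrow> F s = eis_vsum n V \<tau> s) \<and> F 0 = c)"

lemma halfplane_identity:
  assumes "f holomorphic_on {s. Re s > a}" "g holomorphic_on {s. Re s > a}"
    and "\<And>s. Re s > b \<Longrightarrow> f s = g s" and "Re z > a"
  shows "f z = g z"
proof (rule analytic_continuation_open[of "{s. Re s > max a b}" "{s. Re s > a}" f g])
  show "open {s. Re s > max a b}" "open {s. Re s > a}" by (rule open_Re_gt)+
  have "complex_of_real (max a b + 1) \<in> {s. Re s > max a b}" by (simp add: max_def)
  then show "{s. Re s > max a b} \<noteq> {}" by blast
  show "connected {s. Re s > a}" by (intro convex_connected convex_halfspace_Re_gt)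
qed (use assms in auto)

lemma has_phi_imp_phi_eq:
  assumes "\<tau> \<in> uhp" "has_phi n V \<tau> c"
  shows "phi n V 0 \<tau> = c"
proof -
  obtain F \<epsilon> where F: "\<epsilon> > 0" "F holomorphic_on {s. Re s > - \<epsilon>}" "\<And>s. Re s > 2 \<Longrightarrow> F s = eis_vsum n V \<tau> s" "F 0 = c"
    and hol: "eis_vsum n V \<tau> holomorphic_on {s. Re s > 2 - real n}"
    using assms(2) unfolding has_phi_def by blast
  have eq: "F s = eis_vsum n V \<tau> s" if "Re s > - \<epsilon>" "Re s > 2 - real n" for s
  proof (rule halfplane_identity[of F "max (- \<epsilon>) (2 - real n)" "eis_vsum n V \<tau>" 2])
    show "F holomorphic_on {s. max (- \<epsilon>) (2 - real n) < Re s}" by (rule holomorphic_on_subset[OF F(2)]) auto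
    show "eis_vsum n V \<tau> holomorphic_on {s. max (- \<epsilon>) (2 - real n) < Re s}" by (rule holomorphic_on_subset[OF hol]) auto
  qed (use F(3) that in auto)
  show ?thesis
    unfolding phi_def eis_sum_eq_vsum[OF assms(1)]
  proof (rule the_equality)
    \<comment> \<open>For n \<ge> 3 the half-plane of convergence may extend to the left of Re s =
      -\<epsilon>, and \<open>phi\<close> requires agreement on all of it. There the function is
      given by the series itself.\<close>
    define G where "G = (\<lambda>s. if Re s > - \<epsilon> then F s else eis_vsum n V \<tau> s)"
    have "G holomorphic_on {s. Re s > - \<epsilon>} \<longleftrightarrow> F holomorphic_on {s. Re s > - \<epsilon>}"
      by (rule holomorphic_cong) (auto simp: G_def)
    then show "\<exists>F. \<exists>\<epsilon>>0. F holomorphic_on {s. - \<epsilon> < Re s} \<and> (\<forall>s. 2 - real n < Re s \<longrightarrow> F s = eis_vsum n V \<tau> s) \<and> F 0 = c"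
      using F eq by (intro exI[of _ G] exI[of _ \<epsilon>]) (auto simp: G_def)
    fix c' assume "\<exists>F. \<exists>\<epsilon>>0. F holomorphic_on {s. - \<epsilon> < Re s} \<and> (\<forall>s. 2 - real n < Re s \<longrightarrow> F s = eis_vsum n V \<tau> s) \<and> F 0 = c'"
    then obtain F' \<epsilon>' where F': "\<epsilon>' > 0" "F' holomorphic_on {s. Re s > - \<epsilon>'}" "\<And>s. Re s > 2 - real n \<Longrightarrow> F' s = eis_vsum n V \<tau> s" "F' 0 = c'"
      by blast
    have "F' 0 = F 0"
    proof (rule halfplane_identity[of F' "- min \<epsilon> \<epsilon>'" F 2])
      show "F holomorphic_on {s. - min \<epsilon> \<epsilon>' < Re s}" by (rule holomorphic_on_subset[OF F(2)]) auto
      show "F' holomorphic_on {s. - min \<epsilon> \<epsilon>' < Re s}" by (rule holomorphic_on_subset[OF F'(2)]) auto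
      show "F' s = F s" if "Re s > 2" for s using F(3)[of s] F'(3)[of s] that by simp
    qed (use F F' in auto)
    then show "c' = c" using F F' by simp
  qed
qed

lemma has_phi_Un:
  assumes "has_phi n V \<tau> c" "has_phi n W \<tau> d" "V \<inter> W = {}"
  shows "has_phi n (V \<union> W) \<tau> (c + d)"
proof -
  have sV: "(\<lambda>x. eis_term n s (vpt \<tau> x)) summable_on V" and sW: "(\<lambda>x. eis_term n s (vpt \<tau> x)) summable_on W"
    if "Re s > 2 - real n" for s using assms that unfolding has_phi_def by blast+
  have eq: "eis_vsum n (V \<union> W) \<tau> s = eis_vsum n V \<tau> s + eis_vsum n W \<tau> s" if "Re s > 2 - real n" for s
    unfolding eis_vsum_def using sV[OF that] sW[OF that] assms(3) by (rule infsum_Un_disjoint)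
  obtain F \<epsilon> where F: "\<epsilon> > 0" "F holomorphic_on {s. Re s > - \<epsilon>}" "\<And>s. Re s > 2 \<Longrightarrow> F s = eis_vsum n V \<tau> s" "F 0 = c"
    using assms(1) unfolding has_phi_def by blast
  obtain G \<delta> where G: "\<delta> > 0" "G holomorphic_on {s. Re s > - \<delta>}" "\<And>s. Re s > 2 \<Longrightarrow> G s = eis_vsum n W \<tau> s" "G 0 = d"
    using assms(2) unfolding has_phi_def by blast
  show ?thesis unfolding has_phi_def
  proof (intro conjI exI[of _ "\<lambda>s. F s + G s"] exI[of _ "min \<epsilon> \<delta>"] allI impI)
    show "(\<lambda>x. eis_term n s (vpt \<tau> x)) summable_on V \<union> W" if "Re s > 2 - real n" for s
      using sV[OF that] sW[OF that] by (rule summable_on_union)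
    have "(\<lambda>s. eis_vsum n V \<tau> s + eis_vsum n W \<tau> s) holomorphic_on {s. Re s > 2 - real n}"
      using assms unfolding has_phi_def by (intro holomorphic_on_add) auto
    then show "eis_vsum n (V \<union> W) \<tau> holomorphic_on {s. Re s > 2 - real n}"
      by (subst holomorphic_cong[OF refl eq]) auto
    show "(\<lambda>s. F s + G s) holomorphic_on {s. - min \<epsilon> \<delta> < Re s}"
      using F G by (intro holomorphic_on_add holomorphic_on_subset[OF F(2)] holomorphic_on_subset[OF G(2)]) auto
  qed (use F G eq in auto)
qed

lemma has_phi_empty: "has_phi n {} \<tau> 0"
  unfolding has_phi_def eis_vsum_def[abs_def] by (auto intro!: exI[of _ "\<lambda>_. 0"] exI[of _ 1])

text \<open>One statement for two uses: homogeneity in V, with \<tau>' = \<tau>, and modularity,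
  with \<tau>' the image of \<tau> under a Moebius map. The series changes by
  \<open>eis_term n s k\<close>, which is entire in s and equals k^(-n) at s = 0.\<close>

lemma has_phi_transfer:
  assumes "has_phi n (g ` V) \<tau> c" "inj_on g V" "k \<noteq> 0"
    and "\<And>x. x \<in> V \<Longrightarrow> vpt \<tau>' x = k * vpt \<tau> (g x)"
  shows "has_phi n V \<tau>' (c / k ^ n)"
proof -
  obtain F \<epsilon> where F: "\<epsilon> > 0" "F holomorphic_on {s. Re s > - \<epsilon>}" "\<And>s. Re s > 2 \<Longrightarrow> F s = eis_vsum n (g ` V) \<tau> s" "F 0 = c"
    using assms(1) unfolding has_phi_def by blast
  have t: "eis_term n s (vpt \<tau>' x) = eis_term n s k * eis_term n s (vpt \<tau> (g x))" if "x \<in> V" for s x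
    using assms(4)[OF that] by (simp add: eis_term_mult)
  have eq: "eis_vsum n V \<tau>' s = eis_term n s k * eis_vsum n (g ` V) \<tau> s" for s
  proof -
    have "eis_vsum n V \<tau>' s = (\<Sum>\<^sub>\<infinity>x\<in>V. eis_term n s k * eis_term n s (vpt \<tau> (g x)))"
      unfolding eis_vsum_def by (rule infsum_cong) (rule t)
    also have "\<dots> = eis_term n s k * (\<Sum>\<^sub>\<infinity>x\<in>V. eis_term n s (vpt \<tau> (g x)))" by (rule infsum_cmult_right')
    also have "(\<Sum>\<^sub>\<infinity>x\<in>V. eis_term n s (vpt \<tau> (g x))) = eis_vsum n (g ` V) \<tau> s"
      unfolding eis_vsum_def by (subst infsum_reindex[OF assms(2)]) (simp add: o_def)
    finally show ?thesis .
  qed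
  show ?thesis unfolding has_phi_def
  proof (intro conjI exI[of _ "\<lambda>s. eis_term n s k * F s"] exI[of _ \<epsilon>] allI impI)
    show "(\<lambda>x. eis_term n s (vpt \<tau>' x)) summable_on V" if "Re s > 2 - real n" for s
    proof -
      have "(\<lambda>x. eis_term n s (vpt \<tau> x)) summable_on g ` V" using assms(1) that unfolding has_phi_def by blast
      then have "(\<lambda>x. eis_term n s (vpt \<tau> (g x))) summable_on V"
        using summable_on_reindex[OF assms(2), of "\<lambda>x. eis_term n s (vpt \<tau> x)"] by (simp add: o_def)
      then have "(\<lambda>x. eis_term n s k * eis_term n s (vpt \<tau> (g x))) summable_on V" by (rule summable_on_cmult_right)
      then show ?thesis by (rule summable_on_cong[THEN iffD1, rotated]) (simp add: t)
    qed
    show "eis_vsum n V \<tau>' holomorphic_on {s. Re s > 2 - real n}"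
      unfolding eq[abs_def] using assms(1) unfolding has_phi_def
      by (intro holomorphic_on_mult eis_term_holomorphic_in_s) auto
    show "(\<lambda>s. eis_term n s k * F s) holomorphic_on {s. - \<epsilon> < Re s}"
      using F by (intro holomorphic_on_mult eis_term_holomorphic_in_s) auto
  qed (use F eq assms(3) in \<open>auto simp: eis_term_at_0 divide_inverse\<close>)
qed

section \<open>Values for the cosets of Z^2\<close>

definition zcos :: "rat^2 \<Rightarrow> (rat^2) set" where "zcos v = (\<lambda>z. v + z) ` Z2"

lemma bij_betw_zcos: "bij_betw (\<lambda>ab. ivec ab + v) UNIV (zcos v)"
  unfolding bij_betw_def zcos_def Z2_eq
  by (auto simp: inj_on_def image_image add.commute dest: injD[OF inj_ivec])

lemma eis_vsum_zcos: "eis_vsum n (zcos v) \<tau> s = eis_lat_sum n v \<tau> s"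
  unfolding eis_vsum_def eis_lat_sum_def by (rule infsum_reindex_bij_betw[OF bij_betw_zcos, symmetric])

lemma has_phi_zcosI:
  assumes "\<tau> \<in> uhp" "\<epsilon> > 0" "F holomorphic_on {s. Re s > - \<epsilon>}" "\<And>s. Re s > 2 \<Longrightarrow> F s = eis_lat_sum n v \<tau> s"
  shows "has_phi n (zcos v) \<tau> (F 0)"
  unfolding has_phi_def eis_vsum_zcos[abs_def]
proof (intro conjI exI[of _ F] exI[of _ \<epsilon>] allI impI)
  show "(\<lambda>x. eis_term n s (vpt \<tau> x)) summable_on zcos v" if "Re s > 2 - real n" for s
    using summable_eis_term[OF assms(1) that, of v] summable_on_reindex_bij_betw[OF bij_betw_zcos] by fast
qed (use assms eis_lat_sum_holomorphic in auto)

text \<open>The coefficient of 1 / Im \<tau>: minus one half of the 2 pi from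
  \<open>infsum_epst_rem_0\<close>, as in the classical nonholomorphic series G_2 - pi / Im
  \<tau>.\<close>

definition phi_const :: "nat \<Rightarrow> complex" where
  "phi_const n = (if n = 2 then - of_real pi else 0)"

text \<open>In weight two the number 1 is written as the point
  \<open>vpt \<tau> (ivec (0, 1))\<close>, which puts this sum in the shape of
  \<open>tame_eis_rem\<close>.\<close>

definition phi_hol :: "nat \<Rightarrow> nat \<Rightarrow> rat^2 \<Rightarrow> complex \<Rightarrow> complex" where
  "phi_hol n N v \<tau> = (if n \<ge> 3 then \<Sum>\<^sub>\<infinity>ab. eis_term n 0 (vpt \<tau> (ivec ab + v)) else
     (\<Sum>\<^sub>\<infinity>ab. eis_diff n N v \<tau> 0 ab) + (if n = 2 then \<Sum>\<^sub>\<infinity>ab. eis_rem 1 0 (vpt \<tau> (ivec ab)) (vpt \<tau> (ivec (0, 1))) else 0))"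

lemma has_phi_zcos:
  assumes t: "\<tau> \<in> uhp" and n: "n \<ge> 1" and N: "N > 0" "of_nat N *s v \<in> Z2"
  shows "has_phi n (zcos v) \<tau> (phi_hol n N v \<tau> + phi_const n / of_real (Im \<tau>))"
proof -
  consider "n \<ge> 3" | "n = 1" | "n = 2" using n by linarith
  then show ?thesis
  proof cases
    case 1
    have "has_phi n (zcos v) \<tau> (eis_lat_sum n v \<tau> 0)"
      using 1 by (intro has_phi_zcosI[of _ 1] t holomorphic_on_subset[OF eis_lat_sum_holomorphic[OF t]]) auto
    then show ?thesis using 1 by (simp add: phi_hol_def phi_const_def eis_lat_sum_def)
  next
    case 2
    have "has_phi n (zcos v) \<tau> (\<Sum>\<^sub>\<infinity>ab. eis_diff n N v \<tau> 0 ab)"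
      by (rule has_phi_zcosI[of _ "1/2"])
        (use infsum_eis_diff_holomorphic[OF t n] infsum_eis_diff[OF t n N] eis_lat_sum_odd[of n] 2 t in auto)
    then show ?thesis using 2 by (simp add: phi_hol_def phi_const_def)
  next
    case 3
    define F where "F = (\<lambda>s. (\<Sum>\<^sub>\<infinity>ab. eis_diff 2 N v \<tau> s ab) +
      ((\<Sum>\<^sub>\<infinity>ab. eis_rem 1 s (vpt \<tau> (ivec ab)) (vpt \<tau> (ivec (0, 1)))) - (\<Sum>\<^sub>\<infinity>ab. epst_rem \<tau> s ab) / 2) / (1 + s / 2))"
    have nz: "1 + s / 2 \<noteq> 0" if "Re s > - 1/2" for s :: complex
    proof
      assume "1 + s / 2 = 0"
      moreover have "2 + s = 2 * (1 + s / 2)" by simp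
      ultimately have "2 + s = 0" by simp
      then have "s = - 2" by (simp add: eq_neg_iff_add_eq_0 add.commute)
      then show False using that by simp
    qed
    have one: "vpt \<tau> (ivec (0, 1)) = 1" by (simp add: vpt_ivec)
    have "has_phi 2 (zcos v) \<tau> (F 0)"
    proof (rule has_phi_zcosI[OF t, of "1/2"])
      show "F holomorphic_on {s. - (1/2) < Re s}"
        unfolding F_def using infsum_eis_diff_holomorphic[OF t, of 2] infsum_eis_rem_holomorphic[OF t, of 1] infsum_epst_rem_holomorphic[OF t] nz
        by (intro holomorphic_intros) auto
      show "F s = eis_lat_sum 2 v \<tau> s" if s: "Re s > 2" for s
      proof -
        have "(\<Sum>\<^sub>\<infinity>ab. eis_rem 1 s (vpt \<tau> (ivec ab)) 1) - (\<Sum>\<^sub>\<infinity>ab. epst_rem \<tau> s ab) / 2 = (1 + s / 2) * eis_lat_sum 2 0 \<tau> s"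
          using eis_lat_sum_2_eq[OF t s] by simp
        then show ?thesis unfolding F_def one using nz[of s] s infsum_eis_diff[OF t _ N s, of 2] by simp
      qed
    qed auto
    moreover have "F 0 = phi_hol 2 N v \<tau> + phi_const 2 / of_real (Im \<tau>)"
      using infsum_epst_rem_0[OF t] by (simp add: F_def phi_hol_def phi_const_def)
    ultimately show ?thesis using 3 by simp
  qed
qed

text \<open>Families whose sum over Z^2 is holomorphic in \<tau> and of polynomial growth on strips.
  Both kinds of summands reach the exponent 3 at s = 0: the plain terms since n \<ge> 3, the
  remainders since n + 2 \<ge> 3.\<close>

definition tame :: "(complex \<Rightarrow> int \<times> int \<Rightarrow> complex) \<Rightarrow> bool" where
  "tame G \<longleftrightarrow> (\<forall>ab. (\<lambda>\<tau>. G \<tau> ab) holomorphic_on uhp) \<and>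
     (\<forall>A\<ge>0. \<forall>B>0. \<exists>C\<ge>0. \<exists>m. \<forall>\<tau>\<in>strip A B. \<forall>ab. norm (G \<tau> ab) \<le> C * (1 + norm \<tau>) ^ m * lat_major 3 ab)"

lemma tame_hol: "tame G \<Longrightarrow> (\<lambda>\<tau>. G \<tau> ab) holomorphic_on uhp"
  by (simp only: tame_def)

lemma tame_bound:
  assumes "tame G" "0 \<le> A" "0 < B"
  obtains C m where "0 \<le> C" "\<And>\<tau> ab. \<tau> \<in> strip A B \<Longrightarrow> norm (G \<tau> ab) \<le> C * (1 + norm \<tau>) ^ m * lat_major 3 ab"
proof -
  have "\<exists>C\<ge>0. \<exists>m. \<forall>\<tau>\<in>strip A B. \<forall>ab. norm (G \<tau> ab) \<le> C * (1 + norm \<tau>) ^ m * lat_major 3 ab"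
    using assms(1)[unfolded tame_def, THEN conjunct2, THEN spec, THEN mp, OF assms(2), THEN spec, THEN mp, OF assms(3)] .
  then obtain C m where "C \<ge> 0" "\<forall>\<tau>\<in>strip A B. \<forall>ab. norm (G \<tau> ab) \<le> C * (1 + norm \<tau>) ^ m * lat_major 3 ab" by auto
  then show thesis by (intro that[of C m]) blast+
qed

lemma tameI:
  assumes "\<And>ab. (\<lambda>\<tau>. G \<tau> ab) holomorphic_on uhp"
    and "\<And>A B. 0 \<le> A \<Longrightarrow> 0 < B \<Longrightarrow> \<exists>C m. 0 \<le> C \<and>
       (\<forall>\<tau> ab. \<tau> \<in> strip A B \<longrightarrow> norm (G \<tau> ab) \<le> C * (1 + norm \<tau>) ^ m * lat_major 3 ab)"
  shows "tame G"
  unfolding tame_def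
proof (intro conjI allI impI)
  fix A B :: real assume "0 \<le> A" "0 < B"
  from assms(2)[OF this] obtain C m where
    "0 \<le> C" "\<forall>\<tau> ab. \<tau> \<in> strip A B \<longrightarrow> norm (G \<tau> ab) \<le> C * (1 + norm \<tau>) ^ m * lat_major 3 ab" by blast
  then show "\<exists>C\<ge>0. \<exists>m. \<forall>\<tau>\<in>strip A B. \<forall>ab. norm (G \<tau> ab) \<le> C * (1 + norm \<tau>) ^ m * lat_major 3 ab"
    by blast
qed (rule assms(1))

lemma growth_add:
  fixes x :: real
  assumes "0 \<le> C" "0 \<le> D" "0 \<le> x"
  shows "C * (1 + x) ^ m + D * (1 + x) ^ k \<le> (C + D) * (1 + x) ^ (m + k)"
proof -
  have "C * (1 + x) ^ m \<le> C * (1 + x) ^ (m + k)" "D * (1 + x) ^ k \<le> D * (1 + x) ^ (m + k)"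
    using assms by (auto intro!: mult_left_mono power_increasing)
  then show ?thesis by (simp add: distrib_right)
qed

lemma tame_add:
  assumes "tame G" "tame G'"
  shows "tame (\<lambda>\<tau> ab. G \<tau> ab + G' \<tau> ab)"
proof (rule tameI)
  show "(\<lambda>\<tau>. G \<tau> ab + G' \<tau> ab) holomorphic_on uhp" for ab
    using assms by (intro holomorphic_on_add tame_hol)
  fix A B :: real assume AB: "A \<ge> 0" "B > 0"
  obtain C m where C: "C \<ge> 0" "\<And>\<tau> ab. \<tau> \<in> strip A B \<Longrightarrow> norm (G \<tau> ab) \<le> C * (1 + norm \<tau>) ^ m * lat_major 3 ab"
    using tame_bound[OF assms(1) AB] by blast
  obtain D k where D: "D \<ge> 0" "\<And>\<tau> ab. \<tau> \<in> strip A B \<Longrightarrow> norm (G' \<tau> ab) \<le> D * (1 + norm \<tau>) ^ k * lat_major 3 ab"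
    using tame_bound[OF assms(2) AB] by blast
  have "norm (G \<tau> ab + G' \<tau> ab) \<le> (C + D) * (1 + norm \<tau>) ^ (m + k) * lat_major 3 ab" if "\<tau> \<in> strip A B" for \<tau> ab
  proof -
    have "norm (G \<tau> ab + G' \<tau> ab) \<le> (C * (1 + norm \<tau>) ^ m + D * (1 + norm \<tau>) ^ k) * lat_major 3 ab"
      using norm_triangle_ineq[of "G \<tau> ab" "G' \<tau> ab"] C(2)[OF that, of ab] D(2)[OF that, of ab] by (simp add: distrib_right)
    also have "\<dots> \<le> (C + D) * (1 + norm \<tau>) ^ (m + k) * lat_major 3 ab"
      using growth_add[OF C(1) D(1), of "norm \<tau>" m k] by (intro mult_right_mono) auto
    finally show ?thesis .
  qed
  then show "\<exists>C m. 0 \<le> C \<and> (\<forall>\<tau> ab. \<tau> \<in> strip A B \<longrightarrow> norm (G \<tau> ab + G' \<tau> ab) \<le> C * (1 + norm \<tau>) ^ m * lat_major 3 ab)"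
    using C(1) D(1) by (intro exI[of _ "C + D"] exI[of _ "m + k"] conjI allI impI) simp_all
qed

lemma tame_cmult:
  assumes "tame G"
  shows "tame (\<lambda>\<tau> ab. c * G \<tau> ab)"
proof (rule tameI)
  show "(\<lambda>\<tau>. c * G \<tau> ab) holomorphic_on uhp" for ab
    using assms by (intro holomorphic_intros tame_hol)
  fix A B :: real assume AB: "A \<ge> 0" "B > 0"
  obtain C m where C: "C \<ge> 0" "\<And>\<tau> ab. \<tau> \<in> strip A B \<Longrightarrow> norm (G \<tau> ab) \<le> C * (1 + norm \<tau>) ^ m * lat_major 3 ab"
    using tame_bound[OF assms AB] by blast
  have "norm (c * G \<tau> ab) \<le> (norm c * C) * (1 + norm \<tau>) ^ m * lat_major 3 ab" if "\<tau> \<in> strip A B" for \<tau> ab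
    using mult_left_mono[OF C(2)[OF that, of ab], of "norm c"] by (simp add: norm_mult mult_ac)
  then show "\<exists>C m. 0 \<le> C \<and> (\<forall>\<tau> ab. \<tau> \<in> strip A B \<longrightarrow> norm (c * G \<tau> ab) \<le> C * (1 + norm \<tau>) ^ m * lat_major 3 ab)"
    using C(1) by (intro exI[of _ "norm c * C"] exI[of _ m] conjI allI impI) simp_all
qed

lemma vpt_holomorphic: "(\<lambda>\<tau>. vpt \<tau> v) holomorphic_on X"
  unfolding vpt_def by (intro holomorphic_intros)

lemma eis_term_holomorphic_in_tau: "(\<lambda>\<tau>. eis_term n 0 (vpt \<tau> v)) holomorphic_on uhp"
proof (cases "v = 0")
  case False
  have "(\<lambda>\<tau>. inverse (vpt \<tau> v ^ n)) holomorphic_on uhp"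
    using False by (intro holomorphic_intros vpt_holomorphic) (simp add: vpt_eq_0_iff)
  moreover have "eis_term n 0 (vpt \<tau> v) = inverse (vpt \<tau> v ^ n)" if "\<tau> \<in> uhp" for \<tau>
    using False that by (simp add: eis_term_at_0 vpt_eq_0_iff)
  ultimately show ?thesis by (simp cong: holomorphic_cong)
qed auto

lemma norm_vpt_le: "1 + norm (vpt \<tau> v) \<le> (1 + norm (of_rat (v $ 1) :: complex) + norm (of_rat (v $ 2) :: complex)) * (1 + norm \<tau>)"
proof -
  have "norm (vpt \<tau> v) \<le> norm (of_rat (v $ 1) :: complex) * norm \<tau> + norm (of_rat (v $ 2) :: complex)"
    unfolding vpt_def by (metis norm_mult norm_triangle_ineq)
  moreover have "0 \<le> norm (of_rat (v $ 2) :: complex) * norm \<tau>" by simp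
  moreover have "(1 + norm (of_rat (v $ 1) :: complex) + norm (of_rat (v $ 2) :: complex)) * (1 + norm \<tau>) =
     1 + norm \<tau> + norm (of_rat (v $ 1) :: complex) + norm (of_rat (v $ 1) :: complex) * norm \<tau> +
     norm (of_rat (v $ 2) :: complex) + norm (of_rat (v $ 2) :: complex) * norm \<tau>" by (simp add: algebra_simps)
  ultimately show ?thesis using norm_ge_zero[of \<tau>] norm_ge_zero[of "of_rat (v $ 1) :: complex"] by linarith
qed

lemma growth_vpt:
  fixes v :: "rat^2"
  assumes "x \<le> C * (1 + norm (vpt \<tau> v)) ^ m * L" "0 \<le> C" "0 \<le> L"
  shows "x \<le> (C * (1 + norm (of_rat (v $ 1) :: complex) + norm (of_rat (v $ 2) :: complex)) ^ m) * (1 + norm \<tau>) ^ m * L"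
proof -
  have "(1 + norm (vpt \<tau> v)) ^ m \<le> ((1 + norm (of_rat (v $ 1) :: complex) + norm (of_rat (v $ 2) :: complex)) * (1 + norm \<tau>)) ^ m"
    using norm_vpt_le by (intro power_mono) auto
  then have "C * (1 + norm (vpt \<tau> v)) ^ m * L \<le> C * ((1 + norm (of_rat (v $ 1) :: complex) + norm (of_rat (v $ 2) :: complex)) * (1 + norm \<tau>)) ^ m * L"
    using assms by (intro mult_right_mono mult_left_mono) auto
  then show ?thesis using assms(1) by (simp add: power_mult_distrib mult_ac)
qed

lemma tame_eis_term:
  assumes "n \<ge> 3"
  shows "tame (\<lambda>\<tau> ab. eis_term n 0 (vpt \<tau> (ivec ab + v)))"
proof (rule tameI[OF eis_term_holomorphic_in_tau])
  fix A B :: real assume AB: "A \<ge> 0" "B > 0"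
  obtain D where D: "D > 0" "of_nat D *s v \<in> Z2" using ex_denominator by blast
  obtain C m where C: "0 \<le> C" "\<And>\<tau> s p v ab. \<tau> \<in> strip A B \<Longrightarrow> norm s \<le> 0 \<Longrightarrow> 0 \<le> p \<Longrightarrow> p \<le> real n + Re s \<Longrightarrow>
     of_nat D *s v \<in> Z2 \<Longrightarrow>
     norm (eis_term n s (vpt \<tau> (ivec ab + v))) \<le> C * (1 + norm (vpt \<tau> v)) ^ m * lat_major p ab"
    using eis_term_lattice_bound[OF AB D(1) order_refl, of n] by blast
  have "norm (eis_term n 0 (vpt \<tau> (ivec ab + v))) \<le> C * (1 + norm (vpt \<tau> v)) ^ m * lat_major 3 ab" if "\<tau> \<in> strip A B" for \<tau> ab
    using assms by (intro C(2)[OF that _ _ _ D(2)]) auto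
  note growth_vpt[OF this C(1) lat_major_nonneg]
  then show "\<exists>C m. 0 \<le> C \<and> (\<forall>\<tau> ab. \<tau> \<in> strip A B \<longrightarrow> norm (eis_term n 0 (vpt \<tau> (ivec ab + v))) \<le> C * (1 + norm \<tau>) ^ m * lat_major 3 ab)"
    using C(1) by (intro exI[of _ "C * (1 + norm (of_rat (v $ 1) :: complex) + norm (of_rat (v $ 2) :: complex)) ^ m"] exI[of _ m] conjI allI impI) simp_all
qed

lemma tame_eis_rem:
  assumes "n \<ge> 1"
  shows "tame (\<lambda>\<tau> ab. eis_rem n 0 (vpt \<tau> (ivec ab)) (vpt \<tau> v))"
proof (rule tameI)
  fix ab
  have 1: "(\<lambda>\<tau>. vpt \<tau> v / vpt \<tau> (ivec ab)) holomorphic_on uhp"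
  proof (cases "ivec ab = 0")
    case False
    then show ?thesis by (intro holomorphic_intros vpt_holomorphic) (simp add: vpt_eq_0_iff)
  qed auto
  show "(\<lambda>\<tau>. eis_rem n 0 (vpt \<tau> (ivec ab)) (vpt \<tau> v)) holomorphic_on uhp"
    unfolding eis_rem_def vpt_add[symmetric] mult_zero_left
    by (intro holomorphic_intros eis_term_holomorphic_in_tau 1)
next
  fix A B :: real assume AB: "A \<ge> 0" "B > 0"
  obtain D where D: "D > 0" "of_nat D *s v \<in> Z2" using ex_denominator by blast
  obtain C m where C: "0 \<le> C" "\<And>\<tau> s p v ab. \<tau> \<in> strip A B \<Longrightarrow> norm s \<le> 0 \<Longrightarrow> 0 \<le> real n + Re s \<Longrightarrow>
     0 \<le> p \<Longrightarrow> p \<le> real n + Re s + 2 \<Longrightarrow> of_nat D *s v \<in> Z2 \<Longrightarrow>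
     norm (eis_rem n s (vpt \<tau> (ivec ab)) (vpt \<tau> v)) \<le> C * (1 + norm (vpt \<tau> v)) ^ m * lat_major p ab"
    using eis_rem_lattice_bound[OF AB D(1) order_refl, of n] by blast
  have "norm (eis_rem n 0 (vpt \<tau> (ivec ab)) (vpt \<tau> v)) \<le> C * (1 + norm (vpt \<tau> v)) ^ m * lat_major 3 ab" if "\<tau> \<in> strip A B" for \<tau> ab
    using assms by (intro C(2)[OF that _ _ _ _ D(2)]) auto
  note growth_vpt[OF this C(1) lat_major_nonneg]
  then show "\<exists>C m. 0 \<le> C \<and> (\<forall>\<tau> ab. \<tau> \<in> strip A B \<longrightarrow> norm (eis_rem n 0 (vpt \<tau> (ivec ab)) (vpt \<tau> v)) \<le> C * (1 + norm \<tau>) ^ m * lat_major 3 ab)"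
    using C(1) by (intro exI[of _ "C * (1 + norm (of_rat (v $ 1) :: complex) + norm (of_rat (v $ 2) :: complex)) ^ m"] exI[of _ m] conjI allI impI) simp_all
qed

lemma tame_eis_diff: "n \<ge> 1 \<Longrightarrow> tame (\<lambda>\<tau> ab. eis_diff n N v \<tau> 0 ab)"
  using tame_add[OF tame_eis_rem[of n v] tame_cmult[OF tame_eis_rem[of n "of_nat N *s v"], of "- 1 / of_nat N"]]
  by (simp add: eis_diff_def)

lemma tame_infsum_growth:
  assumes "tame G" "A \<ge> 0" "B > 0"
  shows "\<exists>C\<ge>0. \<exists>m. \<forall>\<tau>\<in>strip A B. norm (\<Sum>\<^sub>\<infinity>ab. G \<tau> ab) \<le> C * (1 + norm \<tau>) ^ m"
proof -
  obtain C m where C: "C \<ge> 0" "\<And>\<tau> ab. \<tau> \<in> strip A B \<Longrightarrow> norm (G \<tau> ab) \<le> C * (1 + norm \<tau>) ^ m * lat_major 3 ab"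
    using tame_bound[OF assms] by blast
  have L: "lat_major 3 summable_on UNIV" by (rule summable_on_lat_major) simp
  have "norm (\<Sum>\<^sub>\<infinity>ab. G \<tau> ab) \<le> C * (1 + norm \<tau>) ^ m * infsum (lat_major 3) UNIV" if "\<tau> \<in> strip A B" for \<tau>
  proof (rule norm_infsum_le)
    show h: "((\<lambda>ab. C * (1 + norm \<tau>) ^ m * lat_major 3 ab) has_sum (C * (1 + norm \<tau>) ^ m * infsum (lat_major 3) UNIV)) UNIV"
      by (intro has_sum_cmult_right has_sum_infsum L)
    show "(G \<tau> has_sum (\<Sum>\<^sub>\<infinity>ab. G \<tau> ab)) UNIV"
      by (intro has_sum_infsum summable_on_norm_le[OF has_sum_imp_summable[OF h]] C(2)[OF that])
  qed (rule C(2)[OF that])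
  then show ?thesis using C(1) infsum_nonneg[of UNIV "lat_major 3"]
    by (intro exI[of _ "C * infsum (lat_major 3) UNIV"] conjI exI[of _ m]) (auto simp: mult_ac)
qed

lemma open_uhp: "open uhp"
  unfolding uhp_def by (rule open_halfspace_Im_gt)

lemma tame_infsum_holomorphic:
  assumes "tame G"
  shows "(\<lambda>\<tau>. \<Sum>\<^sub>\<infinity>ab. G \<tau> ab) holomorphic_on uhp"
proof (rule infsum_holomorphic[OF open_uhp])
  show "(\<lambda>\<tau>. G \<tau> ab) holomorphic_on uhp" for ab using assms by (rule tame_hol)
  fix \<tau> assume "\<tau> \<in> uhp"
  then have B: "Im \<tau> / 2 > 0" by (simp add: uhp_def)
  \<comment> \<open>A ball of radius Im \<tau> / 2 around \<tau> stays in a single strip with lower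
    bound \<open>r\<close>, where one majorant is available.\<close>
  define r where "r = Im \<tau> / 2"
  obtain C m where C: "C \<ge> 0" "\<And>\<tau>' ab. \<tau>' \<in> strip (\<bar>Re \<tau>\<bar> + r) r \<Longrightarrow> norm (G \<tau>' ab) \<le> C * (1 + norm \<tau>') ^ m * lat_major 3 ab"
    using tame_bound[OF assms, of "\<bar>Re \<tau>\<bar> + r" r] B unfolding r_def[symmetric] by (auto simp del: split_paired_All)
  define M where "M = (\<lambda>ab. C * (1 + (norm \<tau> + r)) ^ m * lat_major 3 ab)"
  have "norm (G z ab) \<le> M ab" if "z \<in> ball \<tau> r" for z ab
  proof -
    have d: "norm (\<tau> - z) < r" using that by (simp add: dist_norm)
    have "\<bar>Re \<tau> - Re z\<bar> < r" "\<bar>Im \<tau> - Im z\<bar> < r"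
      using d abs_Re_le_cmod[of "\<tau> - z"] abs_Im_le_cmod[of "\<tau> - z"] by auto
    then have "z \<in> strip (\<bar>Re \<tau>\<bar> + r) r" unfolding strip_def r_def by (auto simp: abs_if split: if_splits)
    then have "norm (G z ab) \<le> C * (1 + norm z) ^ m * lat_major 3 ab" by (rule C(2))
    also have "\<dots> \<le> M ab" unfolding M_def
      using C(1) d norm_triangle_ineq2[of z \<tau>] norm_minus_commute[of z \<tau>]
      by (intro mult_right_mono mult_left_mono power_mono) auto
    finally show ?thesis .
  qed
  moreover have "M summable_on UNIV" unfolding M_def by (intro summable_on_cmult_right summable_on_lat_major) auto
  ultimately show "\<exists>r>0. \<exists>M. M summable_on UNIV \<and> (\<forall>y\<in>ball \<tau> r \<inter> uhp. \<forall>i\<in>UNIV. norm (G y i) \<le> M i)"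
    using B unfolding r_def[symmetric] by (intro exI[of _ r] exI[of _ M] conjI ballI) simp_all
qed

lemma phi_hol_holomorphic: "n \<ge> 1 \<Longrightarrow> phi_hol n N v holomorphic_on uhp"
proof -
  assume n: "n \<ge> 1"
  consider "n \<ge> 3" | "n = 2" | "n = 1" using n by linarith
  then show ?thesis
  proof cases
    case 1
    then have "phi_hol n N v = (\<lambda>\<tau>. \<Sum>\<^sub>\<infinity>ab. eis_term n 0 (vpt \<tau> (ivec ab + v)))" by (simp add: phi_hol_def fun_eq_iff)
    then show ?thesis using tame_infsum_holomorphic[OF tame_eis_term[OF 1]] by simp
  next
    case 2
    then have "phi_hol n N v = (\<lambda>\<tau>. (\<Sum>\<^sub>\<infinity>ab. eis_diff n N v \<tau> 0 ab) + (\<Sum>\<^sub>\<infinity>ab. eis_rem 1 0 (vpt \<tau> (ivec ab)) (vpt \<tau> (ivec (0, 1)))))"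
      by (simp add: phi_hol_def fun_eq_iff)
    then show ?thesis using tame_infsum_holomorphic[OF tame_eis_diff[OF n]] tame_infsum_holomorphic[OF tame_eis_rem[of 1]]
      by (simp add: holomorphic_on_add)
  next
    case 3
    then have "phi_hol n N v = (\<lambda>\<tau>. \<Sum>\<^sub>\<infinity>ab. eis_diff n N v \<tau> 0 ab)" by (simp add: phi_hol_def fun_eq_iff)
    then show ?thesis using tame_infsum_holomorphic[OF tame_eis_diff[OF n]] by simp
  qed
qed

lemma phi_hol_growth:
  assumes n: "n \<ge> 1" and AB: "A \<ge> 0" "B > 0"
  shows "\<exists>C\<ge>0. \<exists>m. \<forall>\<tau>\<in>strip A B. norm (phi_hol n N v \<tau>) \<le> C * (1 + norm \<tau>) ^ m"
proof -
  consider "n \<ge> 3" | "n = 2" | "n = 1" using n by linarith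
  then show ?thesis
  proof cases
    case 1
    then show ?thesis using tame_infsum_growth[OF tame_eis_term[OF 1] AB] by (simp add: phi_hol_def)
  next
    case 2
    obtain C m where C: "C \<ge> 0" "\<And>\<tau>. \<tau> \<in> strip A B \<Longrightarrow> norm (\<Sum>\<^sub>\<infinity>ab. eis_diff n N v \<tau> 0 ab) \<le> C * (1 + norm \<tau>) ^ m"
      using tame_infsum_growth[OF tame_eis_diff[OF n] AB] by blast
    obtain D k where D: "D \<ge> 0" "\<And>\<tau>. \<tau> \<in> strip A B \<Longrightarrow> norm (\<Sum>\<^sub>\<infinity>ab. eis_rem 1 0 (vpt \<tau> (ivec ab)) (vpt \<tau> (ivec (0, 1)))) \<le> D * (1 + norm \<tau>) ^ k"
      using tame_infsum_growth[OF tame_eis_rem[of 1] AB] by blast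
    have "norm (phi_hol n N v \<tau>) \<le> (C + D) * (1 + norm \<tau>) ^ (m + k)" if "\<tau> \<in> strip A B" for \<tau>
      using growth_add[OF C(1) D(1), of "norm \<tau>" m k] C(2)[OF that] D(2)[OF that] 2
        norm_triangle_ineq[of "\<Sum>\<^sub>\<infinity>ab. eis_diff n N v \<tau> 0 ab" "\<Sum>\<^sub>\<infinity>ab. eis_rem 1 0 (vpt \<tau> (ivec ab)) (vpt \<tau> (ivec (0, 1)))"]
      by (simp add: phi_hol_def)
    then show ?thesis using C D by (intro exI[of _ "C + D"]) auto
  next
    case 3
    then show ?thesis using tame_infsum_growth[OF tame_eis_diff[OF n] AB] by (simp add: phi_hol_def)
  qed
qed

lemma vpt_smult_inverse: "vpt \<tau> x = of_rat a * vpt \<tau> (inverse a *s x)" if "a \<noteq> 0"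
  using that by (simp add: vpt_smult of_rat_inverse)

text \<open>Division by the scaling factor a reduces to a coset of Z^2. The decomposition obtained
  is what near holomorphy and slow increase are deduced from: c does not depend on \<tau>, and h is
  holomorphic with polynomial growth on strips.\<close>

lemma basic_vec_phi:
  assumes V: "basic_vec V" and n: "n \<ge> 1"
  obtains h c where "h holomorphic_on uhp"
    and "\<And>\<tau>. \<tau> \<in> uhp \<Longrightarrow> has_phi n V \<tau> (h \<tau> + c / of_real (Im \<tau>))"
    and "\<And>A B. A \<ge> 0 \<Longrightarrow> B > 0 \<Longrightarrow> \<exists>C\<ge>0. \<exists>m. \<forall>\<tau>\<in>strip A B. norm (h \<tau>) \<le> C * (1 + norm \<tau>) ^ m"
proof -
  obtain v a where a: "a \<noteq> 0" and Va: "V = (\<lambda>z. v + a *s z) ` Z2" using V unfolding basic_vec_def by blast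
  define w where "w = inverse a *s v"
  have img: "(\<lambda>x. inverse a *s x) ` V = zcos w"
    unfolding Va zcos_def image_image w_def using a by (simp add: vector_add_ldistrib vector_smult_assoc)
  obtain N where N: "N > 0" "of_nat N *s w \<in> Z2" using ex_denominator by blast
  have inj: "inj_on (\<lambda>x. inverse a *s x) V"
    using a by (auto simp: inj_on_def vec2_eq_iff)
  let ?k = "of_rat a :: complex"
  have "has_phi n V \<tau> ((phi_hol n N w \<tau> + phi_const n / of_real (Im \<tau>)) / ?k ^ n)" if t: "\<tau> \<in> uhp" for \<tau>
  proof (rule has_phi_transfer[OF _ inj])
    show "has_phi n ((\<lambda>x. inverse a *s x) ` V) \<tau> (phi_hol n N w \<tau> + phi_const n / of_real (Im \<tau>))"
      unfolding img by (rule has_phi_zcos[OF t n N])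
    show "vpt \<tau> x = ?k * vpt \<tau> (inverse a *s x)" for x by (rule vpt_smult_inverse[OF a])
    show "?k \<noteq> 0" using a by simp
  qed
  then have 1: "has_phi n V \<tau> (phi_hol n N w \<tau> / ?k ^ n + phi_const n / ?k ^ n / of_real (Im \<tau>))" if t: "\<tau> \<in> uhp" for \<tau>
    using t by (simp add: add_divide_distrib mult.commute)
  have 2: "(\<lambda>\<tau>. phi_hol n N w \<tau> / ?k ^ n) holomorphic_on uhp"
    using a by (intro holomorphic_intros phi_hol_holomorphic n) auto
  have 3: "\<exists>C\<ge>0. \<exists>m. \<forall>\<tau>\<in>strip A B. norm (phi_hol n N w \<tau> / ?k ^ n) \<le> C * (1 + norm \<tau>) ^ m" if AB: "A \<ge> 0" "B > 0" for A B
  proof -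
    obtain C m where C: "C \<ge> 0" "\<And>\<tau>. \<tau> \<in> strip A B \<Longrightarrow> norm (phi_hol n N w \<tau>) \<le> C * (1 + norm \<tau>) ^ m"
      using phi_hol_growth[OF n AB] by blast
    then have "norm (phi_hol n N w \<tau> / ?k ^ n) \<le> (C / norm (?k ^ n)) * (1 + norm \<tau>) ^ m" if "\<tau> \<in> strip A B" for \<tau>
      using divide_right_mono[OF C(2)[OF that], of "norm (?k ^ n)"] by (simp add: norm_divide)
    then show ?thesis using C(1) by (intro exI[of _ "C / norm (?k ^ n)"]) auto
  qed
  show thesis by (rule that[OF 2 1 3])
qed


section \<open>Modular behaviour\<close>

text \<open>The row vector x times the matrix \<sigma>: the action on coordinates that corresponds
  to the Moebius action on \<tau>.\<close>

definition sl_vec :: "int^2^2 \<Rightarrow> rat^2 \<Rightarrow> rat^2" where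
  "sl_vec \<sigma> x = vector [of_int (\<sigma> $ 1 $ 1) * x $ 1 + of_int (\<sigma> $ 2 $ 1) * x $ 2,
     of_int (\<sigma> $ 1 $ 2) * x $ 1 + of_int (\<sigma> $ 2 $ 2) * x $ 2]"

definition aut :: "int^2^2 \<Rightarrow> complex \<Rightarrow> complex" where
  "aut \<sigma> \<tau> = of_int (\<sigma> $ 2 $ 1) * \<tau> + of_int (\<sigma> $ 2 $ 2)"

definition mob :: "int^2^2 \<Rightarrow> complex \<Rightarrow> complex" where
  "mob \<sigma> \<tau> = (of_int (\<sigma> $ 1 $ 1) * \<tau> + of_int (\<sigma> $ 1 $ 2)) / aut \<sigma> \<tau>"

lemma slash_eq: "slash k f \<sigma> \<tau> = f (mob \<sigma> \<tau>) / aut \<sigma> \<tau> ^ k"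
  by (simp add: slash_def mob_def aut_def)

lemma aut_nonzero:
  assumes "det \<sigma> = 1" "\<tau> \<in> uhp"
  shows "aut \<sigma> \<tau> \<noteq> 0"
proof
  assume a: "aut \<sigma> \<tau> = 0"
  have "Im (aut \<sigma> \<tau>) = of_int (\<sigma> $ 2 $ 1) * Im \<tau>" by (simp add: aut_def)
  then have c: "\<sigma> $ 2 $ 1 = 0" using a assms(2) by (simp add: uhp_def)
  then have "\<sigma> $ 2 $ 2 = 0" using a by (simp add: aut_def)
  then show False using c assms(1) by (simp add: det_2)
qed

lemma mob_in_uhp:
  assumes "det \<sigma> = 1" "\<tau> \<in> uhp"
  shows "mob \<sigma> \<tau> \<in> uhp"
proof -
  define a b c d where "a = real_of_int (\<sigma> $ 1 $ 1)" and "b = real_of_int (\<sigma> $ 1 $ 2)"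
    and "c = real_of_int (\<sigma> $ 2 $ 1)" and "d = real_of_int (\<sigma> $ 2 $ 2)"
  have "a * d - b * c = real_of_int (det \<sigma>)" by (simp add: a_def b_def c_def d_def det_2)
  then have det: "a * d - b * c = 1" using assms(1) by simp
  have nz: "(Re (aut \<sigma> \<tau>))\<^sup>2 + (Im (aut \<sigma> \<tau>))\<^sup>2 > 0"
    using aut_nonzero[OF assms] by (metis complex_neq_0)
  have "Im (mob \<sigma> \<tau>) = (a * Im \<tau> * (c * Re \<tau> + d) - (a * Re \<tau> + b) * (c * Im \<tau>)) / ((Re (aut \<sigma> \<tau>))\<^sup>2 + (Im (aut \<sigma> \<tau>))\<^sup>2)"
    by (simp add: mob_def Im_divide aut_def a_def b_def c_def d_def)
  also have "a * Im \<tau> * (c * Re \<tau> + d) - (a * Re \<tau> + b) * (c * Im \<tau>) = (a * d - b * c) * Im \<tau>"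
    by (simp add: algebra_simps)
  finally show ?thesis using nz assms(2) by (simp add: uhp_def det)
qed

lemma vpt_mob:
  assumes "det \<sigma> = 1" "\<tau> \<in> uhp"
  shows "vpt (mob \<sigma> \<tau>) x = inverse (aut \<sigma> \<tau>) * vpt \<tau> (sl_vec \<sigma> x)"
proof -
  have "aut \<sigma> \<tau> * vpt (mob \<sigma> \<tau>) x = vpt \<tau> (sl_vec \<sigma> x)"
  proof -
    have "aut \<sigma> \<tau> * mob \<sigma> \<tau> = of_int (\<sigma> $ 1 $ 1) * \<tau> + of_int (\<sigma> $ 1 $ 2)"
      using aut_nonzero[OF assms] by (simp add: mob_def)
    moreover have "aut \<sigma> \<tau> * vpt (mob \<sigma> \<tau>) x = of_rat (x $ 1) * (aut \<sigma> \<tau> * mob \<sigma> \<tau>) + of_rat (x $ 2) * aut \<sigma> \<tau>"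
      by (simp add: vpt_def algebra_simps)
    ultimately show ?thesis by (simp add: vpt_def sl_vec_def aut_def of_rat_add of_rat_mult algebra_simps)
  qed
  then show ?thesis using aut_nonzero[OF assms] by (simp add: field_simps)
qed

text \<open>The adjugate, an inverse with integer entries when the determinant is one.\<close>

definition adj2 :: "int^2^2 \<Rightarrow> int^2^2" where
  "adj2 A = vector [vector [A $ 2 $ 2, - (A $ 1 $ 2)], vector [- (A $ 2 $ 1), A $ 1 $ 1]]"

lemma adj2_nth [simp]: "adj2 A $ 1 $ 1 = A $ 2 $ 2" "adj2 A $ 1 $ 2 = - (A $ 1 $ 2)"
  "adj2 A $ 2 $ 1 = - (A $ 2 $ 1)" "adj2 A $ 2 $ 2 = A $ 1 $ 1"
  by (simp_all add: adj2_def)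

lemma det_adj2: "det (adj2 A) = det A"
  by (simp add: det_2 algebra_simps)

lemma adj2_adj2: "adj2 (adj2 A) = A"
  by (simp add: vec_eq_iff forall_2)

lemma sl_vec_adj2:
  assumes "det \<sigma> = 1"
  shows "sl_vec (adj2 \<sigma>) (sl_vec \<sigma> x) = x"
proof -
  have d: "rat_of_int (\<sigma> $ 1 $ 1) * rat_of_int (\<sigma> $ 2 $ 2) - rat_of_int (\<sigma> $ 1 $ 2) * rat_of_int (\<sigma> $ 2 $ 1) = 1"
    using assms by (simp add: det_2 flip: of_int_mult of_int_diff)
  have "sl_vec (adj2 \<sigma>) (sl_vec \<sigma> x) =
     (rat_of_int (\<sigma> $ 1 $ 1) * rat_of_int (\<sigma> $ 2 $ 2) - rat_of_int (\<sigma> $ 1 $ 2) * rat_of_int (\<sigma> $ 2 $ 1)) *s x"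
    by (simp add: vec2_eq_iff sl_vec_def algebra_simps)
  then show ?thesis unfolding d by simp
qed

lemma inj_sl_vec: "det \<sigma> = 1 \<Longrightarrow> inj_on (sl_vec \<sigma>) X"
  by (metis inj_on_inverseI sl_vec_adj2)

lemma sl_vec_add: "sl_vec \<sigma> (x + y) = sl_vec \<sigma> x + sl_vec \<sigma> y"
  by (simp add: vec2_eq_iff sl_vec_def algebra_simps)

lemma sl_vec_smult: "sl_vec \<sigma> (a *s x) = a *s sl_vec \<sigma> x"
  by (simp add: vec2_eq_iff sl_vec_def algebra_simps)

lemma sl_vec_Z2: "x \<in> Z2 \<Longrightarrow> sl_vec \<sigma> x \<in> Z2"
  by (simp add: Z2_def forall_2 sl_vec_def)

lemma sl_vec_image_Z2:
  assumes "det \<sigma> = 1"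
  shows "sl_vec \<sigma> ` Z2 = Z2"
proof (intro equalityI subsetI)
  fix x assume "x \<in> Z2"
  then have "sl_vec (adj2 \<sigma>) x \<in> Z2" by (rule sl_vec_Z2)
  moreover have "sl_vec \<sigma> (sl_vec (adj2 \<sigma>) x) = x"
    using sl_vec_adj2[of "adj2 \<sigma>" x] assms by (simp add: det_adj2 adj2_adj2)
  ultimately show "x \<in> sl_vec \<sigma> ` Z2" by (metis imageI)
qed (auto intro: sl_vec_Z2)

lemma sl_vec_image_coset:
  assumes "det \<sigma> = 1"
  shows "sl_vec \<sigma> ` ((\<lambda>z. v + a *s z) ` Z2) = (\<lambda>z. sl_vec \<sigma> v + a *s z) ` Z2"
proof -
  have "sl_vec \<sigma> ` ((\<lambda>z. v + a *s z) ` Z2) = (\<lambda>z. sl_vec \<sigma> v + a *s z) ` (sl_vec \<sigma> ` Z2)"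
    by (simp add: image_image sl_vec_add sl_vec_smult)
  then show ?thesis by (simp add: sl_vec_image_Z2[OF assms])
qed

lemma basic_vec_sl_vec: "basic_vec V \<Longrightarrow> det \<sigma> = 1 \<Longrightarrow> basic_vec (sl_vec \<sigma> ` V)"
  unfolding basic_vec_def using sl_vec_image_coset by blast

lemma Z2_uminus: "x \<in> Z2 \<Longrightarrow> - x \<in> Z2"
  by (simp add: Z2_def)

lemma coset_shift:
  assumes "a \<noteq> 0" "inverse a *s (w - v) \<in> Z2"
  shows "(\<lambda>z. w + a *s z) ` Z2 = (\<lambda>z. v + a *s z) ` Z2"
proof -
  have sub: "(\<lambda>z. w + a *s z) ` Z2 \<subseteq> (\<lambda>z. v + a *s z) ` Z2" if "inverse a *s (w - v) \<in> Z2" for v w :: "rat^2"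
  proof
    fix x assume "x \<in> (\<lambda>z. w + a *s z) ` Z2"
    then obtain z where z: "z \<in> Z2" "x = w + a *s z" by blast
    then have "x = v + a *s (inverse a *s (w - v) + z)"
      using assms(1) by (simp add: vec2_eq_iff field_simps)
    then show "x \<in> (\<lambda>z. v + a *s z) ` Z2" using z that Z2_add by blast
  qed
  have "inverse a *s (v - w) = - (inverse a *s (w - v))" by (simp add: vec2_eq_iff algebra_simps)
  then have "inverse a *s (v - w) \<in> Z2" using Z2_uminus[OF assms(2)] by (simp only:)
  then show ?thesis using sub assms(2) by blast
qed

lemma Gamma_principal_mono: "N dvd M \<Longrightarrow> Gamma_principal M \<subseteq> Gamma_principal N"
  unfolding Gamma_principal_def
  by (auto intro!: cong_dvd_modulus[of _ _ "int M" "int N"] simp del: of_nat_mod)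

text \<open>A matrix 1 + N \<mu> moves v by N v \<mu>, which lies in a Z^2 as soon as N v / a is
  integral; so any denominator N of v / a will do.\<close>

lemma basic_vec_Gamma_stable:
  assumes "basic_vec V"
  shows "\<exists>N>0. \<forall>\<sigma>\<in>Gamma_principal N. sl_vec \<sigma> ` V = V"
proof -
  obtain v a where a: "a \<noteq> 0" and V: "V = (\<lambda>z. v + a *s z) ` Z2" using assms unfolding basic_vec_def by blast
  obtain N where N: "N > 0" "of_nat N *s (inverse a *s v) \<in> Z2" using ex_denominator by blast
  have "sl_vec \<sigma> ` V = V" if s: "\<sigma> \<in> Gamma_principal N" for \<sigma>
  proof -
    have det: "det \<sigma> = 1" using s by (simp add: Gamma_principal_def)
    have "int N dvd (\<sigma> $ i $ j - mat 1 $ i $ j)" for i j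
      using s by (simp add: Gamma_principal_def cong_iff_dvd_diff)
    then obtain m where m: "\<And>i j. \<sigma> $ i $ j - mat 1 $ i $ j = int N * m i j" unfolding dvd_def by metis
    define \<mu> :: "int^2^2" where "\<mu> = (\<chi> i j. m i j)"
    have s_eq: "\<sigma> $ 1 $ 1 = 1 + int N * \<mu> $ 1 $ 1" "\<sigma> $ 1 $ 2 = int N * \<mu> $ 1 $ 2" "\<sigma> $ 2 $ 1 = int N * \<mu> $ 2 $ 1" "\<sigma> $ 2 $ 2 = 1 + int N * \<mu> $ 2 $ 2"
      using m[of 1 1] m[of 1 2] m[of 2 1] m[of 2 2] by (auto simp: \<mu>_def mat_def)
    have "inverse a *s (sl_vec \<sigma> v - v) = sl_vec \<mu> (of_nat N *s (inverse a *s v))"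
      by (simp add: vec2_eq_iff sl_vec_def s_eq algebra_simps)
    then have "inverse a *s (sl_vec \<sigma> v - v) \<in> Z2" using sl_vec_Z2[OF N(2)] by simp
    then show ?thesis unfolding V sl_vec_image_coset[OF det] by (rule coset_shift[OF a])
  qed
  then show ?thesis using N(1) by blast
qed

text \<open>The lattice points of the transformed \<tau> are those of the transformed set V at
  \<tau>, divided by the automorphy factor. Its power n is thus an instance of homogeneity.\<close>

lemma phi_mob:
  assumes V: "basic_vec V" and n: "n \<ge> 1" and t: "\<tau> \<in> uhp" and det: "det \<sigma> = 1"
  shows "phi n V 0 (mob \<sigma> \<tau>) = aut \<sigma> \<tau> ^ n * phi n (sl_vec \<sigma> ` V) 0 \<tau>"
proof -
  obtain c where c: "has_phi n (sl_vec \<sigma> ` V) \<tau> c"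
    using basic_vec_phi[OF basic_vec_sl_vec[OF V det] n] t by metis
  have "has_phi n V (mob \<sigma> \<tau>) (c / inverse (aut \<sigma> \<tau>) ^ n)"
    by (rule has_phi_transfer[OF c inj_sl_vec[OF det]]) (use aut_nonzero[OF det t] vpt_mob[OF det t] in auto)
  then show ?thesis
    using has_phi_imp_phi_eq[OF t c] has_phi_imp_phi_eq[OF mob_in_uhp[OF det t]]
    by (simp add: power_inverse divide_inverse mult.commute)
qed

section \<open>Growth at the cusps\<close>

definition poly_growth :: "(complex \<Rightarrow> complex) \<Rightarrow> bool" where
  "poly_growth g \<longleftrightarrow> (\<exists>A B C. B > 0 \<and> (\<forall>\<tau>. Im \<tau> > B \<longrightarrow> cmod (g \<tau>) \<le> A * Im \<tau> powr C))"

lemma slowly_increasing_iff: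
  "slowly_increasing k f \<longleftrightarrow> (\<forall>\<sigma>. det \<sigma> = 1 \<longrightarrow> poly_growth (slash k f \<sigma>))"
  by (auto simp: slowly_increasing_def poly_growth_def SL2Z_def)

lemma poly_growthE:
  assumes "poly_growth g"
  obtains A B C where "A \<ge> 0" "B \<ge> 1" "C \<ge> 0" "\<And>\<tau>. Im \<tau> > B \<Longrightarrow> cmod (g \<tau>) \<le> A * Im \<tau> powr C"
proof -
  obtain A B C where B: "B > 0" and le: "\<And>\<tau>. Im \<tau> > B \<Longrightarrow> cmod (g \<tau>) \<le> A * Im \<tau> powr C"
    using assms unfolding poly_growth_def by blast
  have "cmod (g \<tau>) \<le> \<bar>A\<bar> * Im \<tau> powr max C 0" if "Im \<tau> > max B 1" for \<tau>
  proof -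
    have "cmod (g \<tau>) \<le> A * Im \<tau> powr C" using le that by simp
    also have "\<dots> \<le> \<bar>A\<bar> * Im \<tau> powr max C 0"
      using that by (intro mult_mono powr_mono) auto
    finally show ?thesis .
  qed
  then show thesis by (intro that[of "\<bar>A\<bar>" "max B 1" "max C 0"]) auto
qed

lemma poly_growth_add:
  assumes "poly_growth f" "poly_growth g"
  shows "poly_growth (\<lambda>\<tau>. f \<tau> + g \<tau>)"
proof -
  obtain A B C where f: "A \<ge> 0" "B \<ge> 1" "C \<ge> 0" "\<And>\<tau>. Im \<tau> > B \<Longrightarrow> cmod (f \<tau>) \<le> A * Im \<tau> powr C"
    using poly_growthE[OF assms(1)] by blast
  obtain A' B' C' where g: "A' \<ge> 0" "B' \<ge> 1" "C' \<ge> 0" "\<And>\<tau>. Im \<tau> > B' \<Longrightarrow> cmod (g \<tau>) \<le> A' * Im \<tau> powr C'"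
    using poly_growthE[OF assms(2)] by blast
  have "cmod (f \<tau> + g \<tau>) \<le> (A + A') * Im \<tau> powr max C C'" if "Im \<tau> > max B B'" for \<tau>
  proof -
    have "cmod (f \<tau> + g \<tau>) \<le> A * Im \<tau> powr C + A' * Im \<tau> powr C'"
      using f(4)[of \<tau>] g(4)[of \<tau>] that norm_triangle_ineq[of "f \<tau>" "g \<tau>"] by simp
    also have "\<dots> \<le> A * Im \<tau> powr max C C' + A' * Im \<tau> powr max C C'"
      using that f g by (intro add_mono mult_left_mono powr_mono) auto
    finally show ?thesis by (simp add: distrib_right)
  qed
  then show ?thesis unfolding poly_growth_def using f g
    by (intro exI[of _ "A + A'"] exI[of _ "max B B'"] exI[of _ "max C C'"]) auto
qed

lemma poly_growth_mult:
  assumes "poly_growth f" "poly_growth g"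
  shows "poly_growth (\<lambda>\<tau>. f \<tau> * g \<tau>)"
proof -
  obtain A B C where f: "A \<ge> 0" "B \<ge> 1" "C \<ge> 0" "\<And>\<tau>. Im \<tau> > B \<Longrightarrow> cmod (f \<tau>) \<le> A * Im \<tau> powr C"
    using poly_growthE[OF assms(1)] by blast
  obtain A' B' C' where g: "A' \<ge> 0" "B' \<ge> 1" "C' \<ge> 0" "\<And>\<tau>. Im \<tau> > B' \<Longrightarrow> cmod (g \<tau>) \<le> A' * Im \<tau> powr C'"
    using poly_growthE[OF assms(2)] by blast
  have "cmod (f \<tau> * g \<tau>) \<le> (A * A') * Im \<tau> powr (C + C')" if "Im \<tau> > max B B'" for \<tau>
  proof -
    have "cmod (f \<tau> * g \<tau>) \<le> (A * Im \<tau> powr C) * (A' * Im \<tau> powr C')"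
      unfolding norm_mult using f g that by (intro mult_mono) auto
    then show ?thesis by (simp add: powr_add mult_ac)
  qed
  then show ?thesis unfolding poly_growth_def using f g
    by (intro exI[of _ "A * A'"] exI[of _ "max B B'"] exI[of _ "C + C'"]) auto
qed

lemma poly_growth_cong:
  assumes "\<And>\<tau>. \<tau> \<in> uhp \<Longrightarrow> f \<tau> = g \<tau>" "poly_growth f"
  shows "poly_growth g"
proof -
  obtain A B C where "B > 0" and le: "\<And>\<tau>. Im \<tau> > B \<Longrightarrow> cmod (f \<tau>) \<le> A * Im \<tau> powr C"
    using assms(2) unfolding poly_growth_def by blast
  then have "cmod (g \<tau>) \<le> A * Im \<tau> powr C" if "Im \<tau> > B" for \<tau>
    using le[OF that] assms(1)[of \<tau>] that by (simp add: uhp_def)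
  then show ?thesis unfolding poly_growth_def using \<open>B > 0\<close> by blast
qed

lemma poly_growth_const: "poly_growth (\<lambda>\<tau>. c)"
  unfolding poly_growth_def by (rule exI[of _ "norm c"], rule exI[of _ 1], rule exI[of _ 0]) auto

text \<open>The bounds hold on strips, whereas growth is asked for all Re \<tau>. Translation by a
  multiple of N belongs to a group preserving V, and brings Re \<tau> into the interval from 0 to N
  without changing Im \<tau> or the value.\<close>

lemma phi_poly_growth:
  assumes V: "basic_vec V" and n: "n \<ge> 1"
  shows "poly_growth (phi n V 0)"
proof -
  obtain h c where phi: "\<And>\<tau>. \<tau> \<in> uhp \<Longrightarrow> has_phi n V \<tau> (h \<tau> + c / of_real (Im \<tau>))"
    and gr: "\<And>A B. A \<ge> 0 \<Longrightarrow> B > 0 \<Longrightarrow> \<exists>C\<ge>0. \<exists>m. \<forall>\<tau>\<in>strip A B. norm (h \<tau>) \<le> C * (1 + norm \<tau>) ^ m"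
    using basic_vec_phi[OF V n] by metis
  obtain N where N: "N > 0" "\<And>\<sigma>. \<sigma> \<in> Gamma_principal N \<Longrightarrow> sl_vec \<sigma> ` V = V" using basic_vec_Gamma_stable[OF V] by blast
  obtain C m where C: "C \<ge> 0" "\<And>\<tau>. \<tau> \<in> strip (real N) 1 \<Longrightarrow> norm (h \<tau>) \<le> C * (1 + norm \<tau>) ^ m"
    using gr[of "real N" 1] by auto
  have main: "cmod (phi n V 0 \<tau>) \<le> (C * (2 + real N) ^ m + norm c) * Im \<tau> powr real m" if t: "\<tau> \<in> strip (real N) 1" for \<tau>
  proof -
    have I: "Im \<tau> \<ge> 1" "\<bar>Re \<tau>\<bar> \<le> N" using t by (auto simp: strip_def)
    have u: "\<tau> \<in> uhp" using I by (simp add: uhp_def)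
    have nt: "1 + norm \<tau> \<le> (2 + real N) * Im \<tau>"
    proof -
      have "norm \<tau> \<le> \<bar>Re \<tau>\<bar> + \<bar>Im \<tau>\<bar>" by (rule cmod_le)
      moreover have "real N * 1 \<le> real N * Im \<tau>" using I by (intro mult_left_mono) auto
      ultimately show ?thesis using I by (simp add: algebra_simps)
    qed
    have "norm (h \<tau>) \<le> C * (1 + norm \<tau>) ^ m" by (rule C(2)[OF t])
    also have "\<dots> \<le> C * ((2 + real N) * Im \<tau>) ^ m" using C(1) nt by (intro mult_left_mono power_mono) auto
    also have "\<dots> = C * (2 + real N) ^ m * Im \<tau> powr real m"
      using I by (simp add: power_mult_distrib powr_realpow)
    finally have 1: "norm (h \<tau>) \<le> C * (2 + real N) ^ m * Im \<tau> powr real m" .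
    have "norm (c / of_real (Im \<tau>)) \<le> norm c / 1"
      unfolding norm_divide norm_of_real using I by (intro divide_left_mono) auto
    also have "\<dots> \<le> norm c * Im \<tau> powr real m"
      using I ge_one_powr_ge_zero[of "Im \<tau>" "real m"] by (simp add: mult_left_le mult_le_cancel_left1)
    finally have 2: "norm (c / of_real (Im \<tau>)) \<le> norm c * Im \<tau> powr real m" .
    have "phi n V 0 \<tau> = h \<tau> + c / of_real (Im \<tau>)" by (rule has_phi_imp_phi_eq[OF u phi[OF u]])
    then show ?thesis using 1 2 norm_triangle_ineq[of "h \<tau>" "c / of_real (Im \<tau>)"] by (simp add: distrib_right)
  qed
  have "cmod (phi n V 0 \<tau>) \<le> (C * (2 + real N) ^ m + norm c) * Im \<tau> powr real m" if I: "Im \<tau> > 1" for \<tau>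
  proof -
    define k where "k = - \<lfloor>Re \<tau> / real N\<rfloor>"
    define \<sigma> :: "int^2^2" where "\<sigma> = vector [vector [1, int N * k], vector [0, 1]]"
    have det: "det \<sigma> = 1" by (simp add: \<sigma>_def det_2)
    have s: "\<sigma> \<in> Gamma_principal N"
      unfolding Gamma_principal_def using det by (simp add: forall_2 \<sigma>_def mat_def cong_iff_dvd_diff)
    have u: "\<tau> \<in> uhp" using I by (simp add: uhp_def)
    have mb: "aut \<sigma> \<tau> = 1" "mob \<sigma> \<tau> = \<tau> + of_int (int N * k)" by (simp_all add: aut_def mob_def \<sigma>_def)
    have eq: "phi n V 0 (mob \<sigma> \<tau>) = phi n V 0 \<tau>" using phi_mob[OF V n u det] N(2)[OF s] mb(1) by simp
    have "Re (mob \<sigma> \<tau>) = Re \<tau> - real N * \<lfloor>Re \<tau> / real N\<rfloor>" by (simp add: mb k_def)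
    moreover have "real N * \<lfloor>Re \<tau> / real N\<rfloor> \<le> Re \<tau>" "Re \<tau> \<le> real N * \<lfloor>Re \<tau> / real N\<rfloor> + real N"
    proof -
      have "real N * \<lfloor>Re \<tau> / real N\<rfloor> \<le> real N * (Re \<tau> / real N)"
        "real N * (Re \<tau> / real N) \<le> real N * (\<lfloor>Re \<tau> / real N\<rfloor> + 1)"
        by (intro mult_left_mono; linarith)+
      moreover have "real N * (Re \<tau> / real N) = Re \<tau>" using N(1) by simp
      ultimately show "real N * \<lfloor>Re \<tau> / real N\<rfloor> \<le> Re \<tau>" "Re \<tau> \<le> real N * \<lfloor>Re \<tau> / real N\<rfloor> + real N"
        by (simp_all add: distrib_left)
    qed
    ultimately have "mob \<sigma> \<tau> \<in> strip (real N) 1" using I by (auto simp: strip_def mb abs_le_iff)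
    from main[OF this] show ?thesis unfolding eq by (simp add: mb)
  qed
  then show ?thesis unfolding poly_growth_def by (intro exI[of _ "C * (2 + real N) ^ m + norm c"] exI[of _ 1] exI[of _ "real m"]) auto
qed

text \<open>Polynomials of degree at most d in Y = 1 / (\<tau> - cnj \<tau>) with coefficients
  holomorphic on \<open>uhp\<close>. The inductive form lets real derivatives be computed by rule
  induction.\<close>

inductive nhol :: "nat \<Rightarrow> (complex \<Rightarrow> complex) \<Rightarrow> bool" where
  nhol_hol: "f holomorphic_on uhp \<Longrightarrow> nhol d f"
| nhol_add: "nhol d f \<Longrightarrow> nhol d g \<Longrightarrow> nhol d (\<lambda>\<tau>. f \<tau> + g \<tau>)"
| nhol_Y: "nhol d f \<Longrightarrow> nhol (Suc d) (\<lambda>\<tau>. 1 / (\<tau> - cnj \<tau>) * f \<tau>)"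

lemma nhol_Suc: "nhol d f \<Longrightarrow> nhol (Suc d) f"
  by (induction rule: nhol.induct) (rule nhol.intros; assumption)+

lemma nhol_mono: "nhol d f \<Longrightarrow> d \<le> e \<Longrightarrow> nhol e f"
  by (induction e) (auto simp: le_Suc_eq intro: nhol_Suc)

lemma nhol_mult_hol: "nhol d g \<Longrightarrow> f holomorphic_on uhp \<Longrightarrow> nhol d (\<lambda>\<tau>. f \<tau> * g \<tau>)"
proof (induction rule: nhol.induct)
  case (nhol_hol g d)
  then show ?case by (intro nhol.nhol_hol holomorphic_on_mult)
next
  case (nhol_add d g g')
  then show ?case using nhol.nhol_add[of d "\<lambda>\<tau>. f \<tau> * g \<tau>" "\<lambda>\<tau>. f \<tau> * g' \<tau>"] by (simp add: distrib_left)
next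
  case (nhol_Y d g)
  then show ?case using nhol.nhol_Y[of d "\<lambda>\<tau>. f \<tau> * g \<tau>"] by (simp add: mult_ac)
qed

lemma nhol_mult: "nhol d f \<Longrightarrow> nhol e g \<Longrightarrow> nhol (d + e) (\<lambda>\<tau>. f \<tau> * g \<tau>)"
proof (induction rule: nhol.induct)
  case (nhol_hol f d)
  have "nhol (d + e) g" using nhol_hol(2) by (rule nhol_mono) simp
  then show ?case using nhol_hol(1) by (rule nhol_mult_hol)
next
  case (nhol_add d f f')
  then show ?case using nhol.nhol_add[of "d + e" "\<lambda>\<tau>. f \<tau> * g \<tau>" "\<lambda>\<tau>. f' \<tau> * g \<tau>"] by (simp add: distrib_right)
next
  case (nhol_Y d f)
  then show ?case using nhol.nhol_Y[of "d + e" "\<lambda>\<tau>. f \<tau> * g \<tau>"] by (simp add: mult_ac)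
qed

text \<open>The operator \<open>lowering\<close>, for a function given by its directional
  derivatives \<open>f' v\<close>; this keeps \<open>frechet_derivative\<close> out of the
  induction.\<close>

definition dbar :: "(complex \<Rightarrow> complex \<Rightarrow> complex) \<Rightarrow> complex \<Rightarrow> complex" where
  "dbar f' \<tau> = (\<tau> - cnj \<tau>)\<^sup>2 * ((f' 1 \<tau> + \<i> * f' \<i> \<tau>) / 2)"

lemma uhp_diff_cnj: "\<tau> \<in> uhp \<Longrightarrow> \<tau> - cnj \<tau> \<noteq> 0"
  by (simp add: uhp_def complex_eq_iff)

text \<open>Differentiation raises the degree in Y by at most one and lowering reduces it by one. As
  \<open>d - 1\<close> stops at 0, the vanishing in degree 0 is a clause of its own.\<close>

definition nhol_der :: "nat \<Rightarrow> (complex \<Rightarrow> complex) \<Rightarrow> (complex \<Rightarrow> complex \<Rightarrow> complex) \<Rightarrow> (complex \<Rightarrow> complex) \<Rightarrow> bool" where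
  "nhol_der d f f' g \<longleftrightarrow> (\<forall>v. nhol (Suc d) (f' v)) \<and> (\<forall>\<tau>\<in>uhp. (f has_derivative (\<lambda>v. f' v \<tau>)) (at \<tau>)) \<and>
     nhol (d - 1) g \<and> (\<forall>\<tau>\<in>uhp. dbar f' \<tau> = g \<tau>) \<and> (d = 0 \<longrightarrow> (\<forall>\<tau>\<in>uhp. g \<tau> = 0))"

lemma nhol_derD:
  assumes "nhol_der d f f' g"
  shows "nhol (Suc d) (f' v)" "\<tau> \<in> uhp \<Longrightarrow> (f has_derivative (\<lambda>v. f' v \<tau>)) (at \<tau>)"
    "nhol (d - 1) g" "\<tau> \<in> uhp \<Longrightarrow> dbar f' \<tau> = g \<tau>" "d = 0 \<Longrightarrow> \<tau> \<in> uhp \<Longrightarrow> g \<tau> = 0"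
  using assms by (auto simp: nhol_der_def)

text \<open>The square of \<tau> - cnj \<tau> times the antiholomorphic derivative of Y is 1. Hence
  lowering is the derivation d/dY on these polynomials, and Y f goes to f + Y times the lowering of
  f.\<close>

lemma nhol_derivative: "nhol d f \<Longrightarrow> \<exists>f' g. nhol_der d f f' g"
proof (induction rule: nhol.induct)
  case (nhol_hol f d)
  have dh: "deriv f holomorphic_on uhp" using nhol_hol open_uhp by (rule holomorphic_deriv)
  show ?case unfolding nhol_der_def
  proof (intro exI[of _ "\<lambda>v \<tau>. deriv f \<tau> * v"] exI[of _ "\<lambda>_. 0"] conjI allI ballI impI)
    show "nhol (Suc d) (\<lambda>\<tau>. deriv f \<tau> * v)" for v by (intro nhol.nhol_hol holomorphic_intros dh)
    show "(f has_derivative (\<lambda>v. deriv f \<tau> * v)) (at \<tau>)" if "\<tau> \<in> uhp" for \<tau>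
      using holomorphic_derivI[OF nhol_hol open_uhp that] by (simp add: has_field_derivative_def)
    show "dbar (\<lambda>v \<tau>. deriv f \<tau> * v) \<tau> = 0" for \<tau>
    proof -
      have "deriv f \<tau> * 1 + \<i> * (deriv f \<tau> * \<i>) = deriv f \<tau> * (1 + \<i> * \<i>)" by (simp only: distrib_left mult_ac)
      then show ?thesis by (simp add: dbar_def)
    qed
    show "nhol (d - 1) (\<lambda>_. 0)" by (intro nhol.nhol_hol) auto
  qed auto
next
  case (nhol_add d f1 f2)
  then obtain f1' g1 f2' g2 where d1: "nhol_der d f1 f1' g1" and d2: "nhol_der d f2 f2' g2" by blast
  note 1 = nhol_derD[OF d1] and 2 = nhol_derD[OF d2]
  show ?case unfolding nhol_der_def
  proof (intro exI[of _ "\<lambda>v \<tau>. f1' v \<tau> + f2' v \<tau>"] exI[of _ "\<lambda>\<tau>. g1 \<tau> + g2 \<tau>"] conjI allI ballI impI)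
    show "((\<lambda>\<tau>. f1 \<tau> + f2 \<tau>) has_derivative (\<lambda>v. f1' v \<tau> + f2' v \<tau>)) (at \<tau>)" if "\<tau> \<in> uhp" for \<tau>
      using 1(2)[OF that] 2(2)[OF that] by (rule has_derivative_add)
    show "dbar (\<lambda>v \<tau>. f1' v \<tau> + f2' v \<tau>) \<tau> = g1 \<tau> + g2 \<tau>" if "\<tau> \<in> uhp" for \<tau>
      unfolding 1(4)[OF that, symmetric] 2(4)[OF that, symmetric] by (simp add: dbar_def add_divide_distrib algebra_simps)
  qed (use 1 2 in \<open>auto intro: nhol.nhol_add\<close>)
next
  case (nhol_Y d f)
  then obtain f' g where d1: "nhol_der d f f' g" by blast
  note 1 = nhol_derD[OF d1]
  \<comment> \<open>The product rule, with - (v - cnj v) Y^2 as the derivative of Y in direction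
    v.\<close>
  define F where "F = (\<lambda>v \<tau>. (- (v - cnj v)) * (1 / (\<tau> - cnj \<tau>) * (1 / (\<tau> - cnj \<tau>) * f \<tau>)) + 1 / (\<tau> - cnj \<tau>) * f' v \<tau>)"
  define G where "G = (\<lambda>\<tau>. f \<tau> + 1 / (\<tau> - cnj \<tau>) * g \<tau>)"
  show ?case unfolding nhol_der_def
  \<comment> \<open>In degree 0 the functions \<open>G\<close> and f agree on \<open>uhp\<close>,
    but the form of \<open>G\<close> only shows degree 1; choosing f keeps degree 0.\<close>
  proof (intro exI[of _ F] exI[of _ "if d = 0 then f else G"] conjI allI ballI impI)
    show "nhol (Suc (Suc d)) (F v)" for v
      unfolding F_def by (intro nhol.nhol_add nhol_mult_hol nhol.nhol_Y 1 nhol_Y) auto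
    show "((\<lambda>\<tau>. 1 / (\<tau> - cnj \<tau>) * f \<tau>) has_derivative (\<lambda>v. F v \<tau>)) (at \<tau>)" if t: "\<tau> \<in> uhp" for \<tau>
    proof -
      define Y where "Y = 1 / (\<tau> - cnj \<tau>)"
      have "((\<lambda>\<tau>. 1 / (\<tau> - cnj \<tau>) * f \<tau>) has_derivative
         (\<lambda>v. 1 / (\<tau> - cnj \<tau>) * f' v \<tau> + (- (1 / (\<tau> - cnj \<tau>)) * (v - cnj v) * (1 / (\<tau> - cnj \<tau>))) * f \<tau>)) (at \<tau>)"
        using uhp_diff_cnj[OF t] 1(2)[OF t]
        by (auto intro!: derivative_eq_intros simp: divide_inverse)
      then show ?thesis unfolding F_def Y_def[symmetric]
        by (rule has_derivative_eq_rhs) (simp add: fun_eq_iff algebra_simps)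
    qed
    have db: "dbar F \<tau> = G \<tau>" if t: "\<tau> \<in> uhp" for \<tau>
    proof -
      define Y where "Y = 1 / (\<tau> - cnj \<tau>)"
      have Y: "(\<tau> - cnj \<tau>) * Y = 1" using uhp_diff_cnj[OF t] by (simp add: Y_def)
      have "dbar F \<tau> = ((\<tau> - cnj \<tau>) * Y)\<^sup>2 * f \<tau> + Y * dbar f' \<tau>"
        unfolding dbar_def F_def Y_def[symmetric] by (simp add: power2_eq_square algebra_simps add_divide_distrib)
      then show ?thesis unfolding Y G_def Y_def[symmetric] 1(4)[OF t] by simp
    qed
    show "dbar F \<tau> = (if d = 0 then f else G) \<tau>" if t: "\<tau> \<in> uhp" for \<tau>
      using db[OF t] 1(5)[OF _ t] by (simp add: G_def)
    show "nhol (Suc d - 1) (if d = 0 then f else G)"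
    proof (cases d)
      case 0
      then show ?thesis using nhol_Y by simp
    next
      case (Suc d')
      have "nhol (Suc d') (\<lambda>\<tau>. 1 / (\<tau> - cnj \<tau>) * g \<tau>)" using 1(3) Suc by (intro nhol.nhol_Y) simp
      then show ?thesis using nhol_Y Suc unfolding G_def by (simp add: nhol.nhol_add)
    qed
  qed auto
qed

text \<open>Forms are represented by functions that are 0 off \<open>uhp\<close>, while the
  polynomials in Y may have other values there; so they are compared on \<open>uhp\<close>
  alone.\<close>

definition nhol_uhp :: "nat \<Rightarrow> (complex \<Rightarrow> complex) \<Rightarrow> bool" where
  "nhol_uhp d f \<longleftrightarrow> (\<exists>g. nhol d g \<and> (\<forall>\<tau>\<in>uhp. f \<tau> = g \<tau>))"

lemma nhol_uhp_derivative:
  assumes "nhol_uhp d f"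
  obtains f' where "\<And>\<tau>. \<tau> \<in> uhp \<Longrightarrow> (f has_derivative f' \<tau>) (at \<tau>)"
    "\<And>v. nhol_uhp (Suc d) (\<lambda>\<tau>. f' \<tau> v)" "nhol_uhp (d - 1) (lowering f)"
    "\<And>\<tau>. d = 0 \<Longrightarrow> \<tau> \<in> uhp \<Longrightarrow> lowering f \<tau> = 0"
proof -
  obtain h where h: "nhol d h" "\<And>\<tau>. \<tau> \<in> uhp \<Longrightarrow> f \<tau> = h \<tau>" using assms unfolding nhol_uhp_def by blast
  obtain h' g where "nhol_der d h h' g" using nhol_derivative[OF h(1)] by blast
  note h' = nhol_derD[OF this]
  have der: "(f has_derivative (\<lambda>v. h' v \<tau>)) (at \<tau>)" if "\<tau> \<in> uhp" for \<tau>
    using has_derivative_transform_within_open[OF h'(2)[OF that] open_uhp that] h(2) by simp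
  have low: "lowering f \<tau> = g \<tau>" if t: "\<tau> \<in> uhp" for \<tau>
    using h'(4)[OF t] frechet_derivative_at[OF der[OF t], symmetric]
    by (simp add: lowering_def d_taubar_def dbar_def)
  show thesis
    by (rule that[of "\<lambda>\<tau> v. h' v \<tau>"]) (use der h' low in \<open>auto simp: nhol_uhp_def\<close>)
qed

lemma nhol_uhp_cong: "nhol_uhp d f \<Longrightarrow> (\<And>\<tau>. \<tau> \<in> uhp \<Longrightarrow> f \<tau> = g \<tau>) \<Longrightarrow> nhol_uhp d g"
  unfolding nhol_uhp_def by metis

lemma nhol_uhp_smooth:
  assumes "nhol_uhp d f"
  shows "smooth_uhp f"
proof -
  have "C_diff_on n uhp f" if "nhol_uhp d f" for n d f
    using that
  proof (induction n arbitrary: d f)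
    case 0
    obtain f' where "\<And>\<tau>. \<tau> \<in> uhp \<Longrightarrow> (f has_derivative f' \<tau>) (at \<tau>)" using nhol_uhp_derivative[OF 0] by metis
    then show ?case by (auto intro!: continuous_at_imp_continuous_on has_derivative_continuous)
  next
    case (Suc n)
    obtain f' where f': "\<And>\<tau>. \<tau> \<in> uhp \<Longrightarrow> (f has_derivative f' \<tau>) (at \<tau>)" "\<And>v. nhol_uhp (Suc d) (\<lambda>\<tau>. f' \<tau> v)"
      using nhol_uhp_derivative[OF Suc.prems] by metis
    have "C_diff_on n uhp (\<lambda>x. frechet_derivative f (at x) v)" for v
    proof (rule Suc.IH[of "Suc d"])
      show "nhol_uhp (Suc d) (\<lambda>x. frechet_derivative f (at x) v)"
        by (rule nhol_uhp_cong[OF f'(2)[of v]]) (use frechet_derivative_at[OF f'(1)] in simp)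
    qed
    then show ?case using f'(1) by (auto simp: differentiable_def)
  qed
  then show ?thesis using assms unfolding smooth_uhp_def by blast
qed

lemma lowering_nilpotent: "nhol_uhp d f \<Longrightarrow> \<forall>\<tau>\<in>uhp. (lowering ^^ Suc d) f \<tau> = 0"
proof (induction d arbitrary: f)
  case 0
  show ?case using nhol_uhp_derivative[OF 0] by auto
next
  case (Suc d)
  have "nhol_uhp d (lowering f)" using nhol_uhp_derivative[OF Suc.prems] by auto
  from Suc.IH[OF this] show ?case by (simp add: funpow_swap1)
qed


section \<open>Nearly holomorphic forms and the coefficient group\<close>

lemma slowly_increasing_add:
  assumes "slowly_increasing k f" "slowly_increasing k g"
  shows "slowly_increasing k (\<lambda>\<tau>. f \<tau> + g \<tau>)"
proof -
  have "slash k (\<lambda>\<tau>. f \<tau> + g \<tau>) \<sigma> = (\<lambda>\<tau>. slash k f \<sigma> \<tau> + slash k g \<sigma> \<tau>)" for \<sigma>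
    by (simp add: slash_eq fun_eq_iff add_divide_distrib)
  then show ?thesis using assms unfolding slowly_increasing_iff by (simp add: poly_growth_add)
qed

lemma slowly_increasing_mult:
  assumes "slowly_increasing k f" "slowly_increasing l g"
  shows "slowly_increasing (k + l) (\<lambda>\<tau>. f \<tau> * g \<tau>)"
proof -
  have "slash (k + l) (\<lambda>\<tau>. f \<tau> * g \<tau>) \<sigma> = (\<lambda>\<tau>. slash k f \<sigma> \<tau> * slash l g \<sigma> \<tau>)" for \<sigma>
    by (simp add: slash_eq fun_eq_iff power_add)
  then show ?thesis using assms unfolding slowly_increasing_iff by (simp add: poly_growth_mult)
qed

text \<open>Smoothness and nilpotency under \<open>lowering\<close> are replaced by membership in
  the polynomial ring over Y, where closure under products is immediate.\<close>

definition nform :: "nat \<Rightarrow> nat \<Rightarrow> (complex \<Rightarrow> complex) \<Rightarrow> bool" where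
  "nform k N f \<longleftrightarrow> (\<forall>\<tau>. \<tau> \<notin> uhp \<longrightarrow> f \<tau> = 0) \<and> (\<exists>d. nhol_uhp d f) \<and> slowly_increasing k f \<and>
     slash_invariant k (Gamma_principal N) f"

lemma nform_nearly_hol: "nform k N f \<Longrightarrow> f \<in> nearly_hol_forms k (Gamma_principal N)"
  unfolding nform_def nearly_hol_forms_def using nhol_uhp_smooth lowering_nilpotent by blast

lemma nform_mono: "nform k N f \<Longrightarrow> N dvd M \<Longrightarrow> nform k M f"
  unfolding nform_def slash_invariant_def using Gamma_principal_mono by blast

lemma nhol_uhp_add:
  assumes "nhol_uhp d f" "nhol_uhp e g"
  shows "nhol_uhp (d + e) (\<lambda>\<tau>. f \<tau> + g \<tau>)"
proof -
  obtain f' g' where f': "nhol d f'" "\<forall>\<tau>\<in>uhp. f \<tau> = f' \<tau>" and g': "nhol e g'" "\<forall>\<tau>\<in>uhp. g \<tau> = g' \<tau>"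
    using assms unfolding nhol_uhp_def by blast
  have "nhol (d + e) (\<lambda>\<tau>. f' \<tau> + g' \<tau>)"
    using nhol_add[OF nhol_mono[OF f'(1)] nhol_mono[OF g'(1)], of "d + e"] by simp
  then show ?thesis unfolding nhol_uhp_def using f' g' by (intro exI[of _ "\<lambda>\<tau>. f' \<tau> + g' \<tau>"]) simp
qed

lemma nhol_uhp_mult:
  assumes "nhol_uhp d f" "nhol_uhp e g"
  shows "nhol_uhp (d + e) (\<lambda>\<tau>. f \<tau> * g \<tau>)"
proof -
  obtain f' g' where f': "nhol d f'" "\<forall>\<tau>\<in>uhp. f \<tau> = f' \<tau>" and g': "nhol e g'" "\<forall>\<tau>\<in>uhp. g \<tau> = g' \<tau>"
    using assms unfolding nhol_uhp_def by blast
  show ?thesis unfolding nhol_uhp_def using nhol_mult[OF f'(1) g'(1)] f' g'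
    by (intro exI[of _ "\<lambda>\<tau>. f' \<tau> * g' \<tau>"]) simp
qed

lemma nform_add:
  assumes "nform k N f" "nform k N g"
  shows "nform k N (\<lambda>\<tau>. f \<tau> + g \<tau>)"
proof -
  have "slash k (\<lambda>\<tau>. f \<tau> + g \<tau>) \<sigma> \<tau> = slash k f \<sigma> \<tau> + slash k g \<sigma> \<tau>" for \<sigma> \<tau>
    by (simp add: slash_eq add_divide_distrib)
  moreover have "\<exists>d. nhol_uhp d (\<lambda>\<tau>. f \<tau> + g \<tau>)"
    using assms nhol_uhp_add unfolding nform_def by blast
  ultimately show ?thesis
    using assms slowly_increasing_add unfolding nform_def slash_invariant_def by simp
qed

lemma nform_mult:
  assumes "nform k N f" "nform l N g"
  shows "nform (k + l) N (\<lambda>\<tau>. f \<tau> * g \<tau>)"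
proof -
  have "slash (k + l) (\<lambda>\<tau>. f \<tau> * g \<tau>) \<sigma> \<tau> = slash k f \<sigma> \<tau> * slash l g \<sigma> \<tau>" for \<sigma> \<tau>
    by (simp add: slash_eq power_add)
  moreover have "\<exists>d. nhol_uhp d (\<lambda>\<tau>. f \<tau> * g \<tau>)"
    using assms nhol_uhp_mult unfolding nform_def by blast
  ultimately show ?thesis
    using assms slowly_increasing_mult unfolding nform_def slash_invariant_def by simp
qed

lemma nform_zero: "nform k N (\<lambda>_. 0)"
proof -
  have "nhol_uhp 0 (\<lambda>_. 0)" unfolding nhol_uhp_def by (intro exI[of _ "\<lambda>_. 0"]) (auto intro: nhol_hol)
  moreover have "slash k (\<lambda>_. 0) \<sigma> = (\<lambda>_. 0)" for \<sigma> by (simp add: slash_eq fun_eq_iff)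
  ultimately show ?thesis unfolding nform_def slash_invariant_def slowly_increasing_iff
    using poly_growth_const[of 0] by auto
qed

lemma nform_cmult:
  assumes "nform k N f"
  shows "nform k N (\<lambda>\<tau>. c * f \<tau>)"
proof -
  obtain d where d: "nhol_uhp d f" using assms unfolding nform_def by blast
  have "nhol_uhp 0 (\<lambda>_. c)" unfolding nhol_uhp_def by (intro exI[of _ "\<lambda>_. c"]) (auto intro: nhol_hol)
  from nhol_uhp_mult[OF this d] have 1: "nhol_uhp (0 + d) (\<lambda>\<tau>. c * f \<tau>)" .
  have s: "slash k (\<lambda>\<tau>. c * f \<tau>) \<sigma> = (\<lambda>\<tau>. c * slash k f \<sigma> \<tau>)" for \<sigma>
    by (simp add: slash_eq fun_eq_iff)
  have 2: "slowly_increasing k (\<lambda>\<tau>. c * f \<tau>)"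
    using assms poly_growth_mult[OF poly_growth_const[of c]] unfolding slowly_increasing_iff s nform_def by blast
  show ?thesis using assms 1 2 unfolding nform_def slash_invariant_def s by auto
qed

text \<open>Slashing by \<sigma> turns the series of V into the series of its image under
  \<open>sl_vec\<close>, again a basic set, so growth at each cusp reduces to growth at
  infinity.\<close>

lemma nform_phi:
  assumes V: "basic_vec V" and n: "n \<ge> 1" and N: "\<forall>\<sigma>\<in>Gamma_principal N. sl_vec \<sigma> ` V = V"
  shows "nform n N (on_uhp (phi n V 0))"
proof -
  obtain h c where h: "h holomorphic_on uhp" and phi: "\<And>\<tau>. \<tau> \<in> uhp \<Longrightarrow> has_phi n V \<tau> (h \<tau> + c / of_real (Im \<tau>))"
    using basic_vec_phi[OF V n] by metis
  have sl: "slash n (on_uhp (phi n V 0)) \<sigma> \<tau> = phi n (sl_vec \<sigma> ` V) 0 \<tau>" if d: "det \<sigma> = 1" and t: "\<tau> \<in> uhp" for \<sigma> \<tau>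
    using phi_mob[OF V n t d] mob_in_uhp[OF d t] aut_nonzero[OF d t] by (simp add: slash_eq on_uhp_def)
  \<comment> \<open>The factor 2 i converts 1 / Im \<tau> into 1 / (\<tau> - cnj \<tau>), since
    \<tau> - cnj \<tau> = 2 i Im \<tau>.\<close>
  have "nhol 1 (\<lambda>\<tau>. h \<tau> + 1 / (\<tau> - cnj \<tau>) * (2 * \<i> * c))"
    unfolding One_nat_def by (intro nhol_add nhol_hol h nhol_Y) auto
  moreover have "on_uhp (phi n V 0) \<tau> = h \<tau> + 1 / (\<tau> - cnj \<tau>) * (2 * \<i> * c)" if t: "\<tau> \<in> uhp" for \<tau>
  proof -
    have "\<tau> - cnj \<tau> = 2 * \<i> * of_real (Im \<tau>)" by (simp add: complex_eq_iff)
    then show ?thesis using has_phi_imp_phi_eq[OF t phi[OF t]] t by (simp add: on_uhp_def)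
  qed
  ultimately have 1: "nhol_uhp 1 (on_uhp (phi n V 0))" unfolding nhol_uhp_def by blast
  have 2: "slowly_increasing n (on_uhp (phi n V 0))"
    unfolding slowly_increasing_iff
  proof (intro allI impI)
    fix \<sigma> :: "int^2^2" assume d: "det \<sigma> = 1"
    show "poly_growth (slash n (on_uhp (phi n V 0)) \<sigma>)"
      by (rule poly_growth_cong[OF _ phi_poly_growth[OF basic_vec_sl_vec[OF V d] n]]) (simp add: sl[OF d])
  qed
  have 3: "slash_invariant n (Gamma_principal N) (on_uhp (phi n V 0))"
    unfolding slash_invariant_def
  proof (intro ballI)
    fix \<sigma> \<tau> assume s: "\<sigma> \<in> Gamma_principal N" and t: "\<tau> \<in> uhp"
    have d: "det \<sigma> = 1" using s by (simp add: Gamma_principal_def)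
    show "slash n (on_uhp (phi n V 0)) \<sigma> \<tau> = on_uhp (phi n V 0) \<tau>"
      using sl[OF d t] N s t by (simp add: on_uhp_def)
  qed
  show ?thesis unfolding nform_def using 1 2 3 by (auto simp: on_uhp_def)
qed

lemma E_ser_nth: "fps_nth (E_ser V \<tau>) i = (- 1) ^ i * phi (i + 1) V 0 \<tau>"
  by (simp add: E_ser_def)

text \<open>The level is determined by the stabilizers of V and W and is therefore the same for all
  i and j, as membership in \<open>M2_tilde\<close> demands.\<close>

lemma ex_nform_E_ser_mult:
  assumes "basic_vec V" "basic_vec W"
  shows "\<exists>N>0. \<forall>i j. nform (i + j + 2) N (on_uhp (\<lambda>\<tau>. fps_nth (E_ser V \<tau>) i * fps_nth (E_ser W \<tau>) j))"
proof -
  obtain N where N: "N > 0" "\<forall>\<sigma>\<in>Gamma_principal N. sl_vec \<sigma> ` V = V" using basic_vec_Gamma_stable[OF assms(1)] by blast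
  obtain M where M: "M > 0" "\<forall>\<sigma>\<in>Gamma_principal M. sl_vec \<sigma> ` W = W" using basic_vec_Gamma_stable[OF assms(2)] by blast
  have "nform (i + j + 2) (N * M) (on_uhp (\<lambda>\<tau>. fps_nth (E_ser V \<tau>) i * fps_nth (E_ser W \<tau>) j))" for i j
  proof -
    have "nform (i + 1) (N * M) (on_uhp (phi (i + 1) V 0))"
      using nform_mono[OF nform_phi[OF assms(1) _ N(2)], of "i + 1" "N * M"] by simp
    moreover have "nform (j + 1) (N * M) (on_uhp (phi (j + 1) W 0))"
      using nform_mono[OF nform_phi[OF assms(2) _ M(2)], of "j + 1" "N * M"] by simp
    ultimately have "nform ((i + 1) + (j + 1)) (N * M)
        (\<lambda>\<tau>. ((- 1) ^ i * (- 1) ^ j) * (on_uhp (phi (i + 1) V 0) \<tau> * on_uhp (phi (j + 1) W 0) \<tau>))"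
      by (intro nform_cmult nform_mult)
    moreover have "(\<lambda>\<tau>. ((- 1) ^ i * (- 1) ^ j) * (on_uhp (phi (i + 1) V 0) \<tau> * on_uhp (phi (j + 1) W 0) \<tau>)) =
        on_uhp (\<lambda>\<tau>. fps_nth (E_ser V \<tau>) i * fps_nth (E_ser W \<tau>) j)"
      by (simp add: on_uhp_def E_ser_nth fun_eq_iff)
    ultimately show ?thesis by simp
  qed
  then show ?thesis using N(1) M(1) by (intro exI[of _ "N * M"]) simp
qed

section \<open>Congruence subgroups\<close>

lemma adj2_mult: "det A = 1 \<Longrightarrow> adj2 A ** A = mat 1"
  by (simp add: vec_eq_iff forall_2 matrix_matrix_mult_def sum_2 det_2 mat_def algebra_simps)

lemma group_SL2Z: "group SL2Z"
proof (rule groupI)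
  show "\<exists>y\<in>carrier SL2Z. y \<otimes>\<^bsub>SL2Z\<^esub> x = \<one>\<^bsub>SL2Z\<^esub>" if "x \<in> carrier SL2Z" for x
    using that by (intro bexI[of _ "adj2 x"]) (auto simp: SL2Z_def det_adj2 adj2_mult)
qed (auto simp: SL2Z_def det_mul matrix_mul_assoc)

lemma inv_SL2Z: "det A = 1 \<Longrightarrow> inv\<^bsub>SL2Z\<^esub> A = adj2 A"
  by (rule group.inv_equality[OF group_SL2Z]) (simp_all add: SL2Z_def adj2_mult det_adj2)

lemma Gamma_principal_iff:
  "A \<in> Gamma_principal N \<longleftrightarrow> det A = 1 \<and> [A $ 1 $ 1 = 1] (mod int N) \<and> [A $ 1 $ 2 = 0] (mod int N) \<and>
     [A $ 2 $ 1 = 0] (mod int N) \<and> [A $ 2 $ 2 = 1] (mod int N)"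
  by (simp add: Gamma_principal_def forall_2 mat_def)

lemma congruence_subgroup_Gamma_principal:
  assumes "N > 0"
  shows "congruence_subgroup (Gamma_principal N)"
  unfolding congruence_subgroup_def
proof (intro conjI exI[of _ N] assms order_refl)
  show "subgroup (Gamma_principal N) SL2Z"
  proof (rule subgroup.intro)
    show "Gamma_principal N \<subseteq> carrier SL2Z" by (auto simp: Gamma_principal_def SL2Z_def)
    show "\<one>\<^bsub>SL2Z\<^esub> \<in> Gamma_principal N" by (simp add: SL2Z_def Gamma_principal_def)
    show "inv\<^bsub>SL2Z\<^esub> A \<in> Gamma_principal N" if "A \<in> Gamma_principal N" for A
    proof -
      have "[- (A $ 1 $ 2) = - 0] (mod int N)" "[- (A $ 2 $ 1) = - 0] (mod int N)"
        using that unfolding Gamma_principal_iff cong_minus_minus_iff by auto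
      then show ?thesis using that by (simp add: inv_SL2Z Gamma_principal_iff det_adj2)
    qed
    show "A \<otimes>\<^bsub>SL2Z\<^esub> B \<in> Gamma_principal N" if "A \<in> Gamma_principal N" "B \<in> Gamma_principal N" for A B
    proof -
      have e: "(A ** B) $ i $ j = A $ i $ 1 * B $ 1 $ j + A $ i $ 2 * B $ 2 $ j" for i j
        by (simp add: matrix_matrix_mult_def sum_2)
      have "[A $ 1 $ 1 * B $ 1 $ 1 + A $ 1 $ 2 * B $ 2 $ 1 = 1 * 1 + 0 * 0] (mod int N)"
        "[A $ 1 $ 1 * B $ 1 $ 2 + A $ 1 $ 2 * B $ 2 $ 2 = 1 * 0 + 0 * 1] (mod int N)"
        "[A $ 2 $ 1 * B $ 1 $ 1 + A $ 2 $ 2 * B $ 2 $ 1 = 0 * 1 + 1 * 0] (mod int N)"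
        "[A $ 2 $ 1 * B $ 1 $ 2 + A $ 2 $ 2 * B $ 2 $ 2 = 0 * 0 + 1 * 1] (mod int N)"
        using that unfolding Gamma_principal_iff by (intro cong_add cong_mult; simp)+
      then show ?thesis using that by (simp add: SL2Z_def Gamma_principal_iff det_mul e)
    qed
  qed
qed

lemma congruence_subgroup_Int:
  assumes "congruence_subgroup G" "congruence_subgroup K"
  shows "congruence_subgroup (G \<inter> K)"
proof -
  obtain N M where N: "N > 0" "Gamma_principal N \<subseteq> G" and M: "M > 0" "Gamma_principal M \<subseteq> K"
    using assms unfolding congruence_subgroup_def by blast
  have "Gamma_principal (N * M) \<subseteq> G \<inter> K"
    using N M Gamma_principal_mono[of N "N * M"] Gamma_principal_mono[of M "N * M"] by auto
  moreover have "subgroup (G \<inter> K) SL2Z"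
    using assms group.subgroups_Inter_pair[OF group_SL2Z] unfolding congruence_subgroup_def by blast
  ultimately show ?thesis unfolding congruence_subgroup_def using N M by (metis nat_0_less_mult_iff)
qed

section \<open>Spaces of modular forms and of Eisenstein series\<close>

lemma modular_forms_antimono: "G \<subseteq> K \<Longrightarrow> modular_forms k K \<subseteq> modular_forms k G"
  unfolding modular_forms_def slash_invariant_def by blast

lemma bounded_at_cusps_add:
  assumes "bounded_at_cusps k f" "bounded_at_cusps k g"
  shows "bounded_at_cusps k (\<lambda>\<tau>. f \<tau> + g \<tau>)"
  unfolding bounded_at_cusps_def
proof
  fix \<sigma> assume s: "\<sigma> \<in> carrier SL2Z"
  obtain A B where f: "B > 0" "\<And>\<tau>. Im \<tau> > B \<Longrightarrow> cmod (slash k f \<sigma> \<tau>) \<le> A"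
    using assms(1) s unfolding bounded_at_cusps_def by blast
  obtain A' B' where g: "B' > 0" "\<And>\<tau>. Im \<tau> > B' \<Longrightarrow> cmod (slash k g \<sigma> \<tau>) \<le> A'"
    using assms(2) s unfolding bounded_at_cusps_def by blast
  have "cmod (slash k (\<lambda>\<tau>. f \<tau> + g \<tau>) \<sigma> \<tau>) \<le> A + A'" if "Im \<tau> > max B B'" for \<tau>
    using f(2)[of \<tau>] g(2)[of \<tau>] that norm_triangle_ineq[of "slash k f \<sigma> \<tau>" "slash k g \<sigma> \<tau>"]
    by (simp add: slash_eq add_divide_distrib)
  then show "\<exists>A B. B > 0 \<and> (\<forall>\<tau>. Im \<tau> > B \<longrightarrow> cmod (slash k (\<lambda>\<tau>. f \<tau> + g \<tau>) \<sigma> \<tau>) \<le> A)"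
    using f(1) by (intro exI[of _ "A + A'"] exI[of _ "max B B'"]) auto
qed

lemma bounded_at_cusps_cmult:
  assumes "bounded_at_cusps k f"
  shows "bounded_at_cusps k (\<lambda>\<tau>. c * f \<tau>)"
  unfolding bounded_at_cusps_def
proof
  fix \<sigma> assume s: "\<sigma> \<in> carrier SL2Z"
  obtain A B where f: "B > 0" "\<And>\<tau>. Im \<tau> > B \<Longrightarrow> cmod (slash k f \<sigma> \<tau>) \<le> A"
    using assms(1) s unfolding bounded_at_cusps_def by blast
  have "cmod (slash k (\<lambda>\<tau>. c * f \<tau>) \<sigma> \<tau>) \<le> cmod c * A" if "Im \<tau> > B" for \<tau>
    using mult_left_mono[OF f(2)[OF that], of "cmod c"] by (simp add: slash_eq norm_mult norm_divide)
  then show "\<exists>A B. B > 0 \<and> (\<forall>\<tau>. Im \<tau> > B \<longrightarrow> cmod (slash k (\<lambda>\<tau>. c * f \<tau>) \<sigma> \<tau>) \<le> A)"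
    using f(1) by blast
qed

lemma modular_forms_add: "f \<in> modular_forms k G \<Longrightarrow> g \<in> modular_forms k G \<Longrightarrow> (\<lambda>\<tau>. f \<tau> + g \<tau>) \<in> modular_forms k G"
  unfolding modular_forms_def slash_invariant_def
  by (auto intro: holomorphic_on_add bounded_at_cusps_add simp: slash_eq add_divide_distrib)

lemma modular_forms_cmult: "f \<in> modular_forms k G \<Longrightarrow> (\<lambda>\<tau>. c * f \<tau>) \<in> modular_forms k G"
  unfolding modular_forms_def slash_invariant_def
  by (auto intro!: holomorphic_on_mult bounded_at_cusps_cmult simp: slash_eq simp flip: times_divide_eq_right)

lemma modular_forms_zero: "(\<lambda>_. 0) \<in> modular_forms k G"
proof -
  have "bounded_at_cusps k (\<lambda>_. 0)"
    unfolding bounded_at_cusps_def by (intro ballI exI[of _ 0] exI[of _ 1]) (simp add: slash_eq)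
  then show ?thesis unfolding modular_forms_def slash_invariant_def by (simp add: slash_eq)
qed

lemma eisenstein_forms_antimono: "G \<subseteq> K \<Longrightarrow> eisenstein_forms k K \<subseteq> eisenstein_forms k G"
  unfolding eisenstein_forms_def using modular_forms_antimono by blast

lemma eisenstein_forms_add:
  assumes "f \<in> eisenstein_forms k G" "g \<in> eisenstein_forms k G"
  shows "(\<lambda>\<tau>. f \<tau> + g \<tau>) \<in> eisenstein_forms k G"
proof -
  obtain A c where A: "finite A" "\<forall>V\<in>A. compact_open_vec V" "\<forall>\<tau>\<in>uhp. f \<tau> = (\<Sum>V\<in>A. c V * phi k V 0 \<tau>)"
    using assms(1) unfolding eisenstein_forms_def by blast
  obtain B d where B: "finite B" "\<forall>V\<in>B. compact_open_vec V" "\<forall>\<tau>\<in>uhp. g \<tau> = (\<Sum>V\<in>B. d V * phi k V 0 \<tau>)"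
    using assms(2) unfolding eisenstein_forms_def by blast
  \<comment> \<open>The two families may share sets V; extending the coefficients by zero and adding
    them avoids counting such a V twice.\<close>
  define e where "e = (\<lambda>V. (if V \<in> A then c V else 0) + (if V \<in> B then d V else 0))"
  have "f \<tau> + g \<tau> = (\<Sum>V\<in>A \<union> B. e V * phi k V 0 \<tau>)" if t: "\<tau> \<in> uhp" for \<tau>
  proof -
    have "(\<Sum>V\<in>A. c V * phi k V 0 \<tau>) = (\<Sum>V\<in>A \<union> B. (if V \<in> A then c V else 0) * phi k V 0 \<tau>)"
      using A(1) B(1) by (intro sum.mono_neutral_cong_left) auto
    moreover have "(\<Sum>V\<in>B. d V * phi k V 0 \<tau>) = (\<Sum>V\<in>A \<union> B. (if V \<in> B then d V else 0) * phi k V 0 \<tau>)"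
      using A(1) B(1) by (intro sum.mono_neutral_cong_left) auto
    ultimately show ?thesis using A(3) B(3) t by (simp add: e_def distrib_right sum.distrib)
  qed
  then show ?thesis unfolding eisenstein_forms_def
    using assms A(1,2) B(1,2) modular_forms_add[of f k G g] unfolding eisenstein_forms_def
    by (intro CollectI conjI exI[of _ "A \<union> B"] exI[of _ e]) auto
qed

lemma eisenstein_forms_cmult:
  assumes "f \<in> eisenstein_forms k G"
  shows "(\<lambda>\<tau>. c * f \<tau>) \<in> eisenstein_forms k G"
proof -
  obtain A d where A: "finite A" "\<forall>V\<in>A. compact_open_vec V" "\<forall>\<tau>\<in>uhp. f \<tau> = (\<Sum>V\<in>A. d V * phi k V 0 \<tau>)"
    using assms(1) unfolding eisenstein_forms_def by blast
  have "c * f \<tau> = (\<Sum>V\<in>A. (c * d V) * phi k V 0 \<tau>)" if "\<tau> \<in> uhp" for \<tau>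
    using A(3) that by (simp add: sum_distrib_left mult.assoc)
  then show ?thesis unfolding eisenstein_forms_def
    using assms A(1,2) modular_forms_cmult[of f k G c] unfolding eisenstein_forms_def
    by (intro CollectI conjI exI[of _ A] exI[of _ "\<lambda>V. c * d V"]) auto
qed

lemma eisenstein_forms_zero: "(\<lambda>_. 0) \<in> eisenstein_forms k G"
  unfolding eisenstein_forms_def using modular_forms_zero by (auto intro!: exI[of _ "{}"])

section \<open>The groups of power series and their quotient\<close>

lemma M2_tilde_common:
  assumes "g \<in> carrier M2_tilde" "h \<in> carrier M2_tilde"
  obtains G where "congruence_subgroup G" "\<And>i j. g i j \<in> modular_forms (i + j + 2) G" "\<And>i j. h i j \<in> modular_forms (i + j + 2) G"
proof -
  obtain G K where G: "congruence_subgroup G" "\<And>i j. g i j \<in> modular_forms (i + j + 2) G"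
    and K: "congruence_subgroup K" "\<And>i j. h i j \<in> modular_forms (i + j + 2) K"
    using assms unfolding M2_tilde_def by auto
  have "g i j \<in> modular_forms (i + j + 2) (G \<inter> K)" "h i j \<in> modular_forms (i + j + 2) (G \<inter> K)" for i j
    using G(2)[of i j] K(2)[of i j] modular_forms_antimono[of "G \<inter> K"] by blast+
  then show thesis using that congruence_subgroup_Int[OF G(1) K(1)] by blast
qed

lemma M2_tilde_cmult:
  assumes "h \<in> carrier M2_tilde"
  shows "(\<lambda>i j \<tau>. c i j * h i j \<tau>) \<in> carrier M2_tilde"
  using assms unfolding M2_tilde_def by (auto intro: modular_forms_cmult)

lemma congruence_subgroup_exists: "\<exists>G. congruence_subgroup G"
  using congruence_subgroup_Gamma_principal[of 1] by auto

lemma comm_group_M2_tilde: "comm_group M2_tilde"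
proof (rule comm_groupI)
  show "x \<otimes>\<^bsub>M2_tilde\<^esub> y \<in> carrier M2_tilde" if xy: "x \<in> carrier M2_tilde" "y \<in> carrier M2_tilde" for x y
  proof -
    obtain G where "congruence_subgroup G" "\<And>i j. x i j \<in> modular_forms (i + j + 2) G" "\<And>i j. y i j \<in> modular_forms (i + j + 2) G"
      using M2_tilde_common[OF xy] by blast
    then show ?thesis unfolding M2_tilde_def using modular_forms_add by auto
  qed
  show "\<one>\<^bsub>M2_tilde\<^esub> \<in> carrier M2_tilde"
    using congruence_subgroup_exists modular_forms_zero unfolding M2_tilde_def by auto
  show "\<exists>y\<in>carrier M2_tilde. y \<otimes>\<^bsub>M2_tilde\<^esub> x = \<one>\<^bsub>M2_tilde\<^esub>" if "x \<in> carrier M2_tilde" for x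
    using M2_tilde_cmult[OF that, of "\<lambda>_ _. - 1"]
    by (intro bexI[of _ "\<lambda>i j \<tau>. - 1 * x i j \<tau>"]) (auto simp: M2_tilde_def)
qed (auto simp: M2_tilde_def fun_eq_iff)

lemma inv_M2_tilde:
  assumes "h \<in> carrier M2_tilde"
  shows "inv\<^bsub>M2_tilde\<^esub> h = (\<lambda>i j \<tau>. - 1 * h i j \<tau>)"
proof (rule group.inv_equality[OF comm_group.axioms(2)[OF comm_group_M2_tilde] _ assms])
  show "(\<lambda>i j \<tau>. - 1 * h i j \<tau>) \<in> carrier M2_tilde" using M2_tilde_cmult[OF assms, of "\<lambda>_ _. - 1"] by simp
qed (simp add: M2_tilde_def)

lemma E2_tilde_cmult: "h \<in> E2_tilde \<Longrightarrow> (\<lambda>i j \<tau>. c i j * h i j \<tau>) \<in> E2_tilde"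
  unfolding E2_tilde_def by (auto intro: eisenstein_forms_cmult)

lemma subgroup_E2_tilde: "subgroup E2_tilde M2_tilde"
proof (rule subgroup.intro)
  show sub: "E2_tilde \<subseteq> carrier M2_tilde"
    unfolding E2_tilde_def M2_tilde_def eisenstein_forms_def by auto
  show "\<one>\<^bsub>M2_tilde\<^esub> \<in> E2_tilde"
    using congruence_subgroup_exists eisenstein_forms_zero unfolding M2_tilde_def E2_tilde_def by auto
  show "inv\<^bsub>M2_tilde\<^esub> x \<in> E2_tilde" if "x \<in> E2_tilde" for x
    using E2_tilde_cmult[OF that, of "\<lambda>_ _. - 1"] sub that by (simp add: inv_M2_tilde subset_iff)
  show "x \<otimes>\<^bsub>M2_tilde\<^esub> y \<in> E2_tilde" if xy: "x \<in> E2_tilde" "y \<in> E2_tilde" for x y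
  proof -
    obtain G K where G: "congruence_subgroup G" "\<And>i j. x i j \<in> eisenstein_forms (i + j + 2) G"
      and K: "congruence_subgroup K" "\<And>i j. y i j \<in> eisenstein_forms (i + j + 2) K"
      using xy unfolding E2_tilde_def by auto
    have "x i j \<in> eisenstein_forms (i + j + 2) (G \<inter> K)" "y i j \<in> eisenstein_forms (i + j + 2) (G \<inter> K)" for i j
      using G(2)[of i j] K(2)[of i j] eisenstein_forms_antimono[of "G \<inter> K"] by blast+
    then show ?thesis unfolding E2_tilde_def M2_tilde_def
      using congruence_subgroup_Int[OF G(1) K(1)] eisenstein_forms_add by auto
  qed
qed

lemma normal_E2_tilde: "E2_tilde \<lhd> M2_tilde"
  by (rule comm_group.subgroup_imp_normal[OF comm_group_M2_tilde subgroup_E2_tilde])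

abbreviation cusp_class :: "mf_series \<Rightarrow> mf_series set" where
  "cusp_class h \<equiv> E2_tilde #>\<^bsub>M2_tilde\<^esub> h"

lemma cusp_class_mult:
  assumes "g \<in> carrier M2_tilde" "h \<in> carrier M2_tilde"
  shows "cusp_class g \<otimes>\<^bsub>S2_tilde\<^esub> cusp_class h = cusp_class (g \<otimes>\<^bsub>M2_tilde\<^esub> h)"
  using normal.rcos_sum[OF normal_E2_tilde assms] by (simp add: S2_tilde_def FactGroup_def)

lemma carrier_S2_tilde: "carrier S2_tilde = cusp_class ` carrier M2_tilde"
  by (auto simp: S2_tilde_def FactGroup_def RCOSETS_def)

lemma comm_group_S2_tilde: "comm_group S2_tilde"
proof -
  interpret M: comm_group M2_tilde by (rule comm_group_M2_tilde)
  have g: "group S2_tilde" unfolding S2_tilde_def by (rule normal.factorgroup_is_group[OF normal_E2_tilde])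
  then interpret group S2_tilde .
  show ?thesis
  proof (rule group_comm_groupI)
    fix x y assume "x \<in> carrier S2_tilde" "y \<in> carrier S2_tilde"
    then obtain a b where ab: "a \<in> carrier M2_tilde" "x = cusp_class a" "b \<in> carrier M2_tilde" "y = cusp_class b"
      by (auto simp: carrier_S2_tilde)
    then show "x \<otimes>\<^bsub>S2_tilde\<^esub> y = y \<otimes>\<^bsub>S2_tilde\<^esub> x" by (simp add: cusp_class_mult M.m_comm)
  qed
qed

text \<open>The level is chosen before i and j, so that \<open>H\<close> applied coefficientwise
  gives modular forms for one congruence subgroup.\<close>

definition gform :: "mf_series \<Rightarrow> bool" where
  "gform h \<longleftrightarrow> (\<exists>N>0. \<forall>i j. nform (i + j + 2) N (h i j))"

definition proj_series :: "(nat \<Rightarrow> (complex \<Rightarrow> complex) \<Rightarrow> complex \<Rightarrow> complex) \<Rightarrow> mf_series \<Rightarrow> mf_series" where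
  "proj_series H h = (\<lambda>i j. H (i + j + 2) (h i j))"

lemma gform_common:
  assumes "gform g" "gform h"
  obtains N where "N > 0" "\<And>i j. nform (i + j + 2) N (g i j)" "\<And>i j. nform (i + j + 2) N (h i j)"
proof -
  obtain N M where N: "N > 0" "\<And>i j. nform (i + j + 2) N (g i j)" and M: "M > 0" "\<And>i j. nform (i + j + 2) M (h i j)"
    using assms unfolding gform_def by auto
  show thesis
    by (rule that[of "N * M"]) (use N M nform_mono[of _ N _ "N * M"] nform_mono[of _ M _ "N * M"] in auto)
qed

lemma gform_add:
  assumes "gform g" "gform h"
  shows "gform (\<lambda>i j \<tau>. g i j \<tau> + h i j \<tau>)"
proof -
  obtain N where "N > 0" "\<And>i j. nform (i + j + 2) N (g i j)" "\<And>i j. nform (i + j + 2) N (h i j)"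
    using gform_common[OF assms] by blast
  then show ?thesis unfolding gform_def using nform_add by blast
qed

lemma gform_zero: "gform (\<lambda>i j \<tau>. 0)"
  unfolding gform_def using nform_zero by (intro exI[of _ 1]) auto

lemma gform_sum:
  assumes "finite I" "\<And>i. i \<in> I \<Longrightarrow> gform (f i)"
  shows "gform (\<lambda>p q \<tau>. \<Sum>i\<in>I. f i p q \<tau>)"
  using assms
proof (induction rule: finite_induct)
  case (insert x F)
  then show ?case using gform_add[of "f x" "\<lambda>p q \<tau>. \<Sum>i\<in>F. f i p q \<tau>"] by simp
qed (simp add: gform_zero)

section \<open>Linearity of the holomorphic projection\<close>

context
  fixes H :: "nat \<Rightarrow> (complex \<Rightarrow> complex) \<Rightarrow> complex \<Rightarrow> complex"
  assumes H: "holomorphic_projection H"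
begin

lemma proj_modular:
  assumes "N > 0" "nform k N f"
  shows "H k f \<in> modular_forms k (Gamma_principal N)"
  using H congruence_subgroup_Gamma_principal[OF assms(1)] nform_nearly_hol[OF assms(2)]
  unfolding holomorphic_projection_def by blast

lemma proj_add:
  assumes "N > 0" "nform k N f" "nform k N g"
  shows "H k (\<lambda>\<tau>. f \<tau> + g \<tau>) = (\<lambda>\<tau>. H k f \<tau> + H k g \<tau>)"
  using H congruence_subgroup_Gamma_principal[OF assms(1)] nform_nearly_hol[OF assms(2)] nform_nearly_hol[OF assms(3)]
  unfolding holomorphic_projection_def by blast

lemma proj_cmult:
  assumes "N > 0" "nform k N f"
  shows "H k (\<lambda>\<tau>. c * f \<tau>) = (\<lambda>\<tau>. c * H k f \<tau>)"
  using H congruence_subgroup_Gamma_principal[OF assms(1)] nform_nearly_hol[OF assms(2)]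
  unfolding holomorphic_projection_def by blast

lemma proj_series_carrier: "gform h \<Longrightarrow> proj_series H h \<in> carrier M2_tilde"
proof -
  assume "gform h"
  then obtain N where N: "N > 0" "\<And>i j. nform (i + j + 2) N (h i j)" unfolding gform_def by blast
  then show ?thesis unfolding M2_tilde_def proj_series_def
    using proj_modular[OF N(1)] congruence_subgroup_Gamma_principal[OF N(1)] by auto
qed

lemma proj_series_add:
  assumes "gform g" "gform h"
  shows "proj_series H (\<lambda>i j \<tau>. g i j \<tau> + h i j \<tau>) = proj_series H g \<otimes>\<^bsub>M2_tilde\<^esub> proj_series H h"
proof -
  obtain N where "N > 0" "\<And>i j. nform (i + j + 2) N (g i j)" "\<And>i j. nform (i + j + 2) N (h i j)"
    using gform_common[OF assms] by blast
  then show ?thesis using proj_add by (simp add: proj_series_def M2_tilde_def fun_eq_iff)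
qed

lemma proj_series_cmult:
  assumes "gform h"
  shows "proj_series H (\<lambda>i j \<tau>. c i j * h i j \<tau>) = (\<lambda>i j \<tau>. c i j * proj_series H h i j \<tau>)"
proof -
  obtain N where "N > 0" "\<And>i j. nform (i + j + 2) N (h i j)" using assms unfolding gform_def by blast
  then show ?thesis using proj_cmult by (simp add: proj_series_def)
qed

end


section \<open>Lattice cosets\<close>

text \<open>Congruence modulo the group \<alpha> Z; statements about cosets of vectors and matrices
  are reduced to it entry by entry.\<close>

definition req :: "rat \<Rightarrow> rat \<Rightarrow> rat \<Rightarrow> bool" where
  "req \<alpha> x y \<longleftrightarrow> (\<exists>k::int. x = y + \<alpha> * of_int k)"

lemma req_refl: "req \<alpha> x x"
  unfolding req_def by (rule exI[of _ 0]) simp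

lemma req_sym: "req \<alpha> x y \<Longrightarrow> req \<alpha> y x"
  unfolding req_def
proof (elim exE)
  fix k assume "x = y + \<alpha> * of_int k"
  then show "\<exists>k. y = x + \<alpha> * of_int k" by (intro exI[of _ "- k"]) simp
qed

lemma req_trans: "req \<alpha> x y \<Longrightarrow> req \<alpha> y z \<Longrightarrow> req \<alpha> x z"
  unfolding req_def
proof (elim exE)
  fix k l assume "x = y + \<alpha> * of_int k" "y = z + \<alpha> * of_int l"
  then show "\<exists>k. x = z + \<alpha> * of_int k" by (intro exI[of _ "k + l"]) (simp add: algebra_simps)
qed

lemma req_coarsen: "req (\<alpha> * of_int m) x y \<Longrightarrow> req \<alpha> x y"
  unfolding req_def
proof (elim exE)
  fix k assume "x = y + \<alpha> * of_int m * of_int k"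
  then show "\<exists>k. x = y + \<alpha> * of_int k" by (intro exI[of _ "m * k"]) simp
qed

text \<open>Expresses that N Z is contained in \<alpha> Z, so that classes modulo N refine classes
  modulo \<alpha>.\<close>

definition mult_of :: "nat \<Rightarrow> rat \<Rightarrow> bool" where
  "mult_of N \<alpha> \<longleftrightarrow> N > 0 \<and> \<alpha> \<noteq> 0 \<and> (\<exists>m::int. of_nat N = \<alpha> * of_int m)"

lemma mult_of_dvd: "mult_of N \<alpha> \<Longrightarrow> N dvd M \<Longrightarrow> M > 0 \<Longrightarrow> mult_of M \<alpha>"
  unfolding mult_of_def
proof (elim conjE exE dvdE, intro conjI)
  fix m k assume "of_nat N = \<alpha> * of_int m" "M = N * k"
  then show "\<exists>m. of_nat M = \<alpha> * of_int m" by (intro exI[of _ "m * int k"]) simp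
qed

lemma mult_of_nat: "N dvd M \<Longrightarrow> M > 0 \<Longrightarrow> mult_of M (of_nat N)"
  unfolding mult_of_def
proof (elim dvdE, intro conjI)
  fix k assume "M = N * k" "M > 0"
  then show "\<exists>m. of_nat M = of_nat N * of_int m" "(of_nat N :: rat) \<noteq> 0" by (auto intro!: exI[of _ "int k"])
qed

lemma ex_mult_of: "\<alpha> \<noteq> 0 \<Longrightarrow> \<exists>N. mult_of N \<alpha>"
proof -
  assume a: "\<alpha> \<noteq> 0"
  obtain p q where pq: "quotient_of \<alpha> = (p, q)" by (metis surj_pair)
  have q: "q > 0" using quotient_of_denom_pos[OF pq] .
  have e: "\<alpha> = of_int p / of_int q" using quotient_of_div[OF pq] .
  have p: "p \<noteq> 0" using a e by auto
  have "rat_of_nat (nat \<bar>p\<bar>) = \<alpha> * of_int (if p > 0 then q else - q)"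
    using p q by (simp add: e)
  then show ?thesis using p a unfolding mult_of_def by (intro exI[of _ "nat \<bar>p\<bar>"]) auto
qed

lemma mult_of_req: "mult_of N \<alpha> \<Longrightarrow> req (of_nat N) x y \<Longrightarrow> req \<alpha> x y"
  unfolding mult_of_def by (metis req_coarsen)

lemma req_representatives:
  assumes "mult_of N \<alpha>"
  shows "\<exists>F. finite F \<and> (\<forall>y\<in>F. req \<alpha> y x) \<and> (\<forall>y. req \<alpha> y x \<longrightarrow> (\<exists>z\<in>F. req (of_nat N) y z))"
proof -
  obtain m :: int where N: "N > 0" and m: "of_nat N = \<alpha> * of_int m" using assms unfolding mult_of_def by blast
  have m0: "m \<noteq> 0" using N m by auto
  \<comment> \<open>The quotient m of N by \<alpha> has the sign of \<alpha>, so the residues are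
    taken as the range of \<open>mod\<close> instead of an interval starting at 0.\<close>
  let ?F = "(\<lambda>k. x + \<alpha> * of_int k) ` ((\<lambda>k. k mod m) ` (UNIV :: int set))"
  have fin: "finite ((\<lambda>k. k mod m) ` (UNIV :: int set))"
  proof (rule finite_subset)
    show "(\<lambda>k. k mod m) ` UNIV \<subseteq> {- \<bar>m\<bar>..\<bar>m\<bar>}"
      using m0 abs_mod_less[of m] by (auto simp: abs_less_iff intro: less_imp_le) (smt (verit) abs_mod_less)+
  qed auto
  have "\<exists>z\<in>?F. req (of_nat N) y z" if y: "req \<alpha> y x" for y
  proof -
    obtain k where k: "y = x + \<alpha> * of_int k" using y unfolding req_def by blast
    have "rat_of_int k = of_int (k mod m) + of_int m * of_int (k div m)"
      by (metis mod_mult_div_eq of_int_add of_int_mult)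
    then have "y = (x + \<alpha> * of_int (k mod m)) + of_nat N * of_int (k div m)"
      unfolding k m by (simp add: algebra_simps)
    then have "req (of_nat N) y (x + \<alpha> * of_int (k mod m))" unfolding req_def by blast
    then show ?thesis by blast
  qed
  moreover have "\<forall>y\<in>?F. req \<alpha> y x" unfolding req_def by auto
  ultimately show ?thesis using fin by (intro exI[of _ ?F]) blast
qed

section \<open>Cosets of vectors and boxes of matrices\<close>

definition vclass :: "rat \<Rightarrow> rat^2 \<Rightarrow> (rat^2) set" where
  "vclass \<alpha> v = {x. \<forall>i. req \<alpha> (x $ i) (v $ i)}"

text \<open>Cosets of lattices whose scaling factors may depend on the entry; multiplying a basic set
  by a diagonal matrix produces such sets.\<close>

definition mbox :: "(2 \<Rightarrow> rat) \<Rightarrow> rat^2^2 \<Rightarrow> (rat^2^2) set" where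
  "mbox \<alpha> g = {u. \<forall>i j. req (\<alpha> j) (u $ i $ j) (g $ i $ j)}"

abbreviation mclass :: "nat \<Rightarrow> rat^2^2 \<Rightarrow> (rat^2^2) set" where
  "mclass N \<equiv> mbox (\<lambda>_. of_nat N)"

lemma vclass_eq: "vclass \<alpha> v = (\<lambda>z. v + \<alpha> *s z) ` Z2"
proof (intro equalityI subsetI)
  fix x assume "x \<in> vclass \<alpha> v"
  then have "\<forall>i. \<exists>k::int. x $ i = v $ i + \<alpha> * of_int k" by (simp add: vclass_def req_def)
  then obtain k :: "2 \<Rightarrow> int" where k: "\<And>i. x $ i = v $ i + \<alpha> * of_int (k i)" by metis
  then have "x = v + \<alpha> *s (\<chi> i. of_int (k i))" by (simp add: vec_eq_iff)
  then show "x \<in> (\<lambda>z. v + \<alpha> *s z) ` Z2" by (rule image_eqI) (simp add: Z2_def)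
next
  fix x assume "x \<in> (\<lambda>z. v + \<alpha> *s z) ` Z2"
  then obtain z :: "rat^2" where z: "x = v + \<alpha> *s z" "\<And>i. z $ i \<in> \<int>" by (auto simp: Z2_def)
  have "req \<alpha> (x $ i) (v $ i)" for i
    using z(2)[of i] unfolding z(1) req_def by (auto elim!: Ints_cases)
  then show "x \<in> vclass \<alpha> v" by (simp add: vclass_def)
qed

lemma basic_vec_iff: "basic_vec V \<longleftrightarrow> (\<exists>v \<alpha>. \<alpha> \<noteq> 0 \<and> V = vclass \<alpha> v)"
  by (simp add: basic_vec_def vclass_eq)

lemma mat_mult_nth: "(mat \<alpha> ** m) $ i $ j = \<alpha> * m $ i $ j" for m :: "rat^2^2"
  using exhaust_2[of i] by (auto simp: matrix_matrix_mult_def sum_2 mat_def)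

lemma mbox_const_eq: "mbox (\<lambda>_. \<alpha>) g = (\<lambda>m. g + mat \<alpha> ** m) ` M2Z"
proof (intro equalityI subsetI)
  fix u assume "u \<in> mbox (\<lambda>_. \<alpha>) g"
  then have "\<forall>i j. \<exists>k::int. u $ i $ j = g $ i $ j + \<alpha> * of_int k" by (simp add: mbox_def req_def)
  then obtain k :: "2 \<Rightarrow> 2 \<Rightarrow> int" where k: "\<And>i j. u $ i $ j = g $ i $ j + \<alpha> * of_int (k i j)" by metis
  then have "u = g + mat \<alpha> ** (\<chi> i j. of_int (k i j))" by (simp add: vec_eq_iff mat_mult_nth)
  then show "u \<in> (\<lambda>m. g + mat \<alpha> ** m) ` M2Z" by (rule image_eqI) (simp add: M2Z_def)
next
  fix u assume "u \<in> (\<lambda>m. g + mat \<alpha> ** m) ` M2Z"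
  then obtain m :: "rat^2^2" where m: "u = g + mat \<alpha> ** m" "\<And>i j. m $ i $ j \<in> \<int>" by (auto simp: M2Z_def)
  have "req \<alpha> (u $ i $ j) (g $ i $ j)" for i j
    using m(2)[of i j] unfolding m(1) req_def by (auto simp: mat_mult_nth elim!: Ints_cases)
  then show "u \<in> mbox (\<lambda>_. \<alpha>) g" by (simp add: mbox_def)
qed

lemma basic_mat_iff: "basic_mat U \<longleftrightarrow> (\<exists>g \<alpha>. \<alpha> \<noteq> 0 \<and> U = mbox (\<lambda>_. \<alpha>) g)"
  by (simp add: basic_mat_def mbox_const_eq)

lemma vclass_self: "v \<in> vclass \<alpha> v"
  by (simp add: vclass_def req_refl)

lemma mbox_self: "g \<in> mbox \<alpha> g"
  by (simp add: mbox_def req_refl)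

lemma vclass_eqI: "x \<in> vclass \<alpha> v \<Longrightarrow> vclass \<alpha> x = vclass \<alpha> v"
  unfolding vclass_def using req_sym req_trans by blast

lemma mbox_eqI: "x \<in> mbox \<alpha> g \<Longrightarrow> mbox \<alpha> x = mbox \<alpha> g"
  unfolding mbox_def using req_sym req_trans by blast

lemma vclass_subset: "mult_of N \<alpha> \<Longrightarrow> x \<in> vclass \<alpha> v \<Longrightarrow> vclass (of_nat N) x \<subseteq> vclass \<alpha> v"
  unfolding vclass_def using mult_of_req req_trans by blast

lemma mclass_subset: "(\<And>j. mult_of N (\<alpha> j)) \<Longrightarrow> x \<in> mbox \<alpha> g \<Longrightarrow> mclass N x \<subseteq> mbox \<alpha> g"
  unfolding mbox_def using mult_of_req req_trans by blast

lemma finite_vclasses: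
  assumes "mult_of N \<alpha>"
  shows "finite (vclass (of_nat N) ` vclass \<alpha> v)"
proof -
  have "\<forall>i. \<exists>F. finite F \<and> (\<forall>y\<in>F. req \<alpha> y (v $ i)) \<and> (\<forall>y. req \<alpha> y (v $ i) \<longrightarrow> (\<exists>z\<in>F. req (of_nat N) y z))"
    using req_representatives[OF assms] by blast
  then obtain F where F: "\<And>i. finite (F i)" "\<And>i y. req \<alpha> y (v $ i) \<Longrightarrow> \<exists>z\<in>F i. req (of_nat N) y z"
    by metis
  have "vclass (of_nat N) ` vclass \<alpha> v \<subseteq> (\<lambda>(a, b). vclass (of_nat N) (vector [a, b])) ` (F 1 \<times> F 2)"
  proof clarify
    fix x assume x: "x \<in> vclass \<alpha> v"
    obtain a b where ab: "a \<in> F 1" "req (of_nat N) (x $ 1) a" "b \<in> F 2" "req (of_nat N) (x $ 2) b"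
      using F(2)[of "x $ 1" 1] F(2)[of "x $ 2" 2] x by (auto simp: vclass_def)
    then have "x \<in> vclass (of_nat N) (vector [a, b])" by (simp add: vclass_def forall_2)
    from vclass_eqI[OF this] show "vclass (of_nat N) x \<in> (\<lambda>(a, b). vclass (of_nat N) (vector [a, b])) ` (F 1 \<times> F 2)"
      using ab by auto
  qed
  then show ?thesis by (rule finite_subset) (use F in auto)
qed

text \<open>A union of finitely many classes modulo N M_2(Z). Every compact open set is of this form
  for some N, and N may be replaced by any positive multiple, so that any two sets have a common
  level.\<close>

definition adapted :: "nat \<Rightarrow> (rat^2^2) set \<Rightarrow> bool" where
  "adapted N A \<longleftrightarrow> N > 0 \<and> (\<exists>S. finite S \<and> A = (\<Union>g\<in>S. mclass N g))"

lemma adapted_mbox: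
  assumes "\<And>j. mult_of N (\<alpha> j)"
  shows "adapted N (mbox \<alpha> g)"
proof -
  have N: "N > 0" using assms[of 1] by (simp add: mult_of_def)
  have "\<forall>i j. \<exists>F. finite F \<and> (\<forall>y\<in>F. req (\<alpha> j) y (g $ i $ j)) \<and> (\<forall>y. req (\<alpha> j) y (g $ i $ j) \<longrightarrow> (\<exists>z\<in>F. req (of_nat N) y z))"
    using req_representatives[OF assms] by blast
  then obtain F where F: "\<And>i j. finite (F i j)" "\<And>i j y. y \<in> F i j \<Longrightarrow> req (\<alpha> j) y (g $ i $ j)"
    "\<And>i j y. req (\<alpha> j) y (g $ i $ j) \<Longrightarrow> \<exists>z\<in>F i j. req (of_nat N) y z"
    by metis
  \<comment> \<open>Representatives are chosen for each entry separately; their combinations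
    represent the classes modulo N in the box.\<close>
  define S where "S = (\<lambda>(a, b, c, d). vector [vector [a, b], vector [c, d]] :: rat^2^2) ` (F 1 1 \<times> F 1 2 \<times> F 2 1 \<times> F 2 2)"
  have S: "finite S" unfolding S_def using F(1) by auto
  have "mbox \<alpha> g = (\<Union>x\<in>S. mclass N x)"
  proof (intro equalityI subsetI)
    fix u assume u: "u \<in> mbox \<alpha> g"
    obtain a b c d where "a \<in> F 1 1" "req (of_nat N) (u $ 1 $ 1) a" "b \<in> F 1 2" "req (of_nat N) (u $ 1 $ 2) b"
      "c \<in> F 2 1" "req (of_nat N) (u $ 2 $ 1) c" "d \<in> F 2 2" "req (of_nat N) (u $ 2 $ 2) d"
      using F(3)[of 1 "u $ 1 $ 1" 1] F(3)[of 2 "u $ 1 $ 2" 1] F(3)[of 1 "u $ 2 $ 1" 2] F(3)[of 2 "u $ 2 $ 2" 2] u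
      by (auto simp: mbox_def)
    then have "vector [vector [a, b], vector [c, d]] \<in> S" "u \<in> mclass N (vector [vector [a, b], vector [c, d]])"
      by (force simp: S_def, simp add: mbox_def forall_2)
    then show "u \<in> (\<Union>x\<in>S. mclass N x)" by blast
  next
    fix u assume "u \<in> (\<Union>x\<in>S. mclass N x)"
    then obtain x where x: "x \<in> S" "u \<in> mclass N x" by blast
    have "x \<in> mbox \<alpha> g" using x(1) F(2) by (auto simp: S_def mbox_def forall_2)
    then show "u \<in> mbox \<alpha> g" using mclass_subset[of N \<alpha>, OF assms] x(2) by blast
  qed
  then show ?thesis unfolding adapted_def using N S by blast
qed

lemma ex_adapted_mbox:
  assumes "\<And>j. \<alpha> j \<noteq> 0"
  shows "\<exists>N. (\<forall>j. mult_of N (\<alpha> j)) \<and> adapted N (mbox \<alpha> g)"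
proof -
  obtain N M where N: "mult_of N (\<alpha> 1)" and M: "mult_of M (\<alpha> 2)" using ex_mult_of assms by meson
  have "N > 0" "M > 0" using N M by (auto simp: mult_of_def)
  then have "mult_of (N * M) (\<alpha> j)" for j
    using mult_of_dvd[OF N, of "N * M"] mult_of_dvd[OF M, of "N * M"] exhaust_2[of j] by auto
  then show ?thesis using adapted_mbox by blast
qed

lemma adapted_UN:
  assumes "finite I" "N > 0" "\<And>i. i \<in> I \<Longrightarrow> adapted N (A i)"
  shows "adapted N (\<Union>i\<in>I. A i)"
proof -
  have "\<forall>i\<in>I. \<exists>S. finite S \<and> A i = (\<Union>g\<in>S. mclass N g)" using assms unfolding adapted_def by blast
  then obtain S where S: "\<And>i. i \<in> I \<Longrightarrow> finite (S i)" "\<And>i. i \<in> I \<Longrightarrow> A i = (\<Union>g\<in>S i. mclass N g)" by metis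
  then have "(\<Union>i\<in>I. A i) = (\<Union>g\<in>(\<Union>i\<in>I. S i). mclass N g)" by auto
  moreover have "finite (\<Union>i\<in>I. S i)" using assms(1) S(1) by blast
  ultimately show ?thesis unfolding adapted_def using assms(2) by blast
qed

lemma adapted_Un: "adapted N A \<Longrightarrow> adapted N B \<Longrightarrow> adapted N (A \<union> B)"
proof -
  assume AB: "adapted N A" "adapted N B"
  have "adapted N (\<Union>X\<in>{A, B}. X)"
  proof (rule adapted_UN)
    show "N > 0" using AB(1) unfolding adapted_def by (rule conjunct1)
  qed (use AB in auto)
  then show ?thesis by simp
qed

lemma adapted_dvd:
  assumes "adapted N A" "N dvd M" "M > 0"
  shows "adapted M A"
proof -
  obtain S where S: "finite S" "A = (\<Union>g\<in>S. mclass N g)" using assms(1) unfolding adapted_def by blast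
  show ?thesis unfolding S(2)
    by (intro adapted_UN S assms(3) adapted_mbox mult_of_nat assms)
qed

lemma compact_open_adapted:
  assumes "compact_open_mat A"
  shows "\<exists>N. adapted N A"
proof -
  obtain \<U> where U: "finite \<U>" "\<forall>B\<in>\<U>. basic_mat B" "A = \<Union>\<U>" using assms unfolding compact_open_mat_def by blast
  from U(1,2) have "\<exists>N. adapted N (\<Union>\<U>)"
  proof (induction rule: finite_induct)
    case empty
    show ?case unfolding adapted_def by (intro exI[of _ 1]) auto
  next
    case (insert B \<B>)
    obtain N where N: "adapted N (\<Union>\<B>)" using insert by auto
    obtain g \<alpha> where "\<alpha> \<noteq> 0" "B = mbox (\<lambda>_. \<alpha>) g" using insert.prems by (auto simp: basic_mat_iff)
    then obtain M where M: "adapted M B" using ex_adapted_mbox[of "\<lambda>_. \<alpha>" g] by blast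
    have pos: "N > 0" "M > 0" using N M by (auto simp: adapted_def)
    have "adapted (N * M) B" by (rule adapted_dvd[OF M]) (use pos in auto)
    moreover have "adapted (N * M) (\<Union>\<B>)" by (rule adapted_dvd[OF N]) (use pos in auto)
    ultimately have "adapted (N * M) (B \<union> \<Union>\<B>)" by (rule adapted_Un)
    then show ?case by auto
  qed
  then show ?thesis using U(3) by simp
qed

lemma basic_mat_mclass: "N > 0 \<Longrightarrow> basic_mat (mclass N g)"
  unfolding basic_mat_iff by (intro exI[of _ g] exI[of _ "of_nat N"]) simp

lemma adapted_compact_open: "adapted N A \<Longrightarrow> compact_open_mat A"
  unfolding adapted_def compact_open_mat_def
proof (elim conjE exE)
  fix S assume "0 < N" "finite S" "A = (\<Union>g\<in>S. mclass N g)"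
  then show "\<exists>\<U>. finite \<U> \<and> (\<forall>B\<in>\<U>. basic_mat B) \<and> A = \<Union>\<U>"
    by (intro exI[of _ "mclass N ` S"]) (auto simp: basic_mat_mclass)
qed

lemma adapted_periodic:
  assumes "adapted N A" "x \<in> A"
  shows "mclass N x \<subseteq> A"
proof -
  obtain S g where S: "A = (\<Union>g\<in>S. mclass N g)" and g: "g \<in> S" "x \<in> mclass N g"
    using assms unfolding adapted_def by blast
  then show ?thesis using mbox_eqI[OF g(2)] by blast
qed

lemma adapted_Union:
  assumes "adapted N A"
  shows "\<Union>(mclass N ` A) = A"
proof (intro equalityI subsetI)
  fix x assume "x \<in> A"
  then show "x \<in> \<Union>(mclass N ` A)" using mbox_self[of x "\<lambda>_. of_nat N"] by (intro UnionI[of "mclass N x"]) auto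
next
  fix x assume "x \<in> \<Union>(mclass N ` A)"
  then obtain y where "y \<in> A" "x \<in> mclass N y" by auto
  then show "x \<in> A" using adapted_periodic[OF assms] by auto
qed

lemma mclass_disjoint:
  assumes "C \<in> mclass N ` A" "C' \<in> mclass N ` A" "C \<noteq> C'"
  shows "C \<inter> C' = {}"
proof (rule ccontr)
  assume "C \<inter> C' \<noteq> {}"
  then obtain x where x: "x \<in> C" "x \<in> C'" by auto
  obtain a b where ab: "C = mclass N a" "C' = mclass N b" using assms(1,2) by auto
  show False using mbox_eqI[of x _ a] mbox_eqI[of x _ b] x assms(3) unfolding ab by auto
qed

lemma adapted_finite:
  assumes "adapted N A"
  shows "finite (mclass N ` A)"
proof -
  obtain S where S: "finite S" "A = (\<Union>g\<in>S. mclass N g)" using assms unfolding adapted_def by blast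
  have "mclass N ` A \<subseteq> mclass N ` S"
  proof clarify
    fix x assume "x \<in> A"
    then obtain g where "g \<in> S" "x \<in> mclass N g" using S by blast
    then show "mclass N x \<in> mclass N ` S" using mbox_eqI[of x "\<lambda>_. of_nat N" g] by blast
  qed
  then show ?thesis using S(1) finite_subset by blast
qed

section \<open>Distribution relations under refinement\<close>

lemma has_phi_UN:
  assumes "finite I" "\<And>B. B \<in> I \<Longrightarrow> has_phi n B \<tau> (c B)" "\<And>B B'. B \<in> I \<Longrightarrow> B' \<in> I \<Longrightarrow> B \<noteq> B' \<Longrightarrow> B \<inter> B' = {}"
  shows "has_phi n (\<Union>I) \<tau> (\<Sum>B\<in>I. c B)"
  using assms
proof (induction rule: finite_induct)
  case (insert B I)
  have "B \<inter> \<Union>I = {}"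
  proof -
    have "B \<inter> B' = {}" if "B' \<in> I" for B' using insert.prems(2)[of B B'] insert.hyps(2) that by auto
    then show ?thesis by blast
  qed
  then show ?case using insert has_phi_Un[of n B \<tau> "c B" "\<Union>I"] by simp
qed (simp add: has_phi_empty)

lemma phi_vclass_refine:
  assumes N: "mult_of N \<alpha>" and n: "n \<ge> 1" and t: "\<tau> \<in> uhp"
  shows "phi n (vclass \<alpha> v) 0 \<tau> = (\<Sum>B\<in>vclass (of_nat N) ` vclass \<alpha> v. phi n B 0 \<tau>)"
proof -
  let ?I = "vclass (of_nat N) ` vclass \<alpha> v"
  have N0: "N > 0" using N by (simp add: mult_of_def)
  have b: "basic_vec B" if "B \<in> ?I" for B
    using that N0 unfolding basic_vec_iff by (metis imageE of_nat_eq_0_iff less_numeral_extra(3))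
  have "has_phi n B \<tau> (phi n B 0 \<tau>)" if "B \<in> ?I" for B
    using basic_vec_phi[OF b[OF that] n] has_phi_imp_phi_eq[OF t] t by metis
  moreover have "B \<inter> B' = {}" if "B \<in> ?I" "B' \<in> ?I" "B \<noteq> B'" for B B'
    using that vclass_eqI by blast
  moreover have "\<Union>?I = vclass \<alpha> v"
    using vclass_subset[OF N, of _ v] vclass_self by blast
  ultimately have "has_phi n (vclass \<alpha> v) \<tau> (\<Sum>B\<in>?I. phi n B 0 \<tau>)"
    using has_phi_UN[OF finite_vclasses[OF N, of v], of n \<tau> "\<lambda>B. phi n B 0 \<tau>"] by metis
  then show ?thesis by (rule has_phi_imp_phi_eq[OF t])
qed

lemma E_ser_vclass_refine:
  assumes "mult_of N \<alpha>" "\<tau> \<in> uhp"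
  shows "fps_nth (E_ser (vclass \<alpha> v) \<tau>) i = (\<Sum>B\<in>vclass (of_nat N) ` vclass \<alpha> v. fps_nth (E_ser B \<tau>) i)"
  using phi_vclass_refine[OF assms(1) _ assms(2), of "i + 1" v] by (simp add: E_ser_nth sum_distrib_left)

definition colv :: "2 \<Rightarrow> rat^2^2 \<Rightarrow> rat^2" where
  "colv j u = (\<chi> i. u $ i $ j)"

lemma fst_col_eq: "fst_col U = colv 1 ` U"
proof -
  have "u *v vector [1, 0] = colv 1 u" for u :: "rat^2^2"
    by (simp add: colv_def vec_eq_iff matrix_vector_mult_def sum_2)
  then show ?thesis by (simp add: fst_col_def)
qed

lemma snd_col_eq: "snd_col U = colv 2 ` U"
proof -
  have "u *v vector [0, 1] = colv 2 u" for u :: "rat^2^2"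
    by (simp add: colv_def vec_eq_iff matrix_vector_mult_def sum_2)
  then show ?thesis by (simp add: snd_col_def)
qed

text \<open>The scaling depends on the column only, so a box is the product of its two column
  cosets. This links additivity over matrices with additivity in each factor.\<close>

lemma mbox_colv: "mbox \<alpha> g = {u. colv 1 u \<in> vclass (\<alpha> 1) (colv 1 g) \<and> colv 2 u \<in> vclass (\<alpha> 2) (colv 2 g)}"
  by (auto simp: mbox_def vclass_def colv_def forall_2)

lemma ex_colv: "\<exists>u. colv 1 u = x \<and> colv 2 u = y"
proof -
  have "colv 1 (\<chi> i. vector [x $ i, y $ i]) = x" "colv 2 (\<chi> i. vector [x $ i, y $ i]) = y"
    by (simp_all add: colv_def vec_eq_iff)
  then show ?thesis by blast
qed

lemma colv_mbox: "colv 1 ` mbox \<alpha> g = vclass (\<alpha> 1) (colv 1 g)" "colv 2 ` mbox \<alpha> g = vclass (\<alpha> 2) (colv 2 g)"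
proof -
  have "x \<in> colv 1 ` mbox \<alpha> g" if x: "x \<in> vclass (\<alpha> 1) (colv 1 g)" for x
  proof -
    obtain u where u: "colv 1 u = x" "colv 2 u = colv 2 g" using ex_colv by blast
    then have "u \<in> mbox \<alpha> g" unfolding mbox_colv using x vclass_self by simp
    then show ?thesis using u(1) by blast
  qed
  moreover have "x \<in> colv 2 ` mbox \<alpha> g" if x: "x \<in> vclass (\<alpha> 2) (colv 2 g)" for x
  proof -
    obtain u where u: "colv 1 u = colv 1 g" "colv 2 u = x" using ex_colv by blast
    then have "u \<in> mbox \<alpha> g" unfolding mbox_colv using x vclass_self by simp
    then show ?thesis using u(2) by blast
  qed
  ultimately show "colv 1 ` mbox \<alpha> g = vclass (\<alpha> 1) (colv 1 g)" "colv 2 ` mbox \<alpha> g = vclass (\<alpha> 2) (colv 2 g)"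
    unfolding mbox_colv by blast+
qed

definition eis_prod :: "(rat^2^2) set \<Rightarrow> mf_series" where
  "eis_prod C = (\<lambda>i j. on_uhp (\<lambda>\<tau>. fps_nth (E_ser (fst_col C) \<tau>) i * fps_nth (E_ser (snd_col C) \<tau>) j))"

lemma mu_eq: "mu H U = cusp_class (proj_series H (eis_prod U))"
  by (simp add: mu_def proj_series_def eis_prod_def)

lemma gform_eis_prod:
  assumes "\<And>j. \<alpha> j \<noteq> 0"
  shows "gform (eis_prod (mbox \<alpha> g))"
proof -
  have "basic_vec (fst_col (mbox \<alpha> g))" "basic_vec (snd_col (mbox \<alpha> g))"
    unfolding fst_col_eq snd_col_eq colv_mbox basic_vec_iff using assms by blast+
  then show ?thesis unfolding gform_def eis_prod_def by (rule ex_nform_E_ser_mult)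
qed

text \<open>The classes modulo N inside a box correspond to pairs of column classes. Multiplying the
  distribution relations of the two columns and expanding therefore gives one term for each
  class.\<close>

lemma eis_prod_refine:
  assumes N: "\<And>j. mult_of N (\<alpha> j)"
  shows "eis_prod (mbox \<alpha> g) i j \<tau> = (\<Sum>C\<in>mclass N ` mbox \<alpha> g. eis_prod C i j \<tau>)"
proof (cases "\<tau> \<in> uhp")
  case t: True
  let ?V = "vclass (\<alpha> 1) (colv 1 g)" and ?W = "vclass (\<alpha> 2) (colv 2 g)"
  let ?I = "vclass (of_nat N) ` ?V" and ?J = "vclass (of_nat N) ` ?W"
  define e where "e = (\<lambda>B k. fps_nth (E_ser B \<tau>) k)"
  have "eis_prod (mbox \<alpha> g) i j \<tau> = e ?V i * e ?W j"
    using t by (simp add: eis_prod_def on_uhp_def fst_col_eq snd_col_eq colv_mbox e_def)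
  also have "\<dots> = (\<Sum>B\<in>?I. e B i) * (\<Sum>B\<in>?J. e B j)"
    unfolding e_def E_ser_vclass_refine[OF N t, symmetric] ..
  also have "\<dots> = (\<Sum>(B, B')\<in>?I \<times> ?J. e B i * e B' j)"
    by (simp add: sum_product sum.cartesian_product)
  also have "\<dots> = (\<Sum>C\<in>mclass N ` mbox \<alpha> g. eis_prod C i j \<tau>)"
  \<comment> \<open>Passing to column sets and forming the product of column sets are inverse to
    each other on boxes.\<close>
  proof (rule sum.reindex_bij_witness[where i = "\<lambda>C. (colv 1 ` C, colv 2 ` C)"
        and j = "\<lambda>(B, B'). {u. colv 1 u \<in> B \<and> colv 2 u \<in> B'}"])
    fix P assume "P \<in> ?I \<times> ?J"
    then obtain x y where P: "P = (vclass (of_nat N) x, vclass (of_nat N) y)" and xy: "x \<in> ?V" "y \<in> ?W" by blast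
    obtain u where u: "colv 1 u = x" "colv 2 u = y" using ex_colv by blast
    have C: "(case P of (B, B') \<Rightarrow> {u. colv 1 u \<in> B \<and> colv 2 u \<in> B'}) = mclass N u"
      by (simp add: P mbox_colv u)
    have "u \<in> mbox \<alpha> g" using xy u by (simp add: mbox_colv)
    then show "(case P of (B, B') \<Rightarrow> {u. colv 1 u \<in> B \<and> colv 2 u \<in> B'}) \<in> mclass N ` mbox \<alpha> g" unfolding C by blast
    show "(colv 1 ` (case P of (B, B') \<Rightarrow> {u. colv 1 u \<in> B \<and> colv 2 u \<in> B'}),
        colv 2 ` (case P of (B, B') \<Rightarrow> {u. colv 1 u \<in> B \<and> colv 2 u \<in> B'})) = P"
      unfolding C by (simp add: colv_mbox P u)
    show "eis_prod (case P of (B, B') \<Rightarrow> {u. colv 1 u \<in> B \<and> colv 2 u \<in> B'}) i j \<tau> = (case P of (B, B') \<Rightarrow> e B i * e B' j)"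
      unfolding C using t by (simp add: eis_prod_def on_uhp_def fst_col_eq snd_col_eq colv_mbox e_def P u)
  next
    fix C assume "C \<in> mclass N ` mbox \<alpha> g"
    then obtain u where C: "C = mclass N u" and u: "u \<in> mbox \<alpha> g" by blast
    show "(colv 1 ` C, colv 2 ` C) \<in> ?I \<times> ?J" using u unfolding C colv_mbox by (simp add: mbox_colv)
    show "(case (colv 1 ` C, colv 2 ` C) of (B, B') \<Rightarrow> {u. colv 1 u \<in> B \<and> colv 2 u \<in> B'}) = C"
      unfolding C colv_mbox by (simp add: mbox_colv)
  qed
  finally show ?thesis .
qed (simp add: eis_prod_def on_uhp_def)

text \<open>Each class modulo N is itself a box and is refined into classes modulo M. The index set
  modulo M is the disjoint union of these pieces, since a class modulo M lies in one class modulo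
  N.\<close>

lemma eis_prod_level_indep:
  assumes A: "adapted N A" and d: "N dvd M" and M: "M > 0"
  shows "(\<Sum>C\<in>mclass N ` A. eis_prod C i j \<tau>) = (\<Sum>C\<in>mclass M ` A. eis_prod C i j \<tau>)"
proof -
  have AM: "adapted M A" by (rule adapted_dvd[OF A d M])
  have m: "mult_of M (of_nat N)" by (rule mult_of_nat[OF d M])
  have sub: "C \<subseteq> A" if "C \<in> mclass N ` A" for C using adapted_periodic[OF A] that by blast
  have cov: "mclass M ` A = (\<Union>C\<in>mclass N ` A. mclass M ` C)"
  proof -
    have "mclass M ` A = mclass M ` (\<Union>(mclass N ` A))" by (simp only: adapted_Union[OF A])
    then show ?thesis by (simp only: image_Union image_image)
  qed
  have disj: "mclass M ` C \<inter> mclass M ` C' = {}" if C: "C \<in> mclass N ` A" "C' \<in> mclass N ` A" "C \<noteq> C'" for C C'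
  proof (rule ccontr)
    assume "mclass M ` C \<inter> mclass M ` C' \<noteq> {}"
    then obtain x y where xy: "x \<in> C" "y \<in> C'" "mclass M x = mclass M y" by auto
    obtain b where b: "C' = mclass N b" using C(2) by auto
    have "x \<in> mclass M y" unfolding xy(3)[symmetric] by (rule mbox_self)
    then have "x \<in> C'" using mclass_subset[of M "\<lambda>_. of_nat N" y b, OF m] xy(2) unfolding b by auto
    then show False using xy(1) mclass_disjoint[OF C] by auto
  qed
  have fin: "finite (mclass M ` C)" if "C \<in> mclass N ` A" for C
    using adapted_finite[OF AM] finite_subset[OF image_mono[OF sub[OF that]]] by simp
  have "(\<Sum>C\<in>mclass M ` A. eis_prod C i j \<tau>) = (\<Sum>C\<in>mclass N ` A. \<Sum>C'\<in>mclass M ` C. eis_prod C' i j \<tau>)"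
    unfolding cov using adapted_finite[OF A] fin disj by (intro sum.UNION_disjoint) auto
  also have "\<dots> = (\<Sum>C\<in>mclass N ` A. eis_prod C i j \<tau>)"
    by (intro sum.cong refl) (use eis_prod_refine[of M "\<lambda>_. of_nat N", OF m] in auto)
  finally show ?thesis by simp
qed

text \<open>\<open>eis_prod\<close> sees only the column sets, which determine a box but not a
  general compact open set. So the extension is a sum over classes, and its independence of the
  level makes the choice harmless.\<close>

definition eis_meas :: "(rat^2^2) set \<Rightarrow> mf_series" where
  "eis_meas A = (\<lambda>i j \<tau>. \<Sum>C\<in>mclass (SOME N. adapted N A) ` A. eis_prod C i j \<tau>)"

lemma eis_meas_eq:
  assumes "adapted N A"
  shows "eis_meas A i j \<tau> = (\<Sum>C\<in>mclass N ` A. eis_prod C i j \<tau>)"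
proof -
  define M where "M = (SOME N. adapted N A)"
  have M: "adapted M A" unfolding M_def by (rule someI[of _ N]) (rule assms)
  have pos: "N > 0" "M > 0" using assms M by (auto simp: adapted_def)
  have "(\<Sum>C\<in>mclass N ` A. eis_prod C i j \<tau>) = (\<Sum>C\<in>mclass (N * M) ` A. eis_prod C i j \<tau>)"
    by (rule eis_prod_level_indep[OF assms]) (use pos in auto)
  also have "\<dots> = (\<Sum>C\<in>mclass M ` A. eis_prod C i j \<tau>)"
    by (rule eis_prod_level_indep[OF M, symmetric]) (use pos in auto)
  finally show ?thesis by (simp add: eis_meas_def M_def)
qed

lemma eis_meas_mbox:
  assumes "\<And>j. \<alpha> j \<noteq> 0"
  shows "eis_meas (mbox \<alpha> g) = eis_prod (mbox \<alpha> g)"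
proof -
  obtain N where N: "\<And>j. mult_of N (\<alpha> j)" "adapted N (mbox \<alpha> g)" using ex_adapted_mbox[of \<alpha> g, OF assms] by blast
  show ?thesis by (intro ext) (simp add: eis_meas_eq[OF N(2)] eis_prod_refine[OF N(1)])
qed

lemma common_adapted:
  assumes "compact_open_mat A" "compact_open_mat B"
  obtains N where "adapted N A" "adapted N B"
proof -
  obtain N M where N: "adapted N A" and M: "adapted M B" using compact_open_adapted assms by metis
  have pos: "N > 0" "M > 0" using N M by (auto simp: adapted_def)
  show thesis by (rule that[of "N * M"]; rule adapted_dvd[OF N] adapted_dvd[OF M]) (use pos in auto)
qed

lemma eis_meas_Un:
  assumes "compact_open_mat A" "compact_open_mat B" "A \<inter> B = {}"
  shows "eis_meas (A \<union> B) = (\<lambda>i j \<tau>. eis_meas A i j \<tau> + eis_meas B i j \<tau>)"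
proof -
  obtain N where N: "adapted N A" "adapted N B" using common_adapted[OF assms(1,2)] by blast
  have "mclass N ` A \<inter> mclass N ` B = {}"
  proof (rule ccontr)
    assume "mclass N ` A \<inter> mclass N ` B \<noteq> {}"
    then obtain x y where "x \<in> A" "y \<in> B" "mclass N x = mclass N y" by blast
    then have "x \<in> B" using adapted_periodic[OF N(2)] mbox_self by blast
    then show False using \<open>x \<in> A\<close> assms(3) by blast
  qed
  then show ?thesis
    by (intro ext) (simp add: eis_meas_eq[OF N(1)] eis_meas_eq[OF N(2)] eis_meas_eq[OF adapted_Un[OF N]] image_Un
        sum.union_disjoint adapted_finite N)
qed

lemma eis_meas_empty: "eis_meas {} = (\<lambda>i j \<tau>. 0)"
  by (simp add: eis_meas_def)

lemma gform_eis_meas: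
  assumes "compact_open_mat A"
  shows "gform (eis_meas A)"
proof -
  obtain N where N: "adapted N A" using compact_open_adapted[OF assms] by blast
  have "gform (eis_prod C)" if "C \<in> mclass N ` A" for C
    using that gform_eis_prod[of "\<lambda>_. of_nat N"] N by (auto simp: adapted_def)
  from gform_sum[OF adapted_finite[OF N] this]
  show ?thesis by (simp add: eis_meas_eq[OF N, abs_def])
qed

section \<open>Homogeneity under scaling\<close>

lemma E_ser_scale:
  assumes V: "basic_vec V" and a: "a \<noteq> 0" and t: "\<tau> \<in> uhp"
  shows "fps_nth (E_ser ((\<lambda>x. a *s x) ` V) \<tau>) i = fps_nth (E_ser V \<tau>) i / of_rat a ^ (i + 1)"
proof -
  obtain c where c: "has_phi (i + 1) V \<tau> c" using basic_vec_phi[OF V, of "i + 1"] t by (metis le_add2)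
  have inv: "(\<lambda>x. inverse a *s x) ` (\<lambda>x. a *s x) ` V = V"
    using a by (simp add: image_image vector_smult_assoc)
  have "has_phi (i + 1) ((\<lambda>x. a *s x) ` V) \<tau> (c / of_rat a ^ (i + 1))"
  proof (rule has_phi_transfer[where g = "\<lambda>x. inverse a *s x"])
    show "has_phi (i + 1) ((\<lambda>x. inverse a *s x) ` (\<lambda>x. a *s x) ` V) \<tau> c" unfolding inv by (rule c)
    show "inj_on (\<lambda>x. inverse a *s x) ((\<lambda>x. a *s x) ` V)" using a by (auto simp: inj_on_def vec2_eq_iff)
    show "vpt \<tau> x = of_rat a * vpt \<tau> (inverse a *s x)" for x by (rule vpt_smult_inverse[OF a])
    show "(of_rat a :: complex) \<noteq> 0" using a by simp
  qed
  then show ?thesis using has_phi_imp_phi_eq[OF t c] has_phi_imp_phi_eq[OF t] by (simp add: E_ser_nth)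
qed


section \<open>The distribution\<close>

lemma compact_open_Un: "compact_open_mat A \<Longrightarrow> compact_open_mat B \<Longrightarrow> compact_open_mat (A \<union> B)"
  by (metis common_adapted adapted_Un adapted_compact_open)

lemma compact_open_empty: "compact_open_mat {}"
  unfolding compact_open_mat_def by (intro exI[of _ "{}"]) simp

lemma compact_open_UN:
  assumes "finite I" "\<And>k. k \<in> I \<Longrightarrow> compact_open_mat (W k)"
  shows "compact_open_mat (\<Union>k\<in>I. W k)"
  using assms by (induction rule: finite_induct) (simp_all add: compact_open_empty compact_open_Un)

lemma compact_open_mbox: "(\<And>j. \<alpha> j \<noteq> 0) \<Longrightarrow> compact_open_mat (mbox \<alpha> g)"
  using ex_adapted_mbox adapted_compact_open by blast

lemma compact_open_basic: "basic_mat U \<Longrightarrow> compact_open_mat U"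
  unfolding compact_open_mat_def by (intro exI[of _ "{U}"]) simp

lemma disjoint_family_insert_Int:
  assumes "disjoint_family_on W (insert x F)" "x \<notin> F"
  shows "W x \<inter> (\<Union>k\<in>F. W k) = {}"
  using assms by (auto simp: disjoint_family_on_def)

lemma eis_meas_UN:
  assumes "finite I" "\<And>k. k \<in> I \<Longrightarrow> compact_open_mat (W k)" "disjoint_family_on W I"
  shows "eis_meas (\<Union>k\<in>I. W k) = (\<lambda>i j \<tau>. \<Sum>k\<in>I. eis_meas (W k) i j \<tau>)"
  using assms
proof (induction rule: finite_induct)
  case empty
  show ?case by (simp add: eis_meas_empty)
next
  case (insert x F)
  have d: "disjoint_family_on W F" using insert.prems(2) by (rule disjoint_family_on_mono[rotated]) auto
  have "eis_meas (W x \<union> (\<Union>k\<in>F. W k)) = (\<lambda>i j \<tau>. eis_meas (W x) i j \<tau> + eis_meas (\<Union>k\<in>F. W k) i j \<tau>)"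
    using insert disjoint_family_insert_Int[OF insert.prems(2) insert.hyps(2)]
    by (intro eis_meas_Un compact_open_UN) auto
  then show ?case using insert d by simp
qed

section \<open>Finitely additive functions on compact open sets\<close>

lemma D_naive_carrier: "\<nu> \<in> D_naive G \<Longrightarrow> compact_open_mat A \<Longrightarrow> \<nu> A \<in> carrier G"
  unfolding D_naive_def by (auto simp: PiE_def)

lemma D_naive_UN:
  assumes G: "comm_group G" and \<nu>: "\<nu> \<in> D_naive G" and "finite I" "\<And>k. k \<in> I \<Longrightarrow> compact_open_mat (W k)" "disjoint_family_on W I"
  shows "\<nu> (\<Union>k\<in>I. W k) = finprod G (\<lambda>k. \<nu> (W k)) I"
proof -
  interpret comm_group G by (rule G)
  note cl = D_naive_carrier[OF \<nu>]
  have add: "\<nu> (A \<union> B) = \<nu> A \<otimes>\<^bsub>G\<^esub> \<nu> B" if "compact_open_mat A" "compact_open_mat B" "A \<inter> B = {}" for A B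
    using \<nu> that unfolding D_naive_def by blast
  \<comment> \<open>The empty set is disjoint from itself, so its value is idempotent and hence
    trivial in a group.\<close>
  have emp: "\<nu> {} = \<one>\<^bsub>G\<^esub>"
    using add[OF compact_open_empty compact_open_empty] cl[OF compact_open_empty] by (simp add: l_cancel_one')
  from assms(3-) show ?thesis
  proof (induction rule: finite_induct)
    case empty
    show ?case by (simp add: emp)
  next
    case (insert x F)
    have d: "disjoint_family_on W F" using insert.prems(2) by (rule disjoint_family_on_mono[rotated]) auto
    have "\<nu> (W x \<union> (\<Union>k\<in>F. W k)) = \<nu> (W x) \<otimes>\<^bsub>G\<^esub> \<nu> (\<Union>k\<in>F. W k)"
      using insert disjoint_family_insert_Int[OF insert.prems(2) insert.hyps(2)] by (intro add compact_open_UN) auto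
    also have "\<nu> (\<Union>k\<in>F. W k) = finprod G (\<lambda>k. \<nu> (W k)) F" using insert d by auto
    also have "\<nu> (W x) \<otimes>\<^bsub>G\<^esub> finprod G (\<lambda>k. \<nu> (W k)) F = finprod G (\<lambda>k. \<nu> (W k)) (insert x F)"
      using insert cl by (subst finprod_insert) auto
    finally show ?case by simp
  qed
qed

text \<open>A compact open set is a finite disjoint union of classes modulo N, which are basic, so
  its value is a product of values on basic sets. On all other sets both functions are undefined by
  extensionality.\<close>

lemma D_naive_eqI:
  assumes G: "comm_group G" and \<nu>: "\<nu> \<in> D_naive G" "\<nu>' \<in> D_naive G"
    and eq: "\<And>U. basic_mat U \<Longrightarrow> \<nu> U = \<nu>' U"
  shows "\<nu> = \<nu>'"
proof
  fix A
  interpret comm_group G by (rule G)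
  show "\<nu> A = \<nu>' A"
  proof (cases "compact_open_mat A")
    case True
    obtain N where N: "adapted N A" using compact_open_adapted[OF True] by blast
    have b: "basic_mat C" if "C \<in> mclass N ` A" for C
      using that N basic_mat_mclass by (auto simp: adapted_def)
    have d: "disjoint_family_on (\<lambda>C. C) (mclass N ` A)"
      unfolding disjoint_family_on_def using mclass_disjoint by blast
    have "\<mu> A = finprod G \<mu> (mclass N ` A)" if "\<mu> \<in> D_naive G" for \<mu>
      using D_naive_UN[OF G that adapted_finite[OF N] _ d] b compact_open_basic adapted_Union[OF N] by simp
    moreover have "finprod G \<nu> (mclass N ` A) = finprod G \<nu>' (mclass N ` A)"
    proof (rule finprod_cong')
      show "\<nu>' \<in> mclass N ` A \<rightarrow> carrier G"
        using D_naive_carrier[OF \<nu>(2) compact_open_basic] b by auto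
    qed (use eq b in auto)
    ultimately show ?thesis using \<nu> by simp
  next
    case False
    then show ?thesis using \<nu> unfolding D_naive_def by (auto simp: PiE_def extensional_def)
  qed
qed

section \<open>The action of diagonal matrices\<close>

definition scale_series :: "(nat \<Rightarrow> nat \<Rightarrow> complex) \<Rightarrow> mf_series \<Rightarrow> mf_series" where
  "scale_series c h = (\<lambda>i j \<tau>. c i j * h i j \<tau>)"

text \<open>The Eisenstein part is stable under multiplying the coefficients by scalars and by their
  inverses, hence is mapped onto itself, and cosets go to full cosets.\<close>

lemma scale_series_cusp_class:
  assumes c: "\<And>i j. c i j \<noteq> 0"
  shows "scale_series c ` cusp_class h = cusp_class (scale_series c h)"
proof -
  have E: "scale_series c ` E2_tilde = E2_tilde"
  proof (intro equalityI subsetI)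
    fix e assume e: "e \<in> E2_tilde"
    have "scale_series c (scale_series (\<lambda>i j. inverse (c i j)) e) = e"
      using c by (simp add: scale_series_def fun_eq_iff)
    moreover have "scale_series (\<lambda>i j. inverse (c i j)) e \<in> E2_tilde"
      using E2_tilde_cmult[OF e] by (simp add: scale_series_def)
    ultimately show "e \<in> scale_series c ` E2_tilde" by (metis imageI)
  qed (auto simp: scale_series_def intro: E2_tilde_cmult)
  have "scale_series c (e \<otimes>\<^bsub>M2_tilde\<^esub> h) = scale_series c e \<otimes>\<^bsub>M2_tilde\<^esub> scale_series c h" for e
    by (simp add: scale_series_def M2_tilde_def distrib_left)
  then have "scale_series c ` cusp_class h = (\<Union>e\<in>E2_tilde. {scale_series c e \<otimes>\<^bsub>M2_tilde\<^esub> scale_series c h})"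
    by (simp add: r_coset_def image_UN)
  also have "\<dots> = (\<Union>e\<in>scale_series c ` E2_tilde. {e \<otimes>\<^bsub>M2_tilde\<^esub> scale_series c h})" by simp
  finally show ?thesis by (simp add: E r_coset_def)
qed

text \<open>For \<rho> = diag (a, d) the determinant contributes a d and the substitution
  contributes a^i d^j, whence the exponents i + 1 and j + 1.\<close>

definition diag_char :: "rat^2^2 \<Rightarrow> nat \<Rightarrow> nat \<Rightarrow> complex" where
  "diag_char \<rho> i j = of_rat (\<rho> $ 1 $ 1) ^ (i + 1) * of_rat (\<rho> $ 2 $ 2) ^ (j + 1)"

text \<open>The two linear forms degenerate to a X and d Y. Their powers are monomials, so in the
  coefficient of X^i Y^j only the index p = i contributes.\<close>

lemma gl_series_diag:
  fixes \<rho> :: "rat^2^2"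
  assumes "\<rho> $ 1 $ 2 = 0" "\<rho> $ 2 $ 1 = 0"
  shows "gl_series \<rho> = scale_series (diag_char \<rho>)"
proof (intro ext)
  fix h :: mf_series and i j \<tau>
  define a d :: complex where "a = of_rat (\<rho> $ 1 $ 1)" and "d = of_rat (\<rho> $ 2 $ 2)"
  have P: "[:[:0, a:], [:0:]:] ^ p = [:monom (a ^ p) p:]" for p
    by (induction p) (simp_all add: monom_Suc monom_0 one_pCons mult_monom[of a 1, simplified] monom_altdef ac_simps)
  have Q: "[:[:0, 0:], [:d:]:] ^ q = monom [:d ^ q:] q" for q
  proof -
    have "[:[:0, 0:], [:d:]:] = monom [:d:] 1" by (simp add: monom_Suc monom_0)
    then show ?thesis by (simp add: monom_power poly_const_pow)
  qed
  have "coeff (coeff ([:[:0, a:], [:0:]:] ^ p * [:[:0, 0:], [:d:]:] ^ (i + j - p)) j) i = (if p = i then a ^ i * d ^ j else 0)"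
    if "p \<le> i + j" for p
    unfolding P Q using that by (auto simp: coeff_monom smult_monom)
  then have "(\<Sum>p\<le>i + j. coeff (coeff ([:[:0, a:], [:0:]:] ^ p * [:[:0, 0:], [:d:]:] ^ (i + j - p)) j) i * h p (i + j - p) \<tau>)
      = (\<Sum>p\<le>i + j. if p = i then a ^ i * d ^ j * h i j \<tau> else 0)"
    by (intro sum.cong) auto
  also have "\<dots> = a ^ i * d ^ j * h i j \<tau>" by (simp add: sum.delta)
  finally have "(\<Sum>p\<le>i + j. coeff (coeff ([:[:0, a:], [:0:]:] ^ p * [:[:0, 0:], [:d:]:] ^ (i + j - p)) j) i * h p (i + j - p) \<tau>)
     = a ^ i * d ^ j * h i j \<tau>" .
  moreover have "of_rat (det \<rho>) = a * d" using assms by (simp add: det_2 a_def d_def of_rat_mult)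
  ultimately show "gl_series \<rho> h i j \<tau> = scale_series (diag_char \<rho>) h i j \<tau>"
    using assms by (simp add: gl_series_def scale_series_def diag_char_def a_def d_def)
qed

lemma diag_mult_nth:
  fixes \<rho> u :: "rat^2^2"
  assumes "\<rho> $ 1 $ 2 = 0" "\<rho> $ 2 $ 1 = 0"
  shows "(u ** \<rho>) $ i $ j = \<rho> $ j $ j * u $ i $ j"
  using exhaust_2[of j] assms by (auto simp: matrix_matrix_mult_def sum_2)

lemma mbox_diag:
  fixes \<rho> :: "rat^2^2"
  assumes \<rho>: "\<rho> $ 1 $ 2 = 0" "\<rho> $ 2 $ 1 = 0" and nz: "\<And>j. \<rho> $ j $ j \<noteq> 0"
  shows "(\<lambda>u. u ** \<rho>) ` mbox \<alpha> g = mbox (\<lambda>j. \<rho> $ j $ j * \<alpha> j) (g ** \<rho>)"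
proof (intro equalityI subsetI)
  fix u assume "u \<in> (\<lambda>u. u ** \<rho>) ` mbox \<alpha> g"
  then obtain w where w: "w \<in> mbox \<alpha> g" "u = w ** \<rho>" by blast
  have "req (\<rho> $ j $ j * \<alpha> j) (u $ i $ j) ((g ** \<rho>) $ i $ j)" for i j
  proof -
    obtain k where "w $ i $ j = g $ i $ j + \<alpha> j * of_int k" using w(1) unfolding mbox_def req_def by blast
    then show ?thesis unfolding req_def w(2) diag_mult_nth[OF \<rho>] by (intro exI[of _ k]) (simp add: algebra_simps)
  qed
  then show "u \<in> mbox (\<lambda>j. \<rho> $ j $ j * \<alpha> j) (g ** \<rho>)" by (simp add: mbox_def)
next
  fix u assume u: "u \<in> mbox (\<lambda>j. \<rho> $ j $ j * \<alpha> j) (g ** \<rho>)"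
  define w :: "rat^2^2" where "w = (\<chi> i j. u $ i $ j / \<rho> $ j $ j)"
  have "u = w ** \<rho>" by (simp add: vec_eq_iff diag_mult_nth[OF \<rho>] w_def nz)
  moreover have "req (\<alpha> j) (w $ i $ j) (g $ i $ j)" for i j
  proof -
    obtain k where "u $ i $ j = \<rho> $ j $ j * g $ i $ j + \<rho> $ j $ j * \<alpha> j * of_int k"
      using u unfolding mbox_def req_def diag_mult_nth[OF \<rho>] by blast
    then have "w $ i $ j = g $ i $ j + \<alpha> j * of_int k" using nz[of j] by (simp add: w_def field_simps)
    then show ?thesis unfolding req_def by blast
  qed
  then have "w \<in> mbox \<alpha> g" by (simp add: mbox_def)
  ultimately show "u \<in> (\<lambda>u. u ** \<rho>) ` mbox \<alpha> g" by (rule image_eqI)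
qed

lemma colv_diag:
  fixes \<rho> :: "rat^2^2"
  assumes "\<rho> $ 1 $ 2 = 0" "\<rho> $ 2 $ 1 = 0"
  shows "colv j ` (\<lambda>u. u ** \<rho>) ` C = (\<lambda>x. \<rho> $ j $ j *s x) ` colv j ` C"
proof -
  have "colv j (u ** \<rho>) = \<rho> $ j $ j *s colv j u" for u
    by (simp add: colv_def vec_eq_iff diag_mult_nth[OF assms])
  then show ?thesis by (simp add: image_image)
qed

text \<open>Scaling the columns by a and d multiplies the coefficients by a^(-i-1) and d^(-j-1). The
  weights i + 1 and j + 1 already account for the determinant, so this is exactly the inverse of
  \<open>diag_char\<close>.\<close>

lemma eis_prod_diag:
  fixes \<rho> :: "rat^2^2"
  assumes \<rho>: "\<rho> $ 1 $ 2 = 0" "\<rho> $ 2 $ 1 = 0" and nz: "\<And>j. \<rho> $ j $ j \<noteq> 0" and \<alpha>: "\<And>j. \<alpha> j \<noteq> 0"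
  shows "eis_prod ((\<lambda>u. u ** \<rho>) ` mbox \<alpha> g) i j \<tau> =
    inverse (diag_char \<rho> i j) * eis_prod (mbox \<alpha> g) i j \<tau>"
proof (cases "\<tau> \<in> uhp")
  case True
  have b: "basic_vec (colv 1 ` mbox \<alpha> g)" "basic_vec (colv 2 ` mbox \<alpha> g)"
    unfolding colv_mbox basic_vec_iff using \<alpha> by blast+
  show ?thesis
    using True E_ser_scale[OF b(1) nz[of 1] True, of i] E_ser_scale[OF b(2) nz[of 2] True, of j]
    by (simp add: eis_prod_def on_uhp_def fst_col_eq snd_col_eq colv_diag[OF \<rho>] divide_inverse diag_char_def)
qed (simp add: eis_prod_def on_uhp_def)

text \<open>The pieces of A modulo N are carried to boxes whose columns may have different scalings.
  They are in general not basic, but \<open>eis_meas_mbox\<close> evaluates them directly.\<close>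

lemma
  fixes \<rho> :: "rat^2^2"
  assumes \<rho>: "\<rho> $ 1 $ 2 = 0" "\<rho> $ 2 $ 1 = 0" and nz: "\<And>j. \<rho> $ j $ j \<noteq> 0" and A: "compact_open_mat A"
  shows compact_open_diag: "compact_open_mat ((\<lambda>u. u ** \<rho>) ` A)"
    and eis_meas_diag: "eis_meas ((\<lambda>u. u ** \<rho>) ` A) =
      scale_series (\<lambda>i j. inverse (diag_char \<rho> i j)) (eis_meas A)"
proof -
  let ?S = "\<lambda>u::rat^2^2. u ** \<rho>"
  obtain N where N: "adapted N A" using compact_open_adapted[OF A] by blast
  let ?I = "mclass N ` A"
  have N0: "(of_nat N :: rat) \<noteq> 0" using N by (simp add: adapted_def)
  have inj: "inj ?S"
  proof (rule injI)
    fix x y :: "rat^2^2" assume xy: "x ** \<rho> = y ** \<rho>"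
    have "\<rho> $ j $ j * x $ i $ j = \<rho> $ j $ j * y $ i $ j" for i j
      unfolding diag_mult_nth[OF \<rho>, symmetric] xy ..
    then show "x = y" using nz by (simp add: vec_eq_iff)
  qed
  have fin: "finite ?I" by (rule adapted_finite[OF N])
  have img: "?S ` A = (\<Union>C\<in>?I. ?S ` C)"
    using adapted_Union[OF N] by (metis image_Union)
  have nz': "\<rho> $ j $ j * of_nat N \<noteq> 0" for j using nz N0 by simp
  have box: "\<exists>g. ?S ` C = mbox (\<lambda>j. \<rho> $ j $ j * of_nat N) g" if "C \<in> ?I" for C
    using that mbox_diag[OF \<rho> nz, of "\<lambda>_. of_nat N"] by blast
  have co: "compact_open_mat (?S ` C)" if "C \<in> ?I" for C
    using box[OF that] compact_open_mbox[of "\<lambda>j. \<rho> $ j $ j * of_nat N", OF nz'] by auto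
  have disj: "disjoint_family_on (\<lambda>C. ?S ` C) ?I"
    unfolding disjoint_family_on_def
  proof (intro ballI impI)
    fix C C' assume "C \<in> ?I" "C' \<in> ?I" "C \<noteq> C'"
    then have "C \<inter> C' = {}" by (rule mclass_disjoint)
    then show "?S ` C \<inter> ?S ` C' = {}" using image_Int[OF inj, of C C'] by simp
  qed
  show "compact_open_mat (?S ` A)" unfolding img using fin co by (rule compact_open_UN)
  have pr: "eis_meas (?S ` C) = eis_prod (?S ` C)" if "C \<in> ?I" for C
    using box[OF that] eis_meas_mbox[of "\<lambda>j. \<rho> $ j $ j * of_nat N", OF nz'] by auto
  have sc: "eis_prod (?S ` C) i j \<tau> =
    inverse (diag_char \<rho> i j) * eis_prod C i j \<tau>" if "C \<in> ?I" for C i j \<tau>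
    using that eis_prod_diag[OF \<rho> nz, of "\<lambda>_. of_nat N"] N0 by blast
  show "eis_meas (?S ` A) =
      scale_series (\<lambda>i j. inverse (diag_char \<rho> i j)) (eis_meas A)"
  proof (intro ext)
    fix i j \<tau>
    have "eis_meas (?S ` A) i j \<tau> = (\<Sum>C\<in>?I. eis_meas (?S ` C) i j \<tau>)"
      unfolding img using fun_cong[OF fun_cong[OF fun_cong[OF eis_meas_UN[OF fin co disj]]]] .
    also have "\<dots> = (\<Sum>C\<in>?I. inverse (diag_char \<rho> i j) * eis_prod C i j \<tau>)"
      by (intro sum.cong refl) (simp only: pr sc)
    finally show "eis_meas (?S ` A) i j \<tau> = scale_series (\<lambda>i j. inverse (diag_char \<rho> i j)) (eis_meas A) i j \<tau>"
      by (simp add: scale_series_def eis_meas_eq[OF N] sum_distrib_left)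
  qed
qed

definition eis_dist :: "(nat \<Rightarrow> (complex \<Rightarrow> complex) \<Rightarrow> complex \<Rightarrow> complex) \<Rightarrow> (rat^2^2) set \<Rightarrow> mf_series set" where
  "eis_dist H = restrict (\<lambda>A. cusp_class (proj_series H (eis_meas A))) (Collect compact_open_mat)"

lemma eis_dist_D_naive:
  assumes "holomorphic_projection H"
  shows "eis_dist H \<in> D_naive S2_tilde"
  unfolding D_naive_def
proof (intro CollectI conjI allI impI)
  note c = proj_series_carrier[OF assms gform_eis_meas]
  show "eis_dist H \<in> Collect compact_open_mat \<rightarrow>\<^sub>E carrier S2_tilde"
    using c unfolding eis_dist_def carrier_S2_tilde by auto
  fix A B assume AB: "compact_open_mat A" "compact_open_mat B" "A \<inter> B = {}"
  show "eis_dist H (A \<union> B) = eis_dist H A \<otimes>\<^bsub>S2_tilde\<^esub> eis_dist H B"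
    using AB compact_open_Un[OF AB(1,2)]
    by (simp add: eis_dist_def eis_meas_Un proj_series_add[OF assms] gform_eis_meas cusp_class_mult c)
qed

lemma eis_dist_basic: "basic_mat U \<Longrightarrow> eis_dist H U = mu H U"
  using compact_open_basic[of U] eis_meas_mbox
  by (auto simp: eis_dist_def mu_eq basic_mat_iff)

lemma gl_act_eis_dist:
  fixes \<rho> :: "rat^2^2"
  assumes H: "holomorphic_projection H" and inv: "invertible \<rho>" and \<rho>: "\<rho> $ 1 $ 2 = 0" "\<rho> $ 2 $ 1 = 0"
  shows "gl_act \<rho> (eis_dist H) = eis_dist H"
proof
  fix A
  have "det \<rho> \<noteq> 0" using inv invertible_det_nz by blast
  then have "\<rho> $ 1 $ 1 \<noteq> 0" "\<rho> $ 2 $ 2 \<noteq> 0" using \<rho> by (auto simp: det_2)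
  then have nz: "\<rho> $ j $ j \<noteq> 0" for j using exhaust_2[of j] by auto
  let ?c = "diag_char \<rho>"
  have c0: "?c i j \<noteq> 0" for i j using nz by (simp add: diag_char_def)
  show "gl_act \<rho> (eis_dist H) A = eis_dist H A"
  proof (cases "compact_open_mat A")
    case True
    let ?B = "(\<lambda>u. u ** \<rho>) ` A"
    have B: "compact_open_mat ?B" by (rule compact_open_diag[OF \<rho> nz True])
    have "proj_series H (eis_meas ?B) = scale_series (\<lambda>i j. inverse (?c i j)) (proj_series H (eis_meas A))"
      unfolding eis_meas_diag[OF \<rho> nz True] scale_series_def
      by (rule proj_series_cmult[OF H gform_eis_meas[OF True]])
    \<comment> \<open>The factor produced by moving the set is inverse to the one produced by acting
      on the series, so equality holds between the series themselves.\<close>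
    then have "scale_series ?c (proj_series H (eis_meas ?B)) = proj_series H (eis_meas A)"
      using c0 by (simp add: scale_series_def fun_eq_iff flip: mult.assoc)
    moreover have "gl_act \<rho> (eis_dist H) A = scale_series ?c ` cusp_class (proj_series H (eis_meas ?B))"
      using True B by (simp add: gl_act_def eis_dist_def gl_series_diag[OF \<rho>])
    ultimately show ?thesis using True by (simp add: scale_series_cusp_class[OF c0] eis_dist_def)
  qed (simp add: gl_act_def eis_dist_def)
qed

theorem theorem6p2:
  fixes H :: "nat \<Rightarrow> (complex \<Rightarrow> complex) \<Rightarrow> complex \<Rightarrow> complex"
  assumes "holomorphic_projection H"
  shows "(\<forall>U (W :: nat \<Rightarrow> (rat^2^2) set) r.
            basic_mat U \<longrightarrow> (\<forall>k<r. basic_mat (W k)) \<longrightarrow> disjoint_family_on W {..<r} \<longrightarrow>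
            U = (\<Union>k<r. W k) \<longrightarrow> mu H U = finprod S2_tilde (\<lambda>k. mu H (W k)) {..<r})
       \<and> (\<exists>!\<nu>. \<nu> \<in> D_naive S2_tilde \<and> (\<forall>U. basic_mat U \<longrightarrow> \<nu> U = mu H U))
       \<and> (\<forall>\<nu>. \<nu> \<in> D_naive S2_tilde \<and> (\<forall>U. basic_mat U \<longrightarrow> \<nu> U = mu H U) \<longrightarrow>
            (\<forall>\<rho> :: rat^2^2. invertible \<rho> \<and> \<rho> $ 1 $ 2 = 0 \<and> \<rho> $ 2 $ 1 = 0 \<longrightarrow> gl_act \<rho> \<nu> = \<nu>))"
proof -
  note D = eis_dist_D_naive[OF assms]
  have uniq: "\<nu> = eis_dist H" if "\<nu> \<in> D_naive S2_tilde" "\<forall>U. basic_mat U \<longrightarrow> \<nu> U = mu H U" for \<nu>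
    by (rule D_naive_eqI[OF comm_group_S2_tilde that(1) D]) (use that(2) in \<open>simp add: eis_dist_basic\<close>)
  interpret S: comm_group S2_tilde by (rule comm_group_S2_tilde)
  \<comment> \<open>The relation between basic sets is read off from the distribution already
    constructed, of which \<open>mu\<close> is the restriction to basic sets.\<close>
  have additive: "mu H U = finprod S2_tilde (\<lambda>k. mu H (W k)) {..<r}"
    if U: "basic_mat U" and W: "\<forall>k<r. basic_mat (W k)" and d: "disjoint_family_on W {..<r}" and eq: "U = (\<Union>k<r. W k)"
    for U and W :: "nat \<Rightarrow> (rat^2^2) set" and r
  proof -
    have "mu H U = eis_dist H (\<Union>k<r. W k)" using eis_dist_basic[OF U] eq by simp
    also have "\<dots> = finprod S2_tilde (\<lambda>k. eis_dist H (W k)) {..<r}"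
      by (rule D_naive_UN[OF comm_group_S2_tilde D _ _ d]) (use W compact_open_basic in auto)
    also have "\<dots> = finprod S2_tilde (\<lambda>k. mu H (W k)) {..<r}"
    proof (rule S.finprod_cong')
      show "(\<lambda>k. mu H (W k)) \<in> {..<r} \<rightarrow> carrier S2_tilde"
      proof
        fix k assume "k \<in> {..<r}"
        then have "basic_mat (W k)" using W by simp
        then show "mu H (W k) \<in> carrier S2_tilde"
          using D_naive_carrier[OF D compact_open_basic] eis_dist_basic[of "W k" H] by metis
      qed
    qed (use W eis_dist_basic in auto)
    finally show ?thesis .
  qed
  have unique: "\<exists>!\<nu>. \<nu> \<in> D_naive S2_tilde \<and> (\<forall>U. basic_mat U \<longrightarrow> \<nu> U = mu H U)"
  proof (rule ex1I[of _ "eis_dist H"])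
    show "eis_dist H \<in> D_naive S2_tilde \<and> (\<forall>U. basic_mat U \<longrightarrow> eis_dist H U = mu H U)"
      using D eis_dist_basic by simp
  qed (erule conjE, rule uniq)
  have diag: "gl_act \<rho> \<nu> = \<nu>"
    if "\<nu> \<in> D_naive S2_tilde \<and> (\<forall>U. basic_mat U \<longrightarrow> \<nu> U = mu H U)"
      and \<rho>: "invertible \<rho> \<and> \<rho> $ 1 $ 2 = 0 \<and> \<rho> $ 2 $ 1 = 0" for \<nu> and \<rho> :: "rat^2^2"
  proof -
    \<comment> \<open>Uniqueness transfers the invariance of the explicit distribution to any
      extension of \<open>mu\<close>.\<close>
    have "\<nu> = eis_dist H" using that(1) by (elim conjE) (rule uniq)
    then show ?thesis using gl_act_eis_dist[OF assms] \<rho> by simp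
  qed
  show ?thesis
    by (rule conjI, intro allI impI, rule additive, assumption+, rule conjI, rule unique)
      (intro allI impI, rule diag)
qed

end
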